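(* Let $\{a(x,y) : x\le y,\ x,y\in\mathbb N\}$ be jointly independent real random variables, extended by $a(y,x)=a(x,y)$, such that $\mathbf E[a(x,y)]^{2k+1}=0$ for all $x,y,k$, $\mathbf E[a(x,y)]^2=1$ for all $x,y$, and $V_{2k}:=\sup_{x,y}\mathbf E[a(x,y)]^{2k}<\infty$ for all $k\in\mathbb N$. Assume that there exists $\delta>0$ such that $$V_{2k}\le k^{\delta k}\qquad\text{for all } k\in\mathbb N .$$ Let $A_N^{(p)}$ be the dilute random matrix with parameter $p=p_N\le N$ built from the $a(x,y)$ (see context). Let $\delta'>2\delta$ and let $N,p\to\infty$ in such a way that $$\frac{p}{(\log N)^{1+\delta'}}\to\infty .$$ Then $\|A_N^{(p)}\|$ converges to $2$ in probability, i.e. for every $\varepsilon>0$, $$\lim_{N,p\to\infty}(\mu_a\otimes\mu_d)\left\{\left|\,\|A_N^{(p)}\|-2\,\right|>\varepsilon\right\}=0 .$$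
   Context: For each $N$ and $0<p\le N$ let $\{d_N(x,y) : 1\le x\le y\le N\}$ be independent random variables, also independent of the family $\{a(x,y)\}$, with $d_N(x,y)=1$ with probability $p/N$ and $d_N(x,y)=0$ with probability $1-p/N$; put $d_N(y,x)=d_N(x,y)$. The dilute random matrix $A_N^{(p)}$ is the $N\times N$ real symmetric matrix with entries $$A_N^{(p)}(x,y)=\frac{1}{\sqrt p}\,a(x,y)\,d_N(x,y),\qquad x,y=1,\dots,N .$$ $\mu_a$ denotes the probability measure (with expectation $\mathbf E$) of the family $\{a(x,y)\}$ and $\mu_d$ that of the family $\{d_N(x,y)\}$; $\mu_a\otimes\mu_d$ is the product measure. $\|\cdot\|$ is the spectral norm, i.e. $\|A_N^{(p)}\|$ is the maximum of the absolute values of the eigenvalues of $A_N^{(p)}$. *)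

theory Defs
  imports
    "HOL-Probability.Probability"
    "Jordan_Normal_Form.Spectral_Radius"
begin

text \<open>
  Matrix rows and columns are numbered from 0, while the families \<open>a\<close> and \<open>d\<close> are used at
  indices starting from 1.
\<close>

definition dilute_matrix ::
  "nat \<Rightarrow> real \<Rightarrow> (nat \<Rightarrow> nat \<Rightarrow> real) \<Rightarrow> (nat \<Rightarrow> nat \<Rightarrow> real) \<Rightarrow> real mat" where
  "dilute_matrix N p a d =
     mat N N (\<lambda>(i, j). 1 / sqrt p * a (Suc i) (Suc j) * d (Suc i) (Suc j))"

text \<open>
  For a real symmetric matrix all complex eigenvalues are real, so the maximum of the absolute
  values of the eigenvalues is the \<^const>\<open>spectral_radius\<close> of the complexified matrix.
\<close>

definition spectral_norm :: "real mat \<Rightarrow> real" where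
  "spectral_norm A = spectral_radius (map_mat complex_of_real A)"

text \<open>
  The \<open>n\<close>-th moment supremum, for even \<open>n\<close>.  It is formed in the extended nonnegative reals, so
  that it is \<open>\<infinity>\<close> when some moment diverges or the moments are unbounded; finiteness for all
  even \<open>n\<close> thus includes the existence of all moments.
\<close>

definition moment_sup :: "'w measure \<Rightarrow> (nat \<Rightarrow> nat \<Rightarrow> 'w \<Rightarrow> real) \<Rightarrow> nat \<Rightarrow> ennreal" where
  "moment_sup M a n = (SUP (x, y) \<in> {1..} \<times> {1..}. \<integral>\<^sup>+ w. ennreal (a x y w ^ n) \<partial>M)"

end

theory Submission
  imports Defs "HOL-Real_Asymp.Real_Asymp"
begin

text \<open>
  Expand the powers of the matrix over walks and sort the walks by the set \<open>T\<close> of edges that they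
  traverse an odd number of times.  As odd moments vanish, the parts belonging to different \<open>T\<close> are
  orthogonal.  For a fixed matrix, multiplication acts on functions of pairs (vertex, \<open>T\<close>) as the sum
  of an operator that adds an edge to \<open>T\<close> and its adjoint, which removes one.  By Cauchy-Schwarz
  both have norm at most \<open>sqrt \<rho>\<close> on sets of at most \<open>n\<close> edges, where
  \<open>\<rho> = R + 2 n \<eta>\<close>, \<open>R\<close> is the largest row sum of the squared entries and \<open>\<eta>\<close> the largest
  squared entry.  Counting the sequences of additions and removals by ballot numbers bounds the
  diagonal entries of the expected \<open>2k\<close>-th power by the expectation of \<open>4\<^sup>k \<rho>\<^sup>k\<close>.  With \<open>k\<close> of the
  order of \<open>log N\<close>, truncation at \<open>\<eta> \<approx> 1 / k\<close> shows that this costs no more than \<open>(4 + o(1))\<^sup>k\<close>, whence the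
  upper bound on the norm.  The moments of order \<open>log\<^sup>2 N\<close> that control the truncated part are
  responsible for the condition \<open>\<delta>' > 2 \<delta>\<close>.

  For the lower bound let \<open>m\<close> be fixed.  The expectation of a diagonal entry of the \<open>2m\<close>-th power is
  almost at least the \<open>m\<close>-th Catalan number, by counting the walks that double simple paths, and
  the same operator bounds show that its second moment is at most the square of that number up
  to \<open>o(1)\<close>, because the states that are not simple paths have norm \<open>O(sqrt \<eta>)\<close>.  Hence the entry
  concentrates, and the Catalan numbers grow like \<open>4\<^sup>m\<close>.
\<close>

subsection \<open>Ballot numbers\<close>

text \<open>Counting walks by the multiplicities of their edges would bring in, edge by edge,
  moments that may grow like k^(\<delta> k). Keeping parities only makes the combinatorial part
  deterministic: in each realization it is an inequality with the single random quantity
  \<open>rho\<close>, and the upper bound reduces to the k-th moment of \<open>rho\<close>. The same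
  inequalities, applied to a fixed power, give the second moment for the lower bound.

  The obstacle is the part of that moment due to large entries. Summing them over all edges before
  taking the power costs (N^2)^k, that is exp(O(L^2)) with L = ln N and k of order L, whereas k
  moments gain only p^-k, which is exp(-O(L ln L)) if p is a power of L. Therefore a further
  exponent j of order L^2 is spent on the event that an entry exceeds the truncation level.\<close>

text \<open>Number of nonnegative lattice paths with steps \<open>\<plusminus>1\<close> from \<open>0\<close> to \<open>j\<close>.\<close>

fun ballot :: "nat \<Rightarrow> nat \<Rightarrow> nat" where
  "ballot 0 j = (if j = 0 then 1 else 0)"
| "ballot (Suc n) 0 = ballot n 1"
| "ballot (Suc n) (Suc j) = ballot n j + ballot n (Suc (Suc j))"

lemma ballot_le: "ballot n j \<le> 2 ^ n"
proof (induction n j rule: ballot.induct)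
  case (3 n j)
  then show ?case by simp
qed auto

lemma ballot_eq_0: "n < j \<Longrightarrow> ballot n j = 0"
  by (induction n j rule: ballot.induct) auto

text \<open>Reflection principle: the first binomial counts all paths with i downward steps, the
  subtracted one those that reach -1. The induction is Pascal's rule; at j = 0 it also uses that the
  two middle coefficients of an odd row agree.\<close>

lemma ballot_eq:
  "n = j + 2 * i \<Longrightarrow> real (ballot n j) = real (n choose i) - (if i = 0 then 0 else real (n choose (i - 1)))"
proof (induction n arbitrary: i j)
  case (Suc n)
  show ?case
  proof (cases j)
    case 0
    then obtain k where i: "i = Suc k" using Suc.prems by (cases i) auto
    have n: "n = 1 + 2 * k" using Suc.prems 0 i by simp
    have B: "real (ballot n 1) = real (n choose k) - (if k = 0 then 0 else real (n choose (k - 1)))"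
      using Suc.IH[OF n] .
    have "n choose Suc k = n choose (n - Suc k)" by (rule binomial_symmetric) (simp add: n)
    also have "n - Suc k = k" by (simp add: n)
    finally have "n choose Suc k = n choose k" .
    with B show ?thesis unfolding 0 i by (cases k) auto
  next
    case j: (Suc j')
    have n: "n = j' + 2 * i" using Suc.prems j by simp
    have A: "real (ballot n j') = real (n choose i) - (if i = 0 then 0 else real (n choose (i - 1)))"
      using Suc.IH[OF n] .
    show ?thesis
    proof (cases i)
      case 0
      then have "ballot n (Suc (Suc j')) = 0" using n by (intro ballot_eq_0) simp
      with A 0 j show ?thesis by simp
    next
      case i: (Suc k)
      have n2: "n = Suc (Suc j') + 2 * k" using n i by simp
      have "real (ballot n (Suc (Suc j'))) = real (n choose k) - (if k = 0 then 0 else real (n choose (k - 1)))"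
        using Suc.IH[OF n2] .
      with A show ?thesis unfolding i j by (cases k) auto
    qed
  qed
qed auto

text \<open>\<open>ballot (2 * m) 0\<close> is the m-th Catalan number, the central binomial
  coefficient divided by m + 1, and that coefficient is at least 4^m / (2 m). The polynomial factor
  is harmless because only the exponential rate is used.\<close>

lemma ballot_closed_ge: "4 ^ m \<le> real (ballot (2 * m) 0) * (2 * (real m + 1) ^ 2)"
proof (cases m)
  case (Suc k)
  let ?c = "real ((2 * m) choose m)"
  have B: "real (ballot (2 * m) 0) = ?c - real ((2 * m) choose k)"
    using ballot_eq[of "2 * m" 0 m] unfolding Suc by simp
  have "Suc k * ((2 * m) choose Suc k) = (2 * m - k) * ((2 * m) choose k)"
    by (simp only: binomial_absorption binomial_absorb_comp)
  also have "2 * m - k = m + 1" by (simp add: Suc)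
  finally have "m * ((2 * m) choose m) = (m + 1) * ((2 * m) choose k)" unfolding Suc[symmetric] .
  then have "real m * ?c = (real m + 1) * real ((2 * m) choose k)"
    by (metis of_nat_1 of_nat_add of_nat_mult)
  then have eq: "(real m + 1) * real (ballot (2 * m) 0) = ?c"
    unfolding B by (simp only: right_diff_distrib, simp only: distrib_right)
  have "4 ^ m \<le> ?c * (2 * real m)"
    using central_binomial_lower_bound[of m] Suc by (simp add: pos_divide_le_eq)
  also have "\<dots> \<le> ?c * (2 * (real m + 1))"
    by (intro mult_left_mono) auto
  finally show ?thesis unfolding eq[symmetric] power2_eq_square by (simp only: mult_ac)
qed simp

subsection \<open>Walk sums refined by the set of edges of odd multiplicity\<close>

text \<open>Unordered pairs, a loop at u being the singleton {u}. Indexing by edges encodes the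
  symmetry of the matrix and leaves one independent variable per index.\<close>

definition edges :: "'v set \<Rightarrow> 'v set set" where
  "edges V = (\<lambda>(u, w). {u, w}) ` (V \<times> V)"

definition flip :: "'e \<Rightarrow> 'e set \<Rightarrow> 'e set" where
  "flip e T = (if e \<in> T then T - {e} else insert e T)"

text \<open>Sum, over the walks of length \<open>n\<close> from \<open>v\<close> to \<open>u\<close> in which exactly the edges in \<open>T\<close> are
  traversed an odd number of times, of the product of the weights of the steps.\<close>

primrec walk_sum :: "'v set \<Rightarrow> 'v \<Rightarrow> ('v set \<Rightarrow> real) \<Rightarrow> nat \<Rightarrow> 'v \<Rightarrow> 'v set set \<Rightarrow> real" where
  "walk_sum V v Y 0 u T = (if u = v \<and> T = {} then 1 else 0)"
| "walk_sum V v Y (Suc n) u T = (\<Sum>w\<in>V. Y {w, u} * walk_sum V v Y n w (flip {w, u} T))"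

lemma flip_flip [simp]: "flip e (flip e T) = T"
  by (auto simp: flip_def)

lemma edgesI [intro]: "u \<in> V \<Longrightarrow> w \<in> V \<Longrightarrow> {u, w} \<in> edges V"
  by (auto simp: edges_def)

lemma finite_edges [simp]: "finite V \<Longrightarrow> finite (edges V)"
  by (simp add: edges_def)

lemma flip_subset_iff: "e \<in> E \<Longrightarrow> flip e T \<subseteq> E \<longleftrightarrow> T \<subseteq> E"
  by (auto simp: flip_def split: if_splits)

lemma sum_flip:
  fixes g :: "'e set \<Rightarrow> real"
  assumes "e \<in> E"
  shows "(\<Sum>T\<in>Pow E. g (flip e T)) = (\<Sum>T\<in>Pow E. g T)"
  by (rule sum.reindex_bij_witness[where i = "flip e" and j = "flip e"])
    (use assms in \<open>auto simp: flip_subset_iff\<close>)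

text \<open>Flipping a fixed edge permutes the sets of edges, so summing out T turns the refined
  recursion into the recursion of matrix powers.\<close>

lemma walk_sum_total:
  assumes "finite V" "u \<in> V"
  shows "(\<Sum>T\<in>Pow (edges V). walk_sum V v Y (Suc n) u T) =
    (\<Sum>w\<in>V. Y {w, u} * (\<Sum>T\<in>Pow (edges V). walk_sum V v Y n w T))"
proof -
  have "(\<Sum>T\<in>Pow (edges V). walk_sum V v Y (Suc n) u T) =
      (\<Sum>w\<in>V. \<Sum>T\<in>Pow (edges V). Y {w, u} * walk_sum V v Y n w (flip {w, u} T))"
    by (simp add: sum.swap[of _ V])
  also have "\<dots> = (\<Sum>w\<in>V. \<Sum>T\<in>Pow (edges V). Y {w, u} * walk_sum V v Y n w T)"
    using assms
    by (intro sum.cong refl sum_flip[where g = "\<lambda>T. Y {_, u} * walk_sum V v Y n _ T"]) auto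
  finally show ?thesis by (simp add: sum_distrib_left)
qed

text \<open>Each step changes T by one edge. The norm bounds for the step operators concern
  functions supported on states with few edges, and this provides the support condition.\<close>

lemma card_walk_sum_support:
  assumes "finite T" "walk_sum V v Y n u T \<noteq> 0"
  shows "card T \<le> n"
  using assms
proof (induction n arbitrary: u T)
  case (Suc n)
  then obtain w where w: "w \<in> V" "walk_sum V v Y n w (flip {w, u} T) \<noteq> 0"
    by (auto elim!: sum.not_neutral_contains_not_neutral)
  with Suc have "card (flip {w, u} T) \<le> n" by (auto simp: flip_def)
  moreover have "card T \<le> Suc (card (flip {w, u} T))"
    using Suc.prems(1) by (auto simp: flip_def card_insert_if)
  ultimately show ?case by simp
qed (auto split: if_splits)

section \<open>The operators that add and remove an edge of odd multiplicity\<close>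

definition states :: "'v set \<Rightarrow> ('v \<times> 'v set set) set" where
  "states V = V \<times> Pow (edges V)"

definition step_up :: "'v set \<Rightarrow> ('v set \<Rightarrow> real) \<Rightarrow> ('v \<times> 'v set set \<Rightarrow> real) \<Rightarrow> 'v \<times> 'v set set \<Rightarrow> real"
  where "step_up V Y f = (\<lambda>(u, T). \<Sum>w\<in>V. if {w, u} \<in> T then Y {w, u} * f (w, T - {{w, u}}) else 0)"

definition step_down :: "'v set \<Rightarrow> ('v set \<Rightarrow> real) \<Rightarrow> ('v \<times> 'v set set \<Rightarrow> real) \<Rightarrow> 'v \<times> 'v set set \<Rightarrow> real"
  where "step_down V Y f = (\<lambda>(u, T). \<Sum>w\<in>V. if {w, u} \<in> T then 0 else Y {w, u} * f (w, insert {w, u} T))"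

lemma finite_states [simp]: "finite V \<Longrightarrow> finite (states V)"
  by (simp add: states_def)

lemma walk_sum_Suc_steps:
  "walk_sum V v Y (Suc n) u T =
    step_up V Y (\<lambda>(u, T). walk_sum V v Y n u T) (u, T) +
    step_down V Y (\<lambda>(u, T). walk_sum V v Y n u T) (u, T)"
proof -
  have "walk_sum V v Y (Suc n) u T = (\<Sum>w\<in>V.
      (if {w, u} \<in> T then Y {w, u} * walk_sum V v Y n w (T - {{w, u}}) else 0) +
      (if {w, u} \<in> T then 0 else Y {w, u} * walk_sum V v Y n w (insert {w, u} T)))"
    unfolding walk_sum.simps by (intro sum.cong refl) (simp add: flip_def)
  then show ?thesis unfolding step_up_def step_down_def prod.case by (simp only: sum.distrib)
qed

text \<open>A transition can be recorded by its end (u, T), with {w, u} in T, or by its start (w,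
  S), where S = T - {{w, u}}. Both the adjointness and the Cauchy-Schwarz estimate below rest on
  this change of variables.\<close>

lemma sum_states_swap:
  fixes g :: "'v \<Rightarrow> 'v \<Rightarrow> 'v set set \<Rightarrow> real"
  assumes "finite V"
  shows "(\<Sum>(u, T)\<in>states V. \<Sum>w\<in>V. if {w, u} \<in> T then g w u (T - {{w, u}}) else 0) =
    (\<Sum>(w, S)\<in>states V. \<Sum>u\<in>V. if {w, u} \<in> S then 0 else g w u S)"
proof -
  have 1: "(\<Sum>T\<in>Pow (edges V). if {w, u} \<in> T then g w u (T - {{w, u}}) else 0) =
      (\<Sum>S\<in>Pow (edges V). if {w, u} \<in> S then 0 else g w u S)" if "u \<in> V" "w \<in> V" for u w
    unfolding sum_flip[where E = "edges V" and e = "{w, u}" and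
        g = "\<lambda>S. if {w, u} \<in> S then 0 else g w u S", symmetric, OF edgesI[OF that(2,1)]]
    by (intro sum.cong refl) (auto simp: flip_def)
  have "(\<Sum>(u, T)\<in>states V. \<Sum>w\<in>V. if {w, u} \<in> T then g w u (T - {{w, u}}) else 0) =
      (\<Sum>u\<in>V. \<Sum>w\<in>V. \<Sum>T\<in>Pow (edges V). if {w, u} \<in> T then g w u (T - {{w, u}}) else 0)"
    by (simp add: states_def sum.cartesian_product[symmetric] sum.swap[of _ V "Pow (edges V)"])
  also have "\<dots> = (\<Sum>u\<in>V. \<Sum>w\<in>V. \<Sum>S\<in>Pow (edges V). if {w, u} \<in> S then 0 else g w u S)"
    by (intro sum.cong refl 1)
  also have "\<dots> = (\<Sum>w\<in>V. \<Sum>u\<in>V. \<Sum>S\<in>Pow (edges V). if {w, u} \<in> S then 0 else g w u S)"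
    by (rule sum.swap)
  also have "\<dots> = (\<Sum>(w, S)\<in>states V. \<Sum>u\<in>V. if {w, u} \<in> S then 0 else g w u S)"
    by (simp add: states_def sum.cartesian_product[symmetric] sum.swap[of _ V "Pow (edges V)"])
  finally show ?thesis .
qed

lemma step_adjoint:
  assumes "finite V"
  shows "(\<Sum>s\<in>states V. g s * step_down V Y f s) = (\<Sum>s\<in>states V. step_up V Y g s * f s)"
proof -
  \<comment> \<open>Writing T as \<open>insert {w, u} (T - {{w, u}})\<close> makes the summand a
    function of T - {{w, u}}, the form that the swap requires.\<close>
  have "(\<Sum>s\<in>states V. step_up V Y g s * f s) =
      (\<Sum>(u, T)\<in>states V. \<Sum>w\<in>V. if {w, u} \<in> T then Y {w, u} * g (w, T - {{w, u}}) * f (u, insert {w, u} (T - {{w, u}})) else 0)"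
    by (intro sum.cong refl)
      (auto simp: step_up_def sum_distrib_right insert_absorb intro!: sum.cong)
  also have "\<dots> = (\<Sum>(w, S)\<in>states V. \<Sum>u\<in>V. if {w, u} \<in> S then 0 else Y {w, u} * g (w, S) * f (u, insert {w, u} S))"
    by (rule sum_states_swap[OF assms, where g = "\<lambda>w u S. Y {w, u} * g (w, S) * f (u, insert {w, u} S)"])
  also have "\<dots> = (\<Sum>s\<in>states V. g s * step_down V Y f s)"
    by (intro sum.cong refl)
      (auto simp: step_down_def sum_distrib_left insert_commute ac_simps intro!: sum.cong)
  finally show ?thesis by simp
qed

lemma card_orientations_le: "finite {p. {snd p, fst p} = e} \<and> card {p. {snd p, fst p} = e} \<le> 2"
proof (cases "{p. {snd p, fst p} = e} = {}")
  case False
  then obtain q where q: "{snd q, fst q} = e" by blast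
  have sub: "{p. {snd p, fst p} = e} \<subseteq> {q, (snd q, fst q)}"
  proof
    fix p assume "p \<in> {p. {snd p, fst p} = e}"
    then have "{snd p, fst p} = {snd q, fst q}" using q by simp
    then show "p \<in> {q, (snd q, fst q)}"
      by (cases p; cases q) (auto simp: doubleton_eq_iff)
  qed
  then have "card {p. {snd p, fst p} = e} \<le> card {q, (snd q, fst q)}" by (intro card_mono) auto
  also have "\<dots> \<le> 2" by (simp add: card_insert_if)
  finally show ?thesis using finite_subset[OF sub] by simp
next
  case True
  show ?thesis unfolding True by simp
qed

text \<open>Handshake argument: every counted pair (u, w) is an orientation of an edge of S, and an
  edge has at most two orientations. This is the origin of the term 2 n \<eta> in the operator
  bound.\<close>

lemma sum_card_incident_le:
  assumes "finite V" "finite S"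
  shows "(\<Sum>u\<in>V. card {w\<in>V. {w, u} \<in> S}) \<le> 2 * card S"
proof -
  have "(\<Sum>u\<in>V. card {w\<in>V. {w, u} \<in> S}) = card (SIGMA u:V. {w\<in>V. {w, u} \<in> S})"
    using assms by (subst card_SigmaI) auto
  also have "\<dots> \<le> card (\<Union>e\<in>S. {p. {snd p, fst p} = e})"
    using assms(2) card_orientations_le[THEN conjunct1] by (intro card_mono finite_UN_I) auto
  also have "\<dots> \<le> (\<Sum>e\<in>S. card {p. {snd p, fst p} = e})"
    using assms by (intro card_UN_le)
  also have "\<dots> \<le> (\<Sum>e\<in>S. 2)"
    by (intro sum_mono card_orientations_le[THEN conjunct2])
  finally show ?thesis by simp
qed

text \<open>Purely deterministic. It is interpreted separately in every realization, with R the
  largest row sum of squared entries and \<eta> the largest squared entry of that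
  realization.\<close>

locale weight_bounds =
  fixes V :: "'v set" and Y :: "'v set \<Rightarrow> real" and R \<eta> :: real
  assumes finite_V: "finite V"
    and row_le: "\<And>w. w \<in> V \<Longrightarrow> (\<Sum>u\<in>V. (Y {w, u})\<^sup>2) \<le> R"
    and entry_le: "\<And>w u. w \<in> V \<Longrightarrow> u \<in> V \<Longrightarrow> (Y {w, u})\<^sup>2 \<le> \<eta>"
    and R_nonneg: "0 \<le> R" and eta_nonneg: "0 \<le> \<eta>"
begin

lemma abs_prod_le:
  assumes "w \<in> V" "u \<in> V" "w' \<in> V" "u' \<in> V"
  shows "\<bar>Y {w, u}\<bar> * \<bar>Y {w', u'}\<bar> \<le> \<eta>"
proof -
  have "\<bar>Y {w, u}\<bar> \<le> sqrt \<eta>" "\<bar>Y {w', u'}\<bar> \<le> sqrt \<eta>"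
    using assms entry_le by (auto intro!: real_le_rsqrt)
  then have "\<bar>Y {w, u}\<bar> * \<bar>Y {w', u'}\<bar> \<le> sqrt \<eta> * sqrt \<eta>"
    by (intro mult_mono) (auto simp: eta_nonneg)
  then show ?thesis using eta_nonneg by simp
qed

text \<open>A Schur test with weights |Y e|. After the change of variables the coefficient of f(w,
  S)^2 is the sum over u of |Y {w, u}| times the absolute weights at u of the edges in
  \<open>insert {w, u} S\<close>. The new edge itself contributes at most R in total; the edges
  already in S contribute at most \<eta> per incidence, and there are at most 2 n
  incidences.\<close>

lemma step_up_square_le:
  assumes supp: "\<And>w S. (w, S) \<in> states V \<Longrightarrow> f (w, S) \<noteq> 0 \<Longrightarrow> card S \<le> n"
  shows "(\<Sum>s\<in>states V. (step_up V Y f s)\<^sup>2) \<le> (R + 2 * real n * \<eta>) * (\<Sum>s\<in>states V. (f s)\<^sup>2)"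
proof -
  \<comment> \<open>Only the edges of T at u enter; the sum of a whole row of absolute weights is
    not bounded in terms of R and \<eta>.\<close>
  define c where "c u T = (\<Sum>w\<in>V. if {w, u} \<in> T then \<bar>Y {w, u}\<bar> else 0)" for u T
  have CS: "(step_up V Y f (u, T))\<^sup>2 \<le>
      (\<Sum>w\<in>V. if {w, u} \<in> T then \<bar>Y {w, u}\<bar> * (f (w, T - {{w, u}}))\<^sup>2 * c u (insert {w, u} (T - {{w, u}})) else 0)"
    for u T
  proof -
    define x where "x w = (if {w, u} \<in> T then sqrt \<bar>Y {w, u}\<bar> else 0)" for w
    have "\<bar>step_up V Y f (u, T)\<bar> \<le> (\<Sum>w\<in>V. \<bar>x w\<bar> * \<bar>x w * f (w, T - {{w, u}})\<bar>)"
      unfolding step_up_def prod.case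
      by (rule order.trans[OF sum_abs], intro sum_mono) (auto simp: x_def abs_mult simp flip: mult.assoc)
    also have "\<dots> \<le> L2_set x V * L2_set (\<lambda>w. x w * f (w, T - {{w, u}})) V"
      by (rule L2_set_mult_ineq)
    finally have "(step_up V Y f (u, T))\<^sup>2 \<le> (L2_set x V * L2_set (\<lambda>w. x w * f (w, T - {{w, u}})) V)\<^sup>2"
      by (rule abs_le_square_iff[THEN iffD1, OF order.trans]) simp
    also have "\<dots> = (\<Sum>w\<in>V. (x w)\<^sup>2) * (\<Sum>w\<in>V. (x w)\<^sup>2 * (f (w, T - {{w, u}}))\<^sup>2)"
      by (simp add: L2_set_def power_mult_distrib sum_nonneg)
    also have "(\<Sum>w\<in>V. (x w)\<^sup>2) = c u T"
      unfolding c_def by (intro sum.cong) (auto simp: x_def)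
    also have "c u T * (\<Sum>w\<in>V. (x w)\<^sup>2 * (f (w, T - {{w, u}}))\<^sup>2) =
        (\<Sum>w\<in>V. if {w, u} \<in> T then \<bar>Y {w, u}\<bar> * (f (w, T - {{w, u}}))\<^sup>2 * c u (insert {w, u} (T - {{w, u}})) else 0)"
      unfolding sum_distrib_left by (intro sum.cong) (auto simp: x_def insert_absorb)
    finally show ?thesis .
  qed
  have inner: "(\<Sum>u\<in>V. if {w, u} \<in> S then 0 else \<bar>Y {w, u}\<bar> * (f (w, S))\<^sup>2 * c u (insert {w, u} S))
      \<le> (R + 2 * real n * \<eta>) * (f (w, S))\<^sup>2" if s: "(w, S) \<in> states V" for w S
  proof (cases "f (w, S) = 0")
    case False
    then have cS: "card S \<le> n" using supp s by simp
    from s have w: "w \<in> V" and "S \<subseteq> edges V" by (auto simp: states_def)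
    then have fS: "finite S" using finite_V finite_edges finite_subset by blast
    have term_le: "(if {w, u} \<in> S then 0 else \<bar>Y {w, u}\<bar> * c u (insert {w, u} S))
        \<le> (Y {w, u})\<^sup>2 + \<eta> * real (card {w'\<in>V. {w', u} \<in> S})" if u: "u \<in> V" for u
    proof -
      have "\<bar>Y {w, u}\<bar> * c u (insert {w, u} S)
          \<le> (\<Sum>w'\<in>V. (if w' = w then (Y {w, u})\<^sup>2 else 0) + (if {w', u} \<in> S then \<eta> else 0))"
        unfolding c_def sum_distrib_left
      proof (rule sum_mono)
        fix w' assume "w' \<in> V"
        then show "\<bar>Y {w, u}\<bar> * (if {w', u} \<in> insert {w, u} S then \<bar>Y {w', u}\<bar> else 0)
            \<le> (if w' = w then (Y {w, u})\<^sup>2 else 0) + (if {w', u} \<in> S then \<eta> else 0)"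
          using abs_prod_le[OF w u \<open>w' \<in> V\<close> u] eta_nonneg
          by (auto simp: doubleton_eq_iff power2_eq_square)
      qed
      also have "\<dots> = (Y {w, u})\<^sup>2 + \<eta> * real (card {w'\<in>V. {w', u} \<in> S})"
        using finite_V w by (simp add: sum.distrib sum.If_cases Int_def)
      finally show ?thesis using eta_nonneg by auto
    qed
    have "(\<Sum>u\<in>V. if {w, u} \<in> S then 0 else \<bar>Y {w, u}\<bar> * (f (w, S))\<^sup>2 * c u (insert {w, u} S))
        = (\<Sum>u\<in>V. if {w, u} \<in> S then 0 else \<bar>Y {w, u}\<bar> * c u (insert {w, u} S)) * (f (w, S))\<^sup>2"
      unfolding sum_distrib_right by (intro sum.cong) auto
    also have "\<dots> \<le> (\<Sum>u\<in>V. (Y {w, u})\<^sup>2 + \<eta> * real (card {w'\<in>V. {w', u} \<in> S})) * (f (w, S))\<^sup>2"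
      by (intro mult_right_mono sum_mono term_le) auto
    also have "\<dots> = ((\<Sum>u\<in>V. (Y {w, u})\<^sup>2) + \<eta> * real (\<Sum>u\<in>V. card {w'\<in>V. {w', u} \<in> S})) * (f (w, S))\<^sup>2"
      by (simp add: sum.distrib sum_distrib_left)
    also have "\<dots> \<le> (R + \<eta> * real (2 * n)) * (f (w, S))\<^sup>2"
      using sum_card_incident_le[OF finite_V fS] cS row_le[OF w] eta_nonneg
      by (intro mult_right_mono add_mono mult_left_mono) (auto simp del: of_nat_sum)
    finally show ?thesis by (simp add: mult_ac)
  qed (simp cong: if_cong)
  have "(\<Sum>s\<in>states V. (step_up V Y f s)\<^sup>2) \<le>
      (\<Sum>(u, T)\<in>states V. \<Sum>w\<in>V. if {w, u} \<in> T then \<bar>Y {w, u}\<bar> * (f (w, T - {{w, u}}))\<^sup>2 * c u (insert {w, u} (T - {{w, u}})) else 0)"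
    by (intro sum_mono) (clarify, rule CS)
  also have "\<dots> = (\<Sum>(w, S)\<in>states V. \<Sum>u\<in>V. if {w, u} \<in> S then 0 else \<bar>Y {w, u}\<bar> * (f (w, S))\<^sup>2 * c u (insert {w, u} S))"
    by (rule sum_states_swap[OF finite_V, where g = "\<lambda>w u S. \<bar>Y {w, u}\<bar> * (f (w, S))\<^sup>2 * c u (insert {w, u} S)"])
  also have "\<dots> \<le> (\<Sum>s\<in>states V. (R + 2 * real n * \<eta>) * (f s)\<^sup>2)"
    by (intro sum_mono) (clarify, rule inner)
  finally show ?thesis by (simp add: sum_distrib_left)
qed

lemma step_up_norm_le:
  assumes "\<And>w S. (w, S) \<in> states V \<Longrightarrow> f (w, S) \<noteq> 0 \<Longrightarrow> card S \<le> n"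
    and "R + 2 * real n * \<eta> \<le> \<rho>"
  shows "L2_set (step_up V Y f) (states V) \<le> sqrt \<rho> * L2_set f (states V)"
proof -
  have "(\<Sum>s\<in>states V. (step_up V Y f s)\<^sup>2) \<le> \<rho> * (\<Sum>s\<in>states V. (f s)\<^sup>2)"
    using step_up_square_le[OF assms(1)] mult_right_mono[OF assms(2) sum_nonneg, of "states V" "\<lambda>s. (f s)\<^sup>2"]
    by fastforce
  then show ?thesis by (simp add: L2_set_def real_sqrt_mult[symmetric])
qed

text \<open>The usual argument for adjoints: the squared norm of g = \<open>step_down V Y f\<close>
  is the inner product of \<open>step_up V Y g\<close> with f. The bound for \<open>step_up\<close>
  applies to g because removing an edge preserves the support condition.\<close>

lemma step_down_norm_le:
  assumes supp: "\<And>w S. (w, S) \<in> states V \<Longrightarrow> f (w, S) \<noteq> 0 \<Longrightarrow> card S \<le> n"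
    and rho: "R + 2 * real n * \<eta> \<le> \<rho>"
  shows "L2_set (step_down V Y f) (states V) \<le> sqrt \<rho> * L2_set f (states V)"
proof -
  let ?g = "step_down V Y f"
  have supp': "card S \<le> n" if s: "(u, S) \<in> states V" and nz: "?g (u, S) \<noteq> 0" for u S
  proof -
    obtain w where w: "w \<in> V" "{w, u} \<notin> S" "f (w, insert {w, u} S) \<noteq> 0"
      using nz by (auto simp: step_down_def elim!: sum.not_neutral_contains_not_neutral split: if_splits)
    have "(w, insert {w, u} S) \<in> states V" using s w by (auto simp: states_def)
    from supp[OF this w(3)] have "card (insert {w, u} S) \<le> n" .
    moreover have "finite S"
      using s finite_V finite_edges finite_subset unfolding states_def by blast
    ultimately show ?thesis using w(2) by simp
  qed
  have "(L2_set ?g (states V))\<^sup>2 = (\<Sum>s\<in>states V. ?g s * ?g s)"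
    by (simp add: L2_set_def sum_nonneg power2_eq_square)
  also have "\<dots> = (\<Sum>s\<in>states V. step_up V Y ?g s * f s)"
    by (rule step_adjoint[OF finite_V])
  also have "\<dots> \<le> (\<Sum>s\<in>states V. \<bar>step_up V Y ?g s\<bar> * \<bar>f s\<bar>)"
    by (intro sum_mono) (metis abs_ge_self abs_mult)
  also have "\<dots> \<le> L2_set (step_up V Y ?g) (states V) * L2_set f (states V)"
    by (rule L2_set_mult_ineq)
  also have "\<dots> \<le> (sqrt \<rho> * L2_set ?g (states V)) * L2_set f (states V)"
    by (intro mult_right_mono step_up_norm_le[OF supp' rho]) auto
  finally have "L2_set ?g (states V) * L2_set ?g (states V) \<le> L2_set ?g (states V) * (sqrt \<rho> * L2_set f (states V))"
    by (simp add: power2_eq_square mult_ac)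
  moreover have "0 \<le> L2_set ?g (states V)" by simp
  moreover have "0 \<le> sqrt \<rho> * L2_set f (states V)"
    using rho R_nonneg eta_nonneg by (intro mult_nonneg_nonneg) (auto intro: order.trans[rotated])
  ultimately show ?thesis
    by (cases "L2_set ?g (states V) = 0") (auto simp: mult_le_cancel_left)
qed

end

section \<open>Norms of the walk vectors, sorted by the number of odd edges\<close>

context weight_bounds
begin

abbreviation ws :: "'v \<Rightarrow> nat \<Rightarrow> 'v \<times> 'v set set \<Rightarrow> real" where
  "ws v n \<equiv> \<lambda>(u, T). walk_sum V v Y n u T"

lemma finite_state: "(u, T) \<in> states V \<Longrightarrow> finite T"
  unfolding states_def using finite_V finite_edges finite_subset by blast

lemma ws_Suc: "ws v (Suc n) = (\<lambda>s. step_up V Y (ws v n) s + step_down V Y (ws v n) s)"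
  using walk_sum_Suc_steps[of V v Y n] by (auto simp: fun_eq_iff)

lemma ws_0_norm: "L2_set (ws v 0) (states V) \<le> 1"
proof -
  have "L2_set (ws v 0) (states V) \<le> (\<Sum>s\<in>states V. \<bar>ws v 0 s\<bar>)" by (rule L2_set_le_sum_abs)
  also have "\<dots> = (\<Sum>s\<in>states V. if s = (v, {}) then 1 else 0)"
    by (intro sum.cong) (auto split: if_splits)
  also have "\<dots> \<le> 1" using finite_V by simp
  finally show ?thesis .
qed

text \<open>\<open>step_up\<close> and \<open>step_down\<close> shift the level card T by exactly
  one, so the level norms satisfy the recursion of \<open>ballot\<close> as an inequality. The
  precision serves the lower bound on the spectral norm, where the exact Catalan number is needed;
  for the trace it is later relaxed to 2^n.\<close>

lemma level_norm_le:
  assumes rho: "R + 2 * real k * \<eta> \<le> \<rho>" and "n \<le> k"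
  shows "L2_set (\<lambda>s. if card (snd s) = j then ws v n s else 0) (states V) \<le> real (ballot n j) * sqrt \<rho> ^ n"
  using \<open>n \<le> k\<close>
proof (induction n arbitrary: j)
  case 0
  show ?case
  proof (cases "j = 0")
    case True
    have "L2_set (\<lambda>s. if card (snd s) = j then ws v 0 s else 0) (states V) = L2_set (ws v 0) (states V)"
      by (intro L2_set_cong) (auto simp: True)
    then show ?thesis using ws_0_norm[of v] True by simp
  next
    case False
    then have "L2_set (\<lambda>s. if card (snd s) = j then ws v 0 s else 0) (states V) = 0"
      by (intro L2_set_0') auto
    then show ?thesis using False by simp
  qed
next
  case (Suc n)
  have rho': "R + 2 * real n * \<eta> \<le> \<rho>"
  proof -
    have "2 * real n * \<eta> \<le> 2 * real k * \<eta>"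
      using Suc.prems eta_nonneg by (intro mult_right_mono mult_left_mono) auto
    then show ?thesis using rho by linarith
  qed
  have r0: "0 \<le> \<rho>" using rho' R_nonneg eta_nonneg by (meson add_nonneg_nonneg mult_nonneg_nonneg of_nat_0_le_iff order.trans zero_le_numeral)
  define L where "L i s = (if card (snd s) = i then ws v n s else 0)" for i s
  have supp: "card S \<le> n" if "(w, S) \<in> states V" "L i (w, S) \<noteq> 0" for i w S
    using that card_walk_sum_support[OF finite_state[OF that(1)]] by (auto simp: L_def split: if_splits)
  have IH: "sqrt \<rho> * L2_set (L i) (states V) \<le> sqrt \<rho> * (real (ballot n i) * sqrt \<rho> ^ n)" for i
    using Suc.IH[of i] Suc.prems r0 unfolding L_def by (intro mult_left_mono) auto
  have up: "L2_set (step_up V Y (L i)) (states V) \<le> sqrt \<rho> * (real (ballot n i) * sqrt \<rho> ^ n)" for i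
    by (rule order.trans[OF step_up_norm_le[OF supp rho'] IH])
  have down: "L2_set (step_down V Y (L i)) (states V) \<le> sqrt \<rho> * (real (ballot n i) * sqrt \<rho> ^ n)" for i
    by (rule order.trans[OF step_down_norm_le[OF supp rho'] IH])
  \<comment> \<open>A single level feeds each operator: level j + 1 under \<open>step_down\<close>,
    and level j - 1 under \<open>step_up\<close>, which yields nothing at level 0.\<close>
  have D: "step_down V Y (ws v n) s = step_down V Y (L (Suc (card (snd s)))) s" if "s \<in> states V" for s
    using that finite_state by (cases s) (auto simp: step_down_def L_def intro!: sum.cong)
  have U: "step_up V Y (ws v n) s = (if card (snd s) = 0 then 0 else step_up V Y (L (card (snd s) - 1)) s)"
    if "s \<in> states V" for s
    using that finite_state by (cases s) (auto simp: step_up_def L_def intro!: sum.cong split: if_splits)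
  have mask: "L2_set (\<lambda>s. if P s then h s else 0) (states V) \<le> L2_set h (states V)" for P h
    unfolding L2_set_def by (intro real_sqrt_le_mono sum_mono) auto
  let ?U = "\<lambda>s. if card (snd s) = j \<and> j \<noteq> 0 then step_up V Y (L (j - 1)) s else 0"
  let ?D = "\<lambda>s. if card (snd s) = j then step_down V Y (L (Suc j)) s else 0"
  have "L2_set (\<lambda>s. if card (snd s) = j then ws v (Suc n) s else 0) (states V) = L2_set (\<lambda>s. ?U s + ?D s) (states V)"
    by (rule L2_set_cong[OF refl]) (simp only: ws_Suc D U, simp)
  also have "\<dots> \<le> L2_set ?U (states V) + L2_set ?D (states V)"
    by (rule L2_set_triangle_ineq)
  also have "\<dots> \<le> (if j = 0 then 0 else sqrt \<rho> * (real (ballot n (j - 1)) * sqrt \<rho> ^ n)) +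
      sqrt \<rho> * (real (ballot n (Suc j)) * sqrt \<rho> ^ n)"
  proof (rule add_mono)
    show "L2_set ?U (states V) \<le> (if j = 0 then 0 else sqrt \<rho> * (real (ballot n (j - 1)) * sqrt \<rho> ^ n))"
      using order.trans[OF mask up, of "\<lambda>s. card (snd s) = j \<and> j \<noteq> 0" "j - 1"]
      by (cases "j = 0") (simp_all add: L2_set_0')
    show "L2_set ?D (states V) \<le> sqrt \<rho> * (real (ballot n (Suc j)) * sqrt \<rho> ^ n)"
      by (rule order.trans[OF mask down])
  qed
  also have "\<dots> = real (ballot (Suc n) j) * sqrt \<rho> ^ Suc n"
    by (cases j) (simp_all add: algebra_simps)
  finally show ?case .
qed

lemma walk_sum_return_le:
  assumes "R + 2 * real n * \<eta> \<le> \<rho>" "v \<in> V"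
  shows "\<bar>walk_sum V v Y n v {}\<bar> \<le> real (ballot n 0) * sqrt \<rho> ^ n"
proof -
  have "\<bar>walk_sum V v Y n v {}\<bar> \<le> L2_set (\<lambda>s. \<bar>if card (snd s) = 0 then ws v n s else 0\<bar>) (states V)"
    using member_le_L2_set[OF finite_states[OF finite_V], of "(v, {})" "\<lambda>s. \<bar>if card (snd s) = 0 then ws v n s else 0\<bar>"]
      assms(2) by (simp add: states_def)
  also have "\<dots> = L2_set (\<lambda>s. if card (snd s) = 0 then ws v n s else 0) (states V)"
    by (simp add: L2_set_def)
  finally show ?thesis using level_norm_le[OF assms(1) order.refl, of 0 v] by linarith
qed

lemma ws_step_norm_le:
  assumes supp: "\<And>w S. (w, S) \<in> states V \<Longrightarrow> f (w, S) \<noteq> 0 \<Longrightarrow> card S \<le> n"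
    and rho: "R + 2 * real n * \<eta> \<le> \<rho>"
  shows "L2_set (\<lambda>s. step_up V Y f s + step_down V Y f s) (states V) \<le> 2 * sqrt \<rho> * L2_set f (states V)"
proof -
  have "L2_set (\<lambda>s. step_up V Y f s + step_down V Y f s) (states V)
      \<le> L2_set (step_up V Y f) (states V) + L2_set (step_down V Y f) (states V)"
    by (rule L2_set_triangle_ineq)
  also have "\<dots> \<le> sqrt \<rho> * L2_set f (states V) + sqrt \<rho> * L2_set f (states V)"
    by (intro add_mono step_up_norm_le[OF assms] step_down_norm_le[OF assms])
  finally show ?thesis by simp
qed

text \<open>A cruder rate than the one by levels. It measures the simple states as a source of
  non-simple ones, a transfer that carries a small factor anyway.\<close>

lemma ws_norm_le:
  assumes rho: "R + 2 * real n * \<eta> \<le> \<rho>"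
  shows "L2_set (ws v n) (states V) \<le> (2 * sqrt \<rho>) ^ n"
  using assms
proof (induction n)
  case (Suc n)
  have "R + 2 * real n * \<eta> \<le> R + 2 * real (Suc n) * \<eta>" using eta_nonneg by (simp add: algebra_simps)
  then have rho: "R + 2 * real n * \<eta> \<le> \<rho>" using Suc.prems by simp
  have r0: "0 \<le> \<rho>" using rho R_nonneg eta_nonneg
    by (meson add_nonneg_nonneg mult_nonneg_nonneg of_nat_0_le_iff order.trans zero_le_numeral)
  have "L2_set (ws v (Suc n)) (states V) \<le> 2 * sqrt \<rho> * L2_set (ws v n) (states V)"
    unfolding ws_Suc using card_walk_sum_support[OF finite_state]
    by (intro ws_step_norm_le[OF _ rho]) auto
  also have "\<dots> \<le> 2 * sqrt \<rho> * (2 * sqrt \<rho>) ^ n"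
    using Suc.IH[OF rho] r0 by (intro mult_left_mono) auto
  finally show ?case by simp
qed (simp add: ws_0_norm del: walk_sum.simps)

end

subsection \<open>Simple paths\<close>

fun path_edges :: "'v list \<Rightarrow> 'v set set" where
  "path_edges (x # y # xs) = insert {x, y} (path_edges (y # xs))"
| "path_edges _ = {}"

text \<open>Paths are listed from the current end u back to the start v, so that moving to a fresh
  vertex prepends an element.\<close>

definition simple_states :: "'v set \<Rightarrow> 'v \<Rightarrow> ('v \<times> 'v set set) set" where
  "simple_states V v = {(u, path_edges (u # xs)) |u xs. distinct (u # xs) \<and> set (u # xs) \<subseteq> V \<and> last (u # xs) = v}"

lemma path_edges_subset: "e \<in> path_edges xs \<Longrightarrow> e \<subseteq> set xs"
  by (induction xs rule: path_edges.induct) auto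

text \<open>The last vertex is added separately because a path with one vertex has no edges.\<close>

lemma path_edges_vertices: "set (x # xs) \<subseteq> insert (last (x # xs)) (\<Union>(path_edges (x # xs)))"
proof (induction xs arbitrary: x)
  case (Cons y ys)
  from Cons[of y] show ?case by auto
qed simp

lemma simple_states_closed: "(v, T) \<in> simple_states V v \<Longrightarrow> T = {}"
  unfolding simple_states_def by (auto split: if_splits)

lemma simple_states_insert:
  assumes "(w, T) \<in> simple_states V v" "u \<in> V" "u \<notin> insert v (\<Union>T)"
  shows "(u, insert {w, u} T) \<in> simple_states V v"
proof -
  obtain xs where xs: "distinct (w # xs)" "set (w # xs) \<subseteq> V" "last (w # xs) = v" "T = path_edges (w # xs)"
    using assms(1) by (auto simp: simple_states_def)
  have "u \<notin> set (w # xs)" using path_edges_vertices[of w xs] assms(3) xs(3,4) by auto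
  then show ?thesis
    unfolding simple_states_def using xs assms(2)
    by (intro CollectI exI[of _ u] exI[of _ "w # xs"]) (auto simp: insert_commute)
qed

text \<open>The end w of a simple path lies on only one of its edges, the one to the next vertex, so
  the removed edge must be that one. Hence removals never lead out of the simple states; only
  additions can.\<close>

lemma simple_states_remove:
  assumes "(w, insert {w, u} T) \<in> simple_states V v" "{w, u} \<notin> T"
  shows "(u, T) \<in> simple_states V v"
proof -
  obtain xs where xs: "distinct (w # xs)" "set (w # xs) \<subseteq> V" "last (w # xs) = v"
      "insert {w, u} T = path_edges (w # xs)"
    using assms(1) by (auto simp: simple_states_def)
  then obtain y ys where y: "xs = y # ys" by (cases xs) auto
  have nin: "e \<notin> path_edges (y # ys)" if "w \<in> e" for e
    using path_edges_subset[of e "y # ys"] xs(1) that y by auto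
  have "{w, u} \<in> path_edges (w # xs)" using xs(4) by blast
  then have "{w, u} = {w, y}" using nin[of "{w, u}"] y by simp
  then have "u = y" by (auto simp: doubleton_eq_iff)
  moreover have "T = path_edges (y # ys)"
    using xs(4) assms(2) nin[of "{w, y}"] unfolding \<open>{w, u} = {w, y}\<close> y path_edges.simps
    by (simp add: insert_ident)
  ultimately show ?thesis
    unfolding simple_states_def using xs y by (intro CollectI exI[of _ y] exI[of _ ys]) auto
qed

lemma card_Union_edges_le:
  assumes "finite V" "S \<subseteq> edges V"
  shows "finite (\<Union>S) \<and> card (\<Union>S) \<le> 2 * card S"
proof -
  have fS: "finite S" using assms finite_edges finite_subset by blast
  have e: "finite e \<and> card e \<le> 2" if "e \<in> S" for e
    using that assms(2) by (auto simp: edges_def card_insert_if)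
  have "card (\<Union>S) \<le> (\<Sum>e\<in>S. card e)" by (rule card_Union_le_sum_card)
  also have "\<dots> \<le> (\<Sum>e\<in>S. 2)" using e by (intro sum_mono) auto
  finally show ?thesis using fS e by auto
qed

text \<open>Every simple path from \<open>v\<close> is a state; prolonging it by a fresh vertex or shortening it by its
  last edge yields the recursion of the ballot numbers.\<close>

lemma simple_path_walk_sum_ge:
  assumes "finite V" "distinct (u # xs)" "set (u # xs) \<subseteq> V" "last (u # xs) = v"
    and "length xs + n < K" "K \<le> card V"
  shows "real (ballot n (length xs)) * sqrt (card V - K) ^ n
    \<le> walk_sum V v (\<lambda>_. 1) n u (path_edges (u # xs)) * sqrt (card V - K) ^ length xs"
  using assms(2-5)
proof (induction n arbitrary: u xs)
  case 0
  then show ?case by (cases xs) auto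
next
  case (Suc n)
  let ?q = "sqrt (card V - K)"
  let ?W = "\<lambda>w T. walk_sum V v (\<lambda>_. 1) n w T"
  have nn: "0 \<le> walk_sum V v (\<lambda>_. 1) n w T" for n w T
    by (induction n arbitrary: w T) (auto intro!: sum_nonneg)
  \<comment> \<open>The induction peels off the last step. A predecessor in F lies on a path with
    one more vertex, and at least card V - K of them exist because the current path has at most K
    vertices; the other predecessor used is the next vertex of the path. Each edge that is added and
    later removed thus contributes the square of \<open>?q\<close>.\<close>
  define F where "F = V - set (u # xs)"
  have cO: "real (card V - K) \<le> real (card F)"
  proof -
    have "card F = card V - card (set (u # xs))"
      unfolding F_def using assms(1) Suc.prems(2) by (intro card_Diff_subset) auto
    then show ?thesis using Suc.prems(1,4) by (simp add: distinct_card)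
  qed
  have fresh: "real (ballot n (Suc (length xs))) * ?q ^ n \<le> ?W w (flip {w, u} (path_edges (u # xs))) * ?q ^ Suc (length xs)"
    if w: "w \<in> F" for w
  proof -
    have "{w, u} \<notin> path_edges (u # xs)" using path_edges_subset[of "{w, u}" "u # xs"] w by (auto simp: F_def)
    then have "flip {w, u} (path_edges (u # xs)) = path_edges (w # u # xs)" by (simp add: flip_def)
    moreover have "real (ballot n (length (u # xs))) * ?q ^ n \<le> ?W w (path_edges (w # u # xs)) * ?q ^ length (u # xs)"
      using Suc.prems w by (intro Suc.IH) (auto simp: F_def)
    ultimately show ?thesis by simp
  qed
  have "real (ballot n (Suc (length xs))) * ?q ^ Suc n \<le> (\<Sum>w\<in>F. ?W w (flip {w, u} (path_edges (u # xs)))) * ?q ^ length xs"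
  \<comment> \<open>If \<open>?q\<close> is 0, the left-hand side vanishes; otherwise a factor
    \<open>?q\<close> can be inserted and cancelled.\<close>
  proof (cases "card V = K")
    case True
    then show ?thesis by (auto intro!: mult_nonneg_nonneg sum_nonneg nn)
  next
    case False
    then have q: "?q > 0" using assms(6) by simp
    have "?q * (real (ballot n (Suc (length xs))) * ?q ^ Suc n) = real (card V - K) * (real (ballot n (Suc (length xs))) * ?q ^ n)"
      by (simp add: of_nat_diff[OF assms(6)] assms(6) mult_ac)
    also have "\<dots> \<le> real (card F) * (real (ballot n (Suc (length xs))) * ?q ^ n)"
      using cO q by (intro mult_right_mono) auto
    also have "\<dots> = (\<Sum>w\<in>F. real (ballot n (Suc (length xs))) * ?q ^ n)" by simp
    also have "\<dots> \<le> (\<Sum>w\<in>F. ?W w (flip {w, u} (path_edges (u # xs))) * ?q ^ Suc (length xs))"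
      by (intro sum_mono fresh)
    also have "\<dots> = ?q * ((\<Sum>w\<in>F. ?W w (flip {w, u} (path_edges (u # xs)))) * ?q ^ length xs)"
      by (simp add: sum_distrib_right sum_distrib_left mult_ac)
    finally show ?thesis using q by simp
  qed
  moreover have "real (case length xs of 0 \<Rightarrow> 0 | Suc i \<Rightarrow> ballot n i) * ?q ^ Suc n
      \<le> (\<Sum>w\<in>V - F. ?W w (flip {w, u} (path_edges (u # xs)))) * ?q ^ length xs"
  proof (cases xs)
    case Nil
    then show ?thesis by (auto intro!: mult_nonneg_nonneg sum_nonneg nn simp: assms(6))
  next
    case (Cons y ys)
    have "{y, u} \<notin> path_edges (y # ys)" using path_edges_subset[of "{y, u}" "y # ys"] Suc.prems(1) Cons by auto
    then have "flip {y, u} (path_edges (u # xs)) = path_edges (y # ys)"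
      using Cons by (auto simp: flip_def insert_commute)
    moreover have "real (ballot n (length ys)) * ?q ^ n \<le> ?W y (path_edges (y # ys)) * ?q ^ length ys"
      using Suc.prems Cons by (intro Suc.IH) auto
    ultimately have "?q * (real (ballot n (length ys)) * ?q ^ n) \<le> ?q * (?W y (flip {y, u} (path_edges (u # xs))) * ?q ^ length ys)"
      using assms(6) by (intro mult_left_mono) auto
    moreover have "?W y (flip {y, u} (path_edges (u # xs))) \<le> (\<Sum>w\<in>V - F. ?W w (flip {w, u} (path_edges (u # xs))))"
      using assms(1) Suc.prems(2) Cons
      by (intro member_le_sum[where f = "\<lambda>w. ?W w (flip {w, u} (path_edges (u # xs)))"]) (auto simp: F_def nn)
    then have "?W y (flip {y, u} (path_edges (u # xs))) * ?q ^ length xs \<le> (\<Sum>w\<in>V - F. ?W w (flip {w, u} (path_edges (u # xs)))) * ?q ^ length xs"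
      using assms(6) by (intro mult_right_mono) auto
    ultimately show ?thesis using Cons by (simp add: mult_ac)
  qed
  moreover have "(\<Sum>w\<in>V. ?W w (flip {w, u} (path_edges (u # xs)))) =
      (\<Sum>w\<in>V - F. ?W w (flip {w, u} (path_edges (u # xs)))) + (\<Sum>w\<in>F. ?W w (flip {w, u} (path_edges (u # xs))))"
    using assms(1) by (intro sum.subset_diff) (auto simp: F_def)
  moreover have "ballot (Suc n) (length xs) = (case length xs of 0 \<Rightarrow> 0 | Suc i \<Rightarrow> ballot n i) + ballot n (Suc (length xs))"
    by (cases "length xs") auto
  ultimately show ?case by (simp add: distrib_right del: power_Suc)
qed

section \<open>Walks that leave the simple paths\<close>

context weight_bounds
begin

text \<open>Removals keep simple states simple, so only additions count, and an addition leads out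
  only if the new end u is already on the path: at most 2 n + 1 choices. A given end state has at
  most n + 1 relevant predecessors, which enter as a factor by Cauchy-Schwarz, and each squared
  weight is at most \<eta>.\<close>

lemma deviation_step:
  assumes supp: "\<And>w S. (w, S) \<in> states V \<Longrightarrow> f (w, S) \<noteq> 0 \<Longrightarrow> card S \<le> n"
    and simple: "\<And>s. s \<notin> simple_states V v \<Longrightarrow> f s = 0"
  shows "(\<Sum>s\<in>states V - simple_states V v. (step_up V Y f s + step_down V Y f s)\<^sup>2)
    \<le> (2 * real n + 1)\<^sup>2 * \<eta> * (\<Sum>s\<in>states V. (f s)\<^sup>2)"
proof -
  \<comment> \<open>A majorant for one transition from (w, S) to u; n + 1 is the Cauchy-Schwarz
    factor for the number of predecessors of the end state.\<close>
  define g where "g w u S = (if u \<in> insert v (\<Union>S) then real (n + 1) * \<eta> * (f (w, S))\<^sup>2 else 0)" for w u S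
  have down: "step_down V Y f (u, T) = 0" if "(u, T) \<notin> simple_states V v" for u T
    unfolding step_down_def prod.case
  proof (rule sum.neutral, rule ballI)
    fix w show "(if {w, u} \<in> T then 0 else Y {w, u} * f (w, insert {w, u} T)) = 0"
      using simple_states_remove[of w u T V v] that simple by auto
  qed
  have up: "(step_up V Y f (u, T))\<^sup>2 \<le> (\<Sum>w\<in>V. if {w, u} \<in> T then g w u (T - {{w, u}}) else 0)"
    if T: "(u, T) \<in> states V" "(u, T) \<notin> simple_states V v" for u T
  proof -
    from T have u: "u \<in> V" and TE: "T \<subseteq> edges V" by (auto simp: states_def)
    have fT: "finite T" using finite_state[OF T(1)] .
    define W where "W = {w\<in>V. {w, u} \<in> T \<and> f (w, T - {{w, u}}) \<noteq> 0}"
    have fW: "finite W" unfolding W_def using finite_V by simp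
    have W: "{w, u} \<in> T" "u \<in> insert v (\<Union>(T - {{w, u}}))" "card T \<le> n + 1" "w \<in> V" if "w \<in> W" for w
    proof -
      show wuT: "{w, u} \<in> T" and wV: "w \<in> V" using that by (auto simp: W_def)
      have nz: "f (w, T - {{w, u}}) \<noteq> 0" using that by (auto simp: W_def)
      then have s: "(w, T - {{w, u}}) \<in> simple_states V v" using simple by blast
      show "u \<in> insert v (\<Union>(T - {{w, u}}))"
      proof (rule ccontr)
        assume "u \<notin> insert v (\<Union>(T - {{w, u}}))"
        from simple_states_insert[OF s u this] show False using T(2) wuT by (simp add: insert_absorb)
      qed
      have "card (T - {{w, u}}) \<le> n" using nz wV TE by (intro supp) (auto simp: states_def)
      then show "card T \<le> n + 1" using wuT fT by (simp add: card_Diff_singleton)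
    qed
    \<comment> \<open>Distinct predecessors w use distinct edges {w, u} of T.\<close>
    have "inj_on (\<lambda>w. {w, u}) W" by (auto simp: inj_on_def doubleton_eq_iff)
    then have cW: "card W \<le> card T" using W(1) fT by (intro card_inj_on_le[where f = "\<lambda>w. {w, u}"]) auto
    have cW': "real (card W) \<le> real (n + 1)"
    proof (cases "W = {}")
      case False
      then obtain w where "w \<in> W" by blast
      from cW W(3)[OF this] show ?thesis by linarith
    qed simp
    have "(step_up V Y f (u, T))\<^sup>2 = (\<Sum>w\<in>W. Y {w, u} * f (w, T - {{w, u}}))\<^sup>2"
      unfolding step_up_def prod.case W_def
      by (intro arg_cong[where f = "\<lambda>x. x\<^sup>2"] sum.mono_neutral_cong_right finite_V) (auto split: if_splits)
    also have "\<dots> \<le> real (card W) * (\<Sum>w\<in>W. (Y {w, u} * f (w, T - {{w, u}}))\<^sup>2)"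
      using sum_squared_le_sum_of_squares[of "\<lambda>w. Y {w, u} * f (w, T - {{w, u}})" W] fW by (simp add: mult.commute)
    also have "\<dots> \<le> real (n + 1) * (\<Sum>w\<in>W. \<eta> * (f (w, T - {{w, u}}))\<^sup>2)"
      using cW' W(4) u by (intro mult_mono sum_mono) (auto simp: power_mult_distrib sum_nonneg intro!: mult_right_mono entry_le)
    also have "\<dots> = (\<Sum>w\<in>W. if {w, u} \<in> T then g w u (T - {{w, u}}) else 0)"
      unfolding sum_distrib_left using W by (intro sum.cong refl) (simp add: g_def mult_ac)
    also have "\<dots> \<le> (\<Sum>w\<in>V. if {w, u} \<in> T then g w u (T - {{w, u}}) else 0)"
      using finite_V eta_nonneg by (intro sum_mono2) (auto simp: W_def g_def)
    finally show ?thesis .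
  qed
  have "(\<Sum>s\<in>states V - simple_states V v. (step_up V Y f s + step_down V Y f s)\<^sup>2)
      \<le> (\<Sum>(u, T)\<in>states V - simple_states V v. \<Sum>w\<in>V. if {w, u} \<in> T then g w u (T - {{w, u}}) else 0)"
    by (intro sum_mono, clarify) (simp add: down up)
  also have "\<dots> \<le> (\<Sum>(u, T)\<in>states V. \<Sum>w\<in>V. if {w, u} \<in> T then g w u (T - {{w, u}}) else 0)"
    using finite_V eta_nonneg by (intro sum_mono2) (auto simp: g_def intro!: sum_nonneg)
  also have "\<dots> = (\<Sum>(w, S)\<in>states V. \<Sum>u\<in>V. if {w, u} \<in> S then 0 else g w u S)"
    by (rule sum_states_swap[OF finite_V])
  also have "\<dots> \<le> (\<Sum>s\<in>states V. (2 * real n + 1)\<^sup>2 * \<eta> * (f s)\<^sup>2)"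
  proof (rule sum_mono, clarify)
    fix w S assume s: "(w, S) \<in> states V"
    show "(\<Sum>u\<in>V. if {w, u} \<in> S then 0 else g w u S) \<le> (2 * real n + 1)\<^sup>2 * \<eta> * (f (w, S))\<^sup>2"
    proof (cases "f (w, S) = 0")
      case False
      have c: "finite (\<Union>S)" "card (\<Union>S) \<le> 2 * card S"
        using card_Union_edges_le[OF finite_V, of S] s by (auto simp: states_def)
      have "(\<Sum>u\<in>V. if {w, u} \<in> S then 0 else g w u S) \<le> (\<Sum>u\<in>V. g w u S)"
        using eta_nonneg by (intro sum_mono) (auto simp: g_def)
      also have "\<dots> = real (card (V \<inter> insert v (\<Union>S))) * (real (n + 1) * \<eta> * (f (w, S))\<^sup>2)"
        unfolding g_def using finite_V by (simp add: sum.If_cases Int_def)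
      also have "\<dots> \<le> (2 * real n + 1) * ((2 * real n + 1) * \<eta> * (f (w, S))\<^sup>2)"
      proof (rule mult_mono)
        have "card (V \<inter> insert v (\<Union>S)) \<le> card (insert v (\<Union>S))"
          using c by (intro card_mono) auto
        also have "\<dots> \<le> 2 * n + 1"
          using c supp[OF s False] card_insert_le_m1[of _ "\<Union>S" v] by (auto simp: card_insert_if)
        finally show "real (card (V \<inter> insert v (\<Union>S))) \<le> 2 * real n + 1" by linarith
      qed (use eta_nonneg in \<open>auto intro!: mult_right_mono\<close>)
      finally show ?thesis by (simp add: power2_eq_square mult_ac)
    qed (simp add: g_def cong: if_cong)
  qed
  finally show ?thesis by (simp add: sum_distrib_left)
qed

text \<open>The non-simple part B grows by a factor of at most 2 sqrt \<rho> per step and receives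
  from the simple part G only a contribution with the small factor sqrt \<eta>. The number c plays
  the role of sqrt (\<eta> / \<rho>) in a form that allows \<rho> = 0.\<close>

lemma deviation_norm_le:
  assumes rho: "R + 2 * real n * \<eta> \<le> \<rho>" and v: "v \<in> V" and c: "0 \<le> c" "\<eta> \<le> c\<^sup>2 * \<rho>"
  shows "L2_set (\<lambda>s. if s \<in> simple_states V v then 0 else ws v n s) (states V)
    \<le> real n * (2 * real n + 1) * 2 ^ n * c * sqrt \<rho> ^ n"
  using rho
proof (induction n)
  case 0
  have "(v, {}) \<in> simple_states V v"
    unfolding simple_states_def using v by (intro CollectI exI[of _ v] exI[of _ "[]"]) simp
  then have "L2_set (\<lambda>s. if s \<in> simple_states V v then 0 else ws v 0 s) (states V) = 0"
    by (intro L2_set_0') auto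
  then show ?case by simp
next
  case (Suc n)
  let ?S = "simple_states V v"
  have "R + 2 * real n * \<eta> \<le> R + 2 * real (Suc n) * \<eta>" using eta_nonneg by (simp add: algebra_simps)
  then have rho: "R + 2 * real n * \<eta> \<le> \<rho>" using Suc.prems by simp
  have r0: "0 \<le> \<rho>" using rho R_nonneg eta_nonneg
    by (meson add_nonneg_nonneg mult_nonneg_nonneg of_nat_0_le_iff order.trans zero_le_numeral)
  define G where "G s = (if s \<in> ?S then ws v n s else 0)" for s
  define B where "B s = (if s \<in> ?S then 0 else ws v n s)" for s
  have GB: "ws v n = (\<lambda>s. B s + G s)" by (auto simp: G_def B_def fun_eq_iff)
  have supp: "card S \<le> n" if "(w, S) \<in> states V" "ws v n (w, S) \<noteq> 0" for w S
    using that card_walk_sum_support[OF finite_state[OF that(1)]] by simp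
  have suppB: "card S \<le> n" if "(w, S) \<in> states V" "B (w, S) \<noteq> 0" for w S
    using that supp[OF that(1)] by (auto simp: B_def split: if_splits)
  have suppG: "card S \<le> n" if "(w, S) \<in> states V" "G (w, S) \<noteq> 0" for w S
    using that supp[OF that(1)] by (auto simp: G_def split: if_splits)
  define XB where "XB s = step_up V Y B s + step_down V Y B s" for s
  define XG where "XG s = step_up V Y G s + step_down V Y G s" for s
  have lin: "ws v (Suc n) s = XB s + XG s" for s
  proof -
    have "step_up V Y (ws v n) s = step_up V Y B s + step_up V Y G s"
      unfolding GB step_up_def
      by (cases s) (simp only: prod.case sum.distrib[symmetric], intro sum.cong refl, simp add: distrib_left)
    moreover have "step_down V Y (ws v n) s = step_down V Y B s + step_down V Y G s"
      unfolding GB step_down_def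
      by (cases s) (simp only: prod.case sum.distrib[symmetric], intro sum.cong refl, simp add: distrib_left)
    ultimately show ?thesis unfolding ws_Suc XB_def XG_def by linarith
  qed
  have mask: "L2_set (\<lambda>s. if s \<in> ?S then 0 else h s) (states V) \<le> L2_set h (states V)" for h
    unfolding L2_set_def by (intro real_sqrt_le_mono sum_mono) auto
  have "L2_set (\<lambda>s. if s \<in> ?S then 0 else ws v (Suc n) s) (states V)
      = L2_set (\<lambda>s. (if s \<in> ?S then 0 else XB s) + (if s \<in> ?S then 0 else XG s)) (states V)"
    by (rule L2_set_cong[OF refl]) (simp only: lin split: if_split, simp)
  also have "\<dots> \<le> L2_set (\<lambda>s. if s \<in> ?S then 0 else XB s) (states V) + L2_set (\<lambda>s. if s \<in> ?S then 0 else XG s) (states V)"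
    by (rule L2_set_triangle_ineq)
  also have "\<dots> \<le> 2 * sqrt \<rho> * (real n * (2 * real n + 1) * 2 ^ n * c * sqrt \<rho> ^ n)
      + (2 * real n + 1) * (c * sqrt \<rho>) * (2 * sqrt \<rho>) ^ n"
  proof (rule add_mono)
    have "L2_set (\<lambda>s. if s \<in> ?S then 0 else XB s) (states V) \<le> L2_set XB (states V)" by (rule mask)
    also have "\<dots> \<le> 2 * sqrt \<rho> * L2_set B (states V)"
      unfolding XB_def by (rule ws_step_norm_le[OF suppB rho])
    also have "\<dots> \<le> 2 * sqrt \<rho> * (real n * (2 * real n + 1) * 2 ^ n * c * sqrt \<rho> ^ n)"
      using Suc.IH[OF rho] r0 unfolding B_def by (intro mult_left_mono) auto
    finally show "L2_set (\<lambda>s. if s \<in> ?S then 0 else XB s) (states V)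
        \<le> 2 * sqrt \<rho> * (real n * (2 * real n + 1) * 2 ^ n * c * sqrt \<rho> ^ n)" .
    have "(\<Sum>s\<in>states V. (if s \<in> ?S then 0 else XG s)\<^sup>2) = (\<Sum>s\<in>states V - ?S. (XG s)\<^sup>2)"
      using finite_V by (intro sum.mono_neutral_cong_right) auto
    also have "\<dots> \<le> (2 * real n + 1)\<^sup>2 * \<eta> * (\<Sum>s\<in>states V. (G s)\<^sup>2)"
      unfolding XG_def by (rule deviation_step[OF suppG]) (auto simp: G_def)
    also have "\<dots> \<le> (2 * real n + 1)\<^sup>2 * (c\<^sup>2 * \<rho>) * (\<Sum>s\<in>states V. (ws v n s)\<^sup>2)"
      using c eta_nonneg r0 by (intro mult_mono sum_mono) (auto simp: G_def sum_nonneg)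
    finally have "L2_set (\<lambda>s. if s \<in> ?S then 0 else XG s) (states V) \<le>
        sqrt ((2 * real n + 1)\<^sup>2 * (c\<^sup>2 * \<rho>) * (\<Sum>s\<in>states V. (ws v n s)\<^sup>2))"
      unfolding L2_set_def by (rule real_sqrt_le_mono)
    also have "\<dots> = (2 * real n + 1) * (c * sqrt \<rho>) * L2_set (ws v n) (states V)"
      using c by (simp add: L2_set_def real_sqrt_mult)
    also have "\<dots> \<le> (2 * real n + 1) * (c * sqrt \<rho>) * (2 * sqrt \<rho>) ^ n"
      using c r0 by (intro mult_left_mono ws_norm_le[OF rho]) auto
    finally show "L2_set (\<lambda>s. if s \<in> ?S then 0 else XG s) (states V)
        \<le> (2 * real n + 1) * (c * sqrt \<rho>) * (2 * sqrt \<rho>) ^ n" .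
  qed
  \<comment> \<open>The coefficients add up as 2 n (2 n + 1) + (2 n + 1) = (2 n + 1)^2, which is at
    most the 2 (n + 1) (2 n + 3) of the claim.\<close>
  also have "\<dots> = (2 * real n + 1) * (2 * real n + 1) * (2 ^ n * c * sqrt \<rho> ^ Suc n)"
    by (simp add: power_mult_distrib algebra_simps)
  also have "\<dots> \<le> (2 * (real (Suc n) * (2 * real (Suc n) + 1))) * (2 ^ n * c * sqrt \<rho> ^ Suc n)"
    using c r0 by (intro mult_right_mono) (auto simp: algebra_simps)
  also have "\<dots> = real (Suc n) * (2 * real (Suc n) + 1) * 2 ^ Suc n * c * sqrt \<rho> ^ Suc n"
    by simp
  finally show ?case .
qed

text \<open>A simple path that ends at its own start has no edges, so every state (v, T) with
  nonempty T is non-simple and falls under the deviation bound.\<close>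

lemma walk_sum_closed_nonempty_le:
  assumes "R + 2 * real n * \<eta> \<le> \<rho>" "v \<in> V" "0 \<le> c" "\<eta> \<le> c\<^sup>2 * \<rho>"
  shows "(\<Sum>T\<in>Pow (edges V) - {{}}. (walk_sum V v Y n v T)\<^sup>2)
    \<le> (real n * (2 * real n + 1) * 2 ^ n * c * sqrt \<rho> ^ n)\<^sup>2"
proof -
  let ?f = "\<lambda>s. if s \<in> simple_states V v then 0 else ws v n s"
  have simple: "(v, T) \<in> simple_states V v \<longleftrightarrow> False" if "T \<noteq> {}" for T
    using simple_states_closed[of v T V] that by blast
  have "(\<Sum>T\<in>Pow (edges V) - {{}}. (walk_sum V v Y n v T)\<^sup>2)
      = (\<Sum>s\<in>Pair v ` (Pow (edges V) - {{}}). (?f s)\<^sup>2)"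
    by (subst sum.reindex) (auto simp: inj_on_def simple intro!: sum.cong)
  also have "\<dots> \<le> (\<Sum>s\<in>states V. (?f s)\<^sup>2)"
    using finite_V assms(2) by (intro sum_mono2) (auto simp: states_def)
  also have "\<dots> = (L2_set ?f (states V))\<^sup>2"
    by (simp add: L2_set_def sum_nonneg)
  also have "\<dots> \<le> (real n * (2 * real n + 1) * 2 ^ n * c * sqrt \<rho> ^ n)\<^sup>2"
    using deviation_norm_le[OF assms] by (intro power_mono) auto
  finally show ?thesis .
qed

end

subsection \<open>Spectral norm and matrix powers\<close>

lemma pow_mat_plus:
  assumes "(A :: 'a :: semiring_1 mat) \<in> carrier_mat n n"
  shows "A ^\<^sub>m (k + l) = A ^\<^sub>m k * A ^\<^sub>m l"
proof (induction l)
  case (Suc l)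
  have "A ^\<^sub>m (k + Suc l) = A ^\<^sub>m k * A ^\<^sub>m l * A" using Suc by simp
  also have "\<dots> = A ^\<^sub>m k * (A ^\<^sub>m l * A)"
    using assms by (intro assoc_mult_mat[of _ n n _ n _ n]) auto
  finally show ?case by simp
qed (use assms in simp)

lemma pow_mat_symmetric:
  assumes A: "(A :: 'a :: comm_semiring_1 mat) \<in> carrier_mat n n"
    and sym: "\<And>i j. i < n \<Longrightarrow> j < n \<Longrightarrow> A $$ (i, j) = A $$ (j, i)"
    and "i < n" "j < n"
  shows "(A ^\<^sub>m k) $$ (i, j) = (A ^\<^sub>m k) $$ (j, i)"
proof -
  have t: "transpose_mat A = A" using A sym by (intro eq_matI) auto
  have "transpose_mat (A ^\<^sub>m k) = A ^\<^sub>m k"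
  proof (induction k)
    case (Suc k)
    have "transpose_mat (A ^\<^sub>m Suc k) = A * A ^\<^sub>m k"
      using A Suc t by (simp add: transpose_mult[of _ n n _ n])
    also have "\<dots> = A ^\<^sub>m Suc k"
      using pow_mat_plus[OF A, of 1 k] pow_mat_plus[OF A, of k 1] A by (simp add: add.commute)
    finally show ?case .
  qed (use A in simp)
  then have "(A ^\<^sub>m k) $$ (i, j) = transpose_mat (A ^\<^sub>m k) $$ (i, j)" by simp
  then show ?thesis using assms by simp
qed

lemma pow_mat_square_diag:
  assumes A: "(A :: real mat) \<in> carrier_mat n n"
    and sym: "\<And>i j. i < n \<Longrightarrow> j < n \<Longrightarrow> A $$ (i, j) = A $$ (j, i)"
    and i: "i < n"
  shows "(A ^\<^sub>m (2 * k)) $$ (i, i) = (\<Sum>j<n. ((A ^\<^sub>m k) $$ (i, j))\<^sup>2)"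
proof -
  have "(A ^\<^sub>m (2 * k)) $$ (i, i) = (\<Sum>j<n. (A ^\<^sub>m k) $$ (i, j) * (A ^\<^sub>m k) $$ (j, i))"
    using A i by (simp add: mult_2 pow_mat_plus[OF A] scalar_prod_def atLeast0LessThan)
  also have "\<dots> = (\<Sum>j<n. ((A ^\<^sub>m k) $$ (i, j))\<^sup>2)"
    using pow_mat_symmetric[OF A sym] i by (intro sum.cong) (auto simp: power2_eq_square)
  finally show ?thesis .
qed

text \<open>For an eigenvector x of an eigenvalue of maximal modulus, |A^k x|^2 is at most |x|^2
  times the squared Frobenius norm of A^k, and by symmetry the latter is the trace of
  A^(2k).\<close>

lemma spectral_norm_pow_le_trace:
  assumes A: "A \<in> carrier_mat n n" and n: "n > 0"
    and sym: "\<And>i j. i < n \<Longrightarrow> j < n \<Longrightarrow> A $$ (i, j) = A $$ (j, i)"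
  shows "spectral_norm A ^ (2 * k) \<le> (\<Sum>i<n. (A ^\<^sub>m (2 * k)) $$ (i, i))"
proof -
  let ?C = "map_mat complex_of_real A"
  have C: "?C \<in> carrier_mat n n" using A by simp
  obtain ev where ev: "ev \<in> spectrum ?C" and norm_ev: "cmod ev = spectral_norm A"
    using spectral_radius_mem_max(1)[OF C n] unfolding spectral_norm_def by force
  then obtain x where x: "eigenvector ?C x ev" unfolding spectrum_def eigenvalue_def by auto
  then have x_dim: "x \<in> carrier_vec n" and x0: "x \<noteq> 0\<^sub>v n" using C unfolding eigenvector_def by auto
  define s where "s = (\<Sum>j<n. (cmod (x $ j))\<^sup>2)"
  obtain j0 where "j0 < n" "x $ j0 \<noteq> 0" using x0 x_dim by (metis carrier_vecD eq_vecI index_zero_vec)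
  then have s: "s > 0" unfolding s_def by (intro sum_pos2[of _ j0]) auto
  have pow: "?C ^\<^sub>m k *\<^sub>v x = ev ^ k \<cdot>\<^sub>v x" by (rule eigenvector_pow[OF C x])
  have Ck: "?C ^\<^sub>m k = map_mat complex_of_real (A ^\<^sub>m k)"
    by (rule of_real_hom.mat_hom_pow[OF A, symmetric])
  have row: "(cmod ev ^ k * cmod (x $ i))\<^sup>2 \<le> (\<Sum>j<n. ((A ^\<^sub>m k) $$ (i, j))\<^sup>2) * s" if i: "i < n" for i
  proof -
    have "ev ^ k * x $ i = (?C ^\<^sub>m k *\<^sub>v x) $ i" using pow i x_dim by simp
    also have "\<dots> = (\<Sum>j<n. complex_of_real ((A ^\<^sub>m k) $$ (i, j)) * x $ j)"
      unfolding Ck using A i x_dim by (simp add: scalar_prod_def atLeast0LessThan)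
    finally have "cmod ev ^ k * cmod (x $ i) = cmod (\<Sum>j<n. complex_of_real ((A ^\<^sub>m k) $$ (i, j)) * x $ j)"
      by (simp only: norm_mult[symmetric] norm_power[symmetric])
    also have "\<dots> \<le> (\<Sum>j<n. \<bar>(A ^\<^sub>m k) $$ (i, j)\<bar> * \<bar>cmod (x $ j)\<bar>)"
      by (rule order.trans[OF norm_sum]) (simp add: norm_mult)
    also have "\<dots> \<le> L2_set (\<lambda>j. (A ^\<^sub>m k) $$ (i, j)) {..<n} * L2_set (\<lambda>j. cmod (x $ j)) {..<n}"
      by (rule L2_set_mult_ineq)
    finally have "(cmod ev ^ k * cmod (x $ i))\<^sup>2 \<le>
        (L2_set (\<lambda>j. (A ^\<^sub>m k) $$ (i, j)) {..<n} * L2_set (\<lambda>j. cmod (x $ j)) {..<n})\<^sup>2"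
      by (intro power_mono) auto
    also have "\<dots> = (\<Sum>j<n. ((A ^\<^sub>m k) $$ (i, j))\<^sup>2) * s"
      by (simp add: s_def L2_set_def power_mult_distrib sum_nonneg)
    finally show ?thesis .
  qed
  have "spectral_norm A ^ (2 * k) * s = (\<Sum>i<n. (cmod ev ^ k * cmod (x $ i))\<^sup>2)"
    by (simp add: s_def norm_ev sum_distrib_left power_mult_distrib power_mult[symmetric] mult.commute)
  also have "\<dots> \<le> (\<Sum>i<n. (\<Sum>j<n. ((A ^\<^sub>m k) $$ (i, j))\<^sup>2) * s)"
    by (intro sum_mono row) auto
  also have "\<dots> = (\<Sum>i<n. (A ^\<^sub>m (2 * k)) $$ (i, i)) * s"
    using pow_mat_square_diag[OF A sym] by (simp add: sum_distrib_right)
  finally show ?thesis using s by simp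
qed

lemma smult_pow_mat:
  assumes "(A :: 'a :: comm_semiring_1 mat) \<in> carrier_mat n n"
  shows "(c \<cdot>\<^sub>m A) ^\<^sub>m k = c ^ k \<cdot>\<^sub>m A ^\<^sub>m k"
proof (induction k)
  case (Suc k)
  have "(c \<cdot>\<^sub>m A) ^\<^sub>m Suc k = c \<cdot>\<^sub>m (c ^ k \<cdot>\<^sub>m (A ^\<^sub>m k * A))"
    using assms Suc by (simp add: mult_smult_assoc_mat[of _ n n _ n] mult_smult_distrib[of _ n n _ n])
  also have "\<dots> = c ^ Suc k \<cdot>\<^sub>m A ^\<^sub>m Suc k"
    by (rule eq_matI) (simp_all add: mult_ac del: mult_smult_distrib mult_smult_assoc_mat)
  finally show ?case .
next
  case 0
  show ?case by (rule eq_matI) simp_all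
qed

text \<open>Division by c brings the spectral radius below 1, where the Jordan normal form keeps all
  powers bounded.\<close>

lemma spectral_radius_pow_bound:
  assumes C: "C \<in> carrier_mat n n" and c: "spectral_radius C < c" "0 < c" and n: "n > 0"
  obtains b where "\<And>k i. i < n \<Longrightarrow> cmod ((C ^\<^sub>m k) $$ (i, i)) \<le> b * c ^ k"
proof -
  let ?B = "complex_of_real (1 / c) \<cdot>\<^sub>m C"
  have B: "?B \<in> carrier_mat n n" using C by simp
  have "spectral_radius ?B < 1"
  proof -
    obtain e where e: "e \<in> spectrum ?B" "spectral_radius ?B = cmod e"
      using spectral_radius_mem_max(1)[OF B n] by force
    then obtain x where x: "eigenvector ?B x e" unfolding spectrum_def eigenvalue_def by auto
    then have xd: "x \<in> carrier_vec n" "x \<noteq> 0\<^sub>v n" and ex: "?B *\<^sub>v x = e \<cdot>\<^sub>v x"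
      using B unfolding eigenvector_def by auto
    have "C *\<^sub>v x = (complex_of_real c * e) \<cdot>\<^sub>v x"
    proof (rule eq_vecI)
      fix i assume "i < dim_vec ((complex_of_real c * e) \<cdot>\<^sub>v x)"
      then have i: "i < n" using xd by simp
      have "(?B *\<^sub>v x) $ i = (e \<cdot>\<^sub>v x) $ i" using ex by simp
      then have "complex_of_real (1 / c) * (C *\<^sub>v x) $ i = e * x $ i"
        using C xd i by (simp add: scalar_prod_def sum_distrib_left mult.assoc)
      then show "(C *\<^sub>v x) $ i = ((complex_of_real c * e) \<cdot>\<^sub>v x) $ i"
        using xd i c by (simp add: field_simps)
    qed (use C xd in auto)
    then have "eigenvector C x (complex_of_real c * e)" using xd C by (simp add: eigenvector_def)
    then have "cmod (complex_of_real c * e) \<in> cmod ` spectrum C" unfolding spectrum_def eigenvalue_def by blast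
    from spectral_radius_mem_max(2)[OF C n this] have "c * cmod e \<le> spectral_radius C"
      using c by (simp add: norm_mult)
    then have "c * cmod e < c * 1" using c(1) by linarith
    then show ?thesis unfolding e(2) using c(2) by (simp only: mult_less_cancel_left_pos)
  qed
  from spectral_radius_jnf_norm_bound_less_1_upper_triangular[OF B this]
  obtain b where b: "\<And>k. norm_bound (?B ^\<^sub>m k) b" by auto
  have "cmod ((C ^\<^sub>m k) $$ (i, i)) \<le> b * c ^ k" if i: "i < n" for k i
  proof -
    have "cmod ((?B ^\<^sub>m k) $$ (i, i)) \<le> b" using b[of k] i C unfolding norm_bound_def by simp
    moreover have "(?B ^\<^sub>m k) $$ (i, i) = complex_of_real (1 / c) ^ k * (C ^\<^sub>m k) $$ (i, i)"
      unfolding smult_pow_mat[OF C] using C i by simp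
    ultimately have "(1 / c) ^ k * cmod ((C ^\<^sub>m k) $$ (i, i)) \<le> b"
      using c by (simp only: norm_mult norm_power norm_of_real abs_of_pos zero_less_divide_1_iff)
    then show ?thesis using c by (simp add: power_one_over field_simps)
  qed
  then show ?thesis by (rule that)
qed

text \<open>By symmetry a diagonal entry of A^(2l) is a sum of squares, among them the square of the
  same entry of A^l. Repeated squaring therefore preserves a lower bound: the entry of the power 2 m
  2^j is at least s^(2^j). If s exceeded the claimed bound, this would outgrow b c^l for some c
  slightly above the spectral radius.\<close>

lemma diag_pow_le_spectral_norm:
  assumes A: "A \<in> carrier_mat n n" and v: "v < n"
    and sym: "\<And>i j. i < n \<Longrightarrow> j < n \<Longrightarrow> A $$ (i, j) = A $$ (j, i)"
  shows "(A ^\<^sub>m (2 * m)) $$ (v, v) \<le> spectral_norm A ^ (2 * m)"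
proof (rule ccontr)
  let ?C = "map_mat complex_of_real A"
  let ?s = "(A ^\<^sub>m (2 * m)) $$ (v, v)"
  assume "\<not> ?thesis"
  then have gt: "spectral_norm A ^ (2 * m) < ?s" by simp
  have C: "?C \<in> carrier_mat n n" using A by simp
  have rho: "0 \<le> spectral_norm A"
    using spectral_radius_mem_max(1)[OF C] v unfolding spectral_norm_def by force
  have m: "m > 0" using gt A v by (cases m) auto
  have "((\<lambda>c. c ^ (2 * m)) \<longlongrightarrow> spectral_norm A ^ (2 * m)) (at_right (spectral_norm A))"
    by (intro tendsto_intros)
  then have "eventually (\<lambda>c. c ^ (2 * m) < ?s) (at_right (spectral_norm A))"
    using gt by (rule order_tendstoD(2))
  then have "eventually (\<lambda>c. c ^ (2 * m) < ?s \<and> spectral_norm A < c) (at_right (spectral_norm A))"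
    using eventually_at_right_less by (rule eventually_conj)
  then obtain c where c: "c ^ (2 * m) < ?s" "spectral_norm A < c"
    using eventually_happens trivial_limit_at_right_real by blast
  then have c0: "c > 0" using rho by simp
  obtain b where b: "\<And>k i. i < n \<Longrightarrow> cmod ((?C ^\<^sub>m k) $$ (i, i)) \<le> b * c ^ k"
    using spectral_radius_pow_bound[OF C _ c0] c v unfolding spectral_norm_def by (metis gr_zeroI not_less0)
  have bound: "(A ^\<^sub>m k) $$ (v, v) \<le> b * c ^ k" for k
    using b[OF v, of k] A v by (simp add: of_real_hom.mat_hom_pow[OF A, symmetric])
  have s0: "0 \<le> ?s" using gt rho by (meson less_le order.trans zero_le_power)
  have grow: "?s ^ 2 ^ j \<le> (A ^\<^sub>m (2 * m * 2 ^ j)) $$ (v, v)" for j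
  proof (induction j)
    case (Suc j)
    have "?s ^ 2 ^ Suc j = (?s ^ 2 ^ j)\<^sup>2" by (simp add: power_mult[symmetric] mult.commute)
    also have "\<dots> \<le> ((A ^\<^sub>m (2 * m * 2 ^ j)) $$ (v, v))\<^sup>2" using Suc s0 by (intro power_mono) auto
    also have "\<dots> \<le> (\<Sum>u<n. ((A ^\<^sub>m (2 * m * 2 ^ j)) $$ (v, u))\<^sup>2)"
      using v by (intro member_le_sum[where f = "\<lambda>u. ((A ^\<^sub>m (2 * m * 2 ^ j)) $$ (v, u))\<^sup>2"]) auto
    also have "\<dots> = (A ^\<^sub>m (2 * (2 * m * 2 ^ j))) $$ (v, v)"
      by (rule pow_mat_square_diag[OF A sym v, symmetric])
    finally show ?case by (simp add: mult_ac)
  qed simp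
  define r where "r = ?s / c ^ (2 * m)"
  have r: "1 < r" using c c0 by (simp add: r_def)
  have "r ^ 2 ^ j \<le> b" for j
  proof -
    have "?s ^ 2 ^ j \<le> b * (c ^ (2 * m)) ^ 2 ^ j"
      using order.trans[OF grow[of j] bound] by (simp add: power_mult)
    then show ?thesis using c0 by (simp add: r_def power_divide field_simps)
  qed
  moreover obtain k where "b < r ^ k" using real_arch_pow[OF r] by blast
  moreover have "r ^ k \<le> r ^ 2 ^ k" using r by (intro power_increasing) (auto intro: less_imp_le[OF less_exp])
  ultimately show False by (meson leD less_le_trans)
qed

subsection \<open>Independence on product spaces\<close>

text \<open>The sum type joins the two families into one. An event in finitely many of the variables
  is a rectangle S1 x S2, so its probability factors, and each side factors further by independence
  within its family.\<close>

lemma indep_vars_pair_sum: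
  fixes X :: "'i \<Rightarrow> 'a \<Rightarrow> real" and Y :: "'i \<Rightarrow> 'b \<Rightarrow> real"
  assumes "prob_space M1" "prob_space M2"
    and X: "prob_space.indep_vars M1 (\<lambda>_. borel) X I"
    and Y: "prob_space.indep_vars M2 (\<lambda>_. borel) Y I"
  shows "prob_space.indep_vars (M1 \<Otimes>\<^sub>M M2) (\<lambda>_. borel)
    (case_sum (\<lambda>i \<omega>. X i (fst \<omega>)) (\<lambda>i \<omega>. Y i (snd \<omega>))) (Inl ` I \<union> Inr ` I)"
proof -
  interpret M1: prob_space M1 by fact
  interpret M2: prob_space M2 by fact
  interpret P: pair_prob_space M1 M2 ..
  let ?Z = "case_sum (\<lambda>i \<omega>. X i (fst \<omega>)) (\<lambda>i \<omega>. Y i (snd \<omega>))"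
  have mX: "X i \<in> borel_measurable M1" if "i \<in> I" for i
    using X that unfolding M1.indep_vars_def2 by auto
  have mY: "Y i \<in> borel_measurable M2" if "i \<in> I" for i
    using Y that unfolding M2.indep_vars_def2 by auto
  have mZ: "?Z z \<in> borel_measurable (M1 \<Otimes>\<^sub>M M2)" if "z \<in> Inl ` I \<union> Inr ` I" for z
    using that mX mY by (auto intro!: measurable_compose[OF measurable_fst] measurable_compose[OF measurable_snd])
  have times: "measure (M1 \<Otimes>\<^sub>M M2) (S1 \<times> S2) = M1.prob S1 * M2.prob S2"
    if "S1 \<in> sets M1" "S2 \<in> sets M2" for S1 S2
    using that by (simp add: measure_def M2.emeasure_pair_measure_Times enn2real_mult)
  have "P.prob (\<Inter>j\<in>J. ?Z j -` B j \<inter> space (M1 \<Otimes>\<^sub>M M2)) = (\<Prod>j\<in>J. P.prob (?Z j -` B j \<inter> space (M1 \<Otimes>\<^sub>M M2)))"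
    if J: "J \<subseteq> Inl ` I \<union> Inr ` I" "J \<noteq> {}" "finite J" and B: "\<And>j. j \<in> J \<Longrightarrow> B j \<in> sets borel" for J B
  proof -
    define J1 where "J1 = {i. Inl i \<in> J}"
    define J2 where "J2 = {i. Inr i \<in> J}"
    have J12: "J = Inl ` J1 \<union> Inr ` J2" unfolding J1_def J2_def by (auto simp: image_iff) (metis sumE)
    have fin: "finite J1" "finite J2"
      using J(3) unfolding J1_def J2_def by (auto intro: finite_vimageI[of J Inl, unfolded vimage_def] finite_vimageI[of J Inr, unfolded vimage_def])
    have sub: "J1 \<subseteq> I" "J2 \<subseteq> I" using J(1) unfolding J1_def J2_def by auto
    \<comment> \<open>Quantified rather than written as an intersection, so that an empty J1 gives
      the whole space, matching the empty product 1.\<close>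
    define S1 where "S1 = {\<omega>\<in>space M1. \<forall>i\<in>J1. X i \<omega> \<in> B (Inl i)}"
    define S2 where "S2 = {\<omega>\<in>space M2. \<forall>i\<in>J2. Y i \<omega> \<in> B (Inr i)}"
    have E1: "X i -` B (Inl i) \<inter> space M1 \<in> sets M1" if "i \<in> J1" for i
      using that mX[of i] sub B[of "Inl i"] by (intro measurable_sets) (auto simp: J1_def)
    have E2: "Y i -` B (Inr i) \<inter> space M2 \<in> sets M2" if "i \<in> J2" for i
      using that mY[of i] sub B[of "Inr i"] by (intro measurable_sets) (auto simp: J2_def)
    have p1: "S1 \<in> sets M1 \<and> M1.prob S1 = (\<Prod>i\<in>J1. M1.prob (X i -` B (Inl i) \<inter> space M1))"
    proof (cases "J1 = {}")
      case False
      then have eq: "S1 = (\<Inter>i\<in>J1. X i -` B (Inl i) \<inter> space M1)" unfolding S1_def by auto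
      have "S1 \<in> sets M1" unfolding eq using False fin by (intro sets.finite_INT E1) auto
      moreover have "M1.prob S1 = (\<Prod>i\<in>J1. M1.prob (X i -` B (Inl i) \<inter> space M1))"
        unfolding eq by (rule M1.indep_varsD[OF X False fin(1) sub(1)]) (use B in \<open>simp add: J1_def\<close>)
      ultimately show ?thesis by blast
    qed (simp add: S1_def M1.prob_space)
    have p2: "S2 \<in> sets M2 \<and> M2.prob S2 = (\<Prod>i\<in>J2. M2.prob (Y i -` B (Inr i) \<inter> space M2))"
    proof (cases "J2 = {}")
      case False
      then have eq: "S2 = (\<Inter>i\<in>J2. Y i -` B (Inr i) \<inter> space M2)" unfolding S2_def by auto
      have "S2 \<in> sets M2" unfolding eq using False fin by (intro sets.finite_INT E2) auto
      moreover have "M2.prob S2 = (\<Prod>i\<in>J2. M2.prob (Y i -` B (Inr i) \<inter> space M2))"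
        unfolding eq by (rule M2.indep_varsD[OF Y False fin(2) sub(2)]) (use B in \<open>simp add: J2_def\<close>)
      ultimately show ?thesis by blast
    qed (simp add: S2_def M2.prob_space)
    have "(\<forall>j\<in>J. ?Z j \<omega> \<in> B j) \<longleftrightarrow>
        (\<forall>i\<in>J1. X i (fst \<omega>) \<in> B (Inl i)) \<and> (\<forall>i\<in>J2. Y i (snd \<omega>) \<in> B (Inr i))" for \<omega>
      unfolding J12 by (simp add: ball_Un)
    moreover have "(\<Inter>j\<in>J. ?Z j -` B j \<inter> space (M1 \<Otimes>\<^sub>M M2)) =
        {\<omega>\<in>space (M1 \<Otimes>\<^sub>M M2). \<forall>j\<in>J. ?Z j \<omega> \<in> B j}"
      using J(2) by blast
    ultimately have "(\<Inter>j\<in>J. ?Z j -` B j \<inter> space (M1 \<Otimes>\<^sub>M M2)) = S1 \<times> S2"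
      unfolding S1_def S2_def by (auto simp: space_pair_measure)
    then have "P.prob (\<Inter>j\<in>J. ?Z j -` B j \<inter> space (M1 \<Otimes>\<^sub>M M2)) = M1.prob S1 * M2.prob S2"
      using times p1 p2 by simp
    also have "M1.prob S1 = (\<Prod>i\<in>J1. P.prob (?Z (Inl i) -` B (Inl i) \<inter> space (M1 \<Otimes>\<^sub>M M2)))"
    proof -
      have "P.prob (?Z (Inl i) -` B (Inl i) \<inter> space (M1 \<Otimes>\<^sub>M M2)) = M1.prob (X i -` B (Inl i) \<inter> space M1)"
        if "i \<in> J1" for i
      proof -
        have "?Z (Inl i) -` B (Inl i) \<inter> space (M1 \<Otimes>\<^sub>M M2) = (X i -` B (Inl i) \<inter> space M1) \<times> space M2"
          by (auto simp: space_pair_measure)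
        then show ?thesis using times[OF E1[OF that], of "space M2"] by (simp add: M2.prob_space)
      qed
      then show ?thesis using p1 by simp
    qed
    also have "M2.prob S2 = (\<Prod>i\<in>J2. P.prob (?Z (Inr i) -` B (Inr i) \<inter> space (M1 \<Otimes>\<^sub>M M2)))"
    proof -
      have "P.prob (?Z (Inr i) -` B (Inr i) \<inter> space (M1 \<Otimes>\<^sub>M M2)) = M2.prob (Y i -` B (Inr i) \<inter> space M2)"
        if "i \<in> J2" for i
      proof -
        have "?Z (Inr i) -` B (Inr i) \<inter> space (M1 \<Otimes>\<^sub>M M2) = space M1 \<times> (Y i -` B (Inr i) \<inter> space M2)"
          by (auto simp: space_pair_measure)
        then show ?thesis using times[OF _ E2[OF that], of "space M1"] by (simp add: M1.prob_space)
      qed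
      then show ?thesis using p2 by simp
    qed
    finally show ?thesis
      unfolding J12 using fin by (subst prod.union_disjoint) (auto simp: prod.reindex)
  qed
  note prod_formula = this
  show ?thesis
    unfolding P.indep_vars_def2 P.indep_sets_def
  proof (intro conjI ballI allI impI)
    fix z assume "z \<in> Inl ` I \<union> Inr ` I"
    then show "?Z z \<in> borel_measurable (M1 \<Otimes>\<^sub>M M2)" by (rule mZ)
    show "{?Z z -` A \<inter> space (M1 \<Otimes>\<^sub>M M2) |A. A \<in> sets borel} \<subseteq> P.events"
      using mZ[OF \<open>z \<in> Inl ` I \<union> Inr ` I\<close>] by (auto intro: measurable_sets)
  next
    fix J A
    assume J: "J \<subseteq> Inl ` I \<union> Inr ` I" "J \<noteq> {}" "finite J"
      and A: "A \<in> (\<Pi> j\<in>J. {?Z j -` A \<inter> space (M1 \<Otimes>\<^sub>M M2) |A. A \<in> sets borel})"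
    then have "\<forall>j\<in>J. \<exists>B. B \<in> sets borel \<and> A j = ?Z j -` B \<inter> space (M1 \<Otimes>\<^sub>M M2)"
      by (auto simp: Pi_iff)
    then obtain B where B: "\<And>j. j \<in> J \<Longrightarrow> B j \<in> sets borel" "\<And>j. j \<in> J \<Longrightarrow> A j = ?Z j -` B j \<inter> space (M1 \<Otimes>\<^sub>M M2)"
      by metis
    show "P.prob (\<Inter>(A ` J)) = (\<Prod>j\<in>J. P.prob (A j))"
      using prod_formula[OF J B(1)] B(2) by (simp cong: INF_cong prod.cong)
  qed
qed

text \<open>Functions of disjoint blocks of independent variables are independent; injectivity of g
  makes the blocks K e disjoint.\<close>

lemma indep_vars_pair_times:
  fixes X :: "'i \<Rightarrow> 'a \<Rightarrow> real" and Y :: "'i \<Rightarrow> 'b \<Rightarrow> real"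
  assumes M: "prob_space M1" "prob_space M2"
    and X: "prob_space.indep_vars M1 (\<lambda>_. borel) X I"
    and Y: "prob_space.indep_vars M2 (\<lambda>_. borel) Y I"
    and g: "inj_on g L" "g ` L \<subseteq> I"
  shows "prob_space.indep_vars (M1 \<Otimes>\<^sub>M M2) (\<lambda>_. borel) (\<lambda>e \<omega>. c * (X (g e) (fst \<omega>) * Y (g e) (snd \<omega>))) L"
proof -
  interpret M1: prob_space M1 by fact
  interpret M2: prob_space M2 by fact
  interpret P: pair_prob_space M1 M2 ..
  let ?Z = "case_sum (\<lambda>i \<omega>. X i (fst \<omega>)) (\<lambda>i \<omega>. Y i (snd \<omega>))"
  define K where "K e = {Inl (g e), Inr (g e)}" for e
  have "P.indep_vars (\<lambda>e. \<Pi>\<^sub>M i\<in>K e. borel) (\<lambda>e \<omega>. \<lambda>i\<in>K e. ?Z i \<omega>) L"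
    using g by (intro P.indep_vars_restrict[OF indep_vars_pair_sum[OF M X Y]])
      (auto simp: K_def disjoint_family_on_def inj_on_def)
  then have "P.indep_vars (\<lambda>_. borel)
      (\<lambda>e \<omega>. (\<lambda>f. c * (f (Inl (g e)) * f (Inr (g e)))) (\<lambda>i\<in>K e. ?Z i \<omega>)) L"
    by (rule P.indep_vars_compose2) (auto simp: K_def)
  then show ?thesis by (simp add: K_def)
qed

subsection \<open>Parity and moments of walk sums\<close>

text \<open>Distinguish whether y \<le> \<epsilon> x. In the application x is the truncated part,
  whose growth rate must survive up to 1 + \<epsilon>, while the large constant 1 + 1 / \<epsilon>
  falls on the large entries.\<close>

lemma add_pow_le:
  fixes x y :: real
  assumes "0 \<le> x" "0 \<le> y" "0 < \<epsilon>"
  shows "(x + y) ^ k \<le> (1 + \<epsilon>) ^ k * x ^ k + (1 + 1 / \<epsilon>) ^ k * y ^ k"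
proof (cases "y \<le> \<epsilon> * x")
  case True
  then have "(x + y) ^ k \<le> ((1 + \<epsilon>) * x) ^ k" using assms by (intro power_mono) (auto simp: algebra_simps)
  then show ?thesis using assms by (simp add: power_mult_distrib add_increasing2)
next
  case False
  then have "x + y \<le> (1 + 1 / \<epsilon>) * y" using assms by (simp add: field_simps)
  then have "(x + y) ^ k \<le> ((1 + 1 / \<epsilon>) * y) ^ k" using assms by (intro power_mono) auto
  then show ?thesis using assms by (simp add: power_mult_distrib add_increasing)
qed

lemma sum_pow_le:
  fixes x :: "'i \<Rightarrow> real"
  assumes "finite I" "\<And>i. i \<in> I \<Longrightarrow> 0 \<le> x i" "k > 0"
  shows "(\<Sum>i\<in>I. x i) ^ k \<le> real (card I) ^ k * (\<Sum>i\<in>I. x i ^ k)"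
proof (cases "I = {}")
  case False
  define m where "m = Max (x ` I)"
  have "m \<in> x ` I" unfolding m_def using assms(1) False by (intro Max_in) auto
  then obtain j where j: "j \<in> I" "m = x j" by blast
  have "(\<Sum>i\<in>I. x i) \<le> real (card I) * m"
    using assms(1) by (intro sum_bounded_above) (auto simp: m_def)
  then have "(\<Sum>i\<in>I. x i) ^ k \<le> (real (card I) * m) ^ k"
    using assms by (intro power_mono sum_nonneg) auto
  also have "\<dots> = real (card I) ^ k * x j ^ k" by (simp add: power_mult_distrib j(2))
  also have "\<dots> \<le> real (card I) ^ k * (\<Sum>i\<in>I. x i ^ k)"
    using assms j by (intro mult_left_mono member_le_sum) auto
  finally show ?thesis .
qed (use assms in \<open>simp add: power_0_left\<close>)

lemma flip_sym_diff: "flip e ((T - flip e T') \<union> (flip e T' - T)) = (T - T') \<union> (T' - T)"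
  by (auto simp: flip_def)

text \<open>The variance 1 / card V gives every squared row sum the mean 1; this is why moments of
  \<open>rho\<close> are later compared with \<theta>^k for \<theta> close to 1.\<close>

locale random_weights = prob_space M for M :: "'a measure" +
  fixes V :: "'v set" and Y :: "'v set \<Rightarrow> 'a \<Rightarrow> real"
  assumes fin_V: "finite V" and V_nonempty: "V \<noteq> {}"
    and indep: "indep_vars (\<lambda>_. borel) Y (edges V)"
    and integrable_pow: "\<And>e n. e \<in> edges V \<Longrightarrow> integrable M (\<lambda>\<omega>. Y e \<omega> ^ n)"
    and odd_moment: "\<And>e n. e \<in> edges V \<Longrightarrow> odd n \<Longrightarrow> expectation (\<lambda>\<omega>. Y e \<omega> ^ n) = 0"
    and second_moment: "\<And>e. e \<in> edges V \<Longrightarrow> expectation (\<lambda>\<omega>. (Y e \<omega>)\<^sup>2) = 1 / real (card V)"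
begin

definition edge_monomial :: "('v set \<Rightarrow> nat) \<Rightarrow> 'a \<Rightarrow> real" where
  "edge_monomial \<mu> \<omega> = (\<Prod>e\<in>edges V. Y e \<omega> ^ \<mu> e)"

definition parity :: "('v set \<Rightarrow> nat) \<Rightarrow> 'v set set" where
  "parity \<mu> = {e \<in> edges V. odd (\<mu> e)}"

lemma card_V: "real (card V) > 0"
  using fin_V V_nonempty by (simp add: card_gt_0_iff)

lemma measurable_Y: "e \<in> edges V \<Longrightarrow> Y e \<in> borel_measurable M"
  using indep unfolding indep_vars_def by auto

lemma indep_pow: "indep_vars (\<lambda>_. borel) (\<lambda>e \<omega>. Y e \<omega> ^ \<mu> e) (edges V)"
  by (rule indep_vars_compose2[OF indep]) auto

lemma integrable_edge_monomial: "integrable M (edge_monomial \<mu>)"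
  using indep_vars_integrable[OF _ indep_pow] integrable_pow fin_V
  by (simp add: edge_monomial_def[abs_def])

lemma expectation_edge_monomial: "expectation (edge_monomial \<mu>) = (\<Prod>e\<in>edges V. expectation (\<lambda>\<omega>. Y e \<omega> ^ \<mu> e))"
  using indep_vars_lebesgue_integral[OF _ indep_pow] integrable_pow fin_V
  by (simp add: edge_monomial_def[abs_def])

lemma edge_monomial_Suc:
  assumes "e \<in> edges V"
  shows "edge_monomial (\<mu>(e := Suc (\<mu> e))) \<omega> = Y e \<omega> * edge_monomial \<mu> \<omega>"
proof -
  have "edge_monomial (\<mu>(e := Suc (\<mu> e))) \<omega> = Y e \<omega> ^ Suc (\<mu> e) * (\<Prod>f\<in>edges V - {e}. Y f \<omega> ^ \<mu> f)"
    unfolding edge_monomial_def using fin_V assms by (subst prod.remove[of _ e]) auto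
  also have "\<dots> = Y e \<omega> * edge_monomial \<mu> \<omega>"
    unfolding edge_monomial_def using fin_V assms by (subst (2) prod.remove[of _ e]) auto
  finally show ?thesis .
qed

lemma parity_Suc: "e \<in> edges V \<Longrightarrow> parity (\<mu>(e := Suc (\<mu> e))) = flip e (parity \<mu>)"
  by (auto simp: parity_def flip_def)

lemma expectation_edge_monomial_odd:
  assumes "parity \<mu> \<noteq> {}"
  shows "expectation (edge_monomial \<mu>) = 0"
proof -
  obtain e where "e \<in> edges V" "odd (\<mu> e)" using assms by (auto simp: parity_def)
  then show ?thesis
    using fin_V odd_moment unfolding expectation_edge_monomial by (auto intro!: prod_zero)
qed

text \<open>Jensen's inequality for the k-th power, obtained by integrating Bernoulli's inequality
  at card V times Y^2, minus 1.\<close>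

lemma even_moment_ge:
  assumes "e \<in> edges V"
  shows "(1 / real (card V)) ^ k \<le> expectation (\<lambda>\<omega>. Y e \<omega> ^ (2 * k))"
proof -
  let ?N = "real (card V)"
  have int: "integrable M (\<lambda>\<omega>. (Y e \<omega>)\<^sup>2)" using integrable_pow[OF assms] .
  have "1 = expectation (\<lambda>\<omega>. 1 + real k * (?N * (Y e \<omega>)\<^sup>2 - 1))"
    using int card_V second_moment[OF assms] by (simp add: prob_space)
  also have "\<dots> \<le> expectation (\<lambda>\<omega>. ?N ^ k * Y e \<omega> ^ (2 * k))"
  proof (rule integral_mono)
    fix \<omega> show "1 + real k * (?N * (Y e \<omega>)\<^sup>2 - 1) \<le> ?N ^ k * Y e \<omega> ^ (2 * k)"
      using Bernoulli_inequality[of "?N * (Y e \<omega>)\<^sup>2 - 1" k] card_V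
      unfolding power_mult by (simp add: power_mult_distrib)
  qed (use int integrable_pow[OF assms] in auto)
  also have "\<dots> = ?N ^ k * expectation (\<lambda>\<omega>. Y e \<omega> ^ (2 * k))" by simp
  finally show ?thesis using card_V by (simp add: power_one_over field_simps)
qed

lemma expectation_edge_monomial_even_ge:
  assumes "parity \<mu> = {}"
  shows "sqrt (1 / real (card V)) ^ (\<Sum>e\<in>edges V. \<mu> e) \<le> expectation (edge_monomial \<mu>)"
proof -
  have "sqrt (1 / real (card V)) ^ (\<Sum>e\<in>edges V. \<mu> e) = (\<Prod>e\<in>edges V. sqrt (1 / real (card V)) ^ \<mu> e)"
    by (rule power_sum)
  also have "\<dots> \<le> (\<Prod>e\<in>edges V. expectation (\<lambda>\<omega>. Y e \<omega> ^ \<mu> e))"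
  proof (rule prod_mono)
    fix e assume e: "e \<in> edges V"
    then obtain k where k: "\<mu> e = 2 * k" using assms by (auto simp: parity_def elim!: evenE)
    show "0 \<le> sqrt (1 / real (card V)) ^ \<mu> e \<and> sqrt (1 / real (card V)) ^ \<mu> e \<le> expectation (\<lambda>\<omega>. Y e \<omega> ^ \<mu> e)"
      using even_moment_ge[OF e, of k] by (simp add: k power_mult)
  qed
  finally show ?thesis unfolding expectation_edge_monomial .
qed

text \<open>Linear combinations of monomials whose odd exponents are exactly those of the edges in \<open>T\<close>,
  described by testing against monomials.\<close>

definition odd_class :: "'v set set \<Rightarrow> ('a \<Rightarrow> real) \<Rightarrow> bool" where
  "odd_class T f \<longleftrightarrow> (\<forall>\<mu>. integrable M (\<lambda>\<omega>. f \<omega> * edge_monomial \<mu> \<omega>) \<and>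
    (parity \<mu> \<noteq> T \<longrightarrow> expectation (\<lambda>\<omega>. f \<omega> * edge_monomial \<mu> \<omega>) = 0))"

lemma odd_class_1: "odd_class {} (\<lambda>_. 1)"
  unfolding odd_class_def using integrable_edge_monomial expectation_edge_monomial_odd by auto

lemma odd_class_0: "odd_class T (\<lambda>_. 0)"
  unfolding odd_class_def by auto

lemma odd_class_sum:
  assumes "\<And>i. i \<in> I \<Longrightarrow> odd_class T (f i)"
  shows "odd_class T (\<lambda>\<omega>. \<Sum>i\<in>I. f i \<omega>)"
  using assms unfolding odd_class_def sum_distrib_right
  by (auto simp: Bochner_Integration.integral_sum intro!: sum.neutral)

lemma odd_class_mult:
  assumes "odd_class T f" "e \<in> edges V"
  shows "odd_class (flip e T) (\<lambda>\<omega>. f \<omega> * Y e \<omega>)"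
  unfolding odd_class_def
proof (intro allI conjI impI)
  fix \<mu>
  have eq: "f \<omega> * Y e \<omega> * edge_monomial \<mu> \<omega> = f \<omega> * edge_monomial (\<mu>(e := Suc (\<mu> e))) \<omega>" for \<omega>
    using edge_monomial_Suc[OF assms(2)] by simp
  show "integrable M (\<lambda>\<omega>. f \<omega> * Y e \<omega> * edge_monomial \<mu> \<omega>)"
    unfolding eq using assms(1) by (simp add: odd_class_def)
  assume "parity \<mu> \<noteq> flip e T"
  then have "parity (\<mu>(e := Suc (\<mu> e))) \<noteq> T" using parity_Suc[OF assms(2), of \<mu>] by (metis flip_flip)
  then show "expectation (\<lambda>\<omega>. f \<omega> * Y e \<omega> * edge_monomial \<mu> \<omega>) = 0"
    unfolding eq using assms(1) by (simp add: odd_class_def)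
qed

abbreviation walk :: "'v \<Rightarrow> nat \<Rightarrow> 'v \<Rightarrow> 'v set set \<Rightarrow> 'a \<Rightarrow> real" where
  "walk v n u T \<omega> \<equiv> walk_sum V v (\<lambda>e. Y e \<omega>) n u T"

text \<open>The factor f is carried along so that the lemma can be iterated: f = 1 gives a single
  walk sum, and a walk sum as f gives a product of two, whose class is the symmetric difference and
  so is empty only if the two sets agree.\<close>

lemma odd_class_walk:
  assumes "odd_class T f" "u \<in> V"
  shows "odd_class ((T - T') \<union> (T' - T)) (\<lambda>\<omega>. f \<omega> * walk v n u T' \<omega>)"
  using assms(2)
proof (induction n arbitrary: u T')
  case 0
  show ?case
  proof (cases "u = v \<and> T' = {}")
    case True
    then show ?thesis using assms(1) by simp
  next
    case False
    then have "(\<lambda>\<omega>. f \<omega> * walk v 0 u T' \<omega>) = (\<lambda>_. 0)" by auto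
    then show ?thesis by (simp only: odd_class_0)
  qed
next
  case (Suc n)
  have "odd_class ((T - T') \<union> (T' - T)) (\<lambda>\<omega>. f \<omega> * walk v n w (flip {w, u} T') \<omega> * Y {w, u} \<omega>)"
    if "w \<in> V" for w
    using odd_class_mult[OF Suc.IH[OF that, of "flip {w, u} T'"] edgesI[OF that Suc.prems]]
    by (simp only: flip_sym_diff)
  then have "odd_class ((T - T') \<union> (T' - T)) (\<lambda>\<omega>. \<Sum>w\<in>V. f \<omega> * walk v n w (flip {w, u} T') \<omega> * Y {w, u} \<omega>)"
    by (rule odd_class_sum)
  then show ?case by (simp add: sum_distrib_left mult_ac)
qed

lemma edge_monomial_0: "edge_monomial (\<lambda>_. 0) \<omega> = 1"
  by (simp add: edge_monomial_def)

lemma integrable_walk: "u \<in> V \<Longrightarrow> integrable M (walk v n u T)"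
  using odd_class_walk[OF odd_class_1, of u T v n] unfolding odd_class_def
  by (auto dest!: spec[of _ "\<lambda>_. 0"] simp: edge_monomial_0)

lemma expectation_walk:
  assumes "u \<in> V" "T \<noteq> {}"
  shows "expectation (walk v n u T) = 0"
  using odd_class_walk[OF odd_class_1 assms(1), of T v n] assms(2) unfolding odd_class_def
  by (auto dest!: spec[of _ "\<lambda>_. 0"] simp: edge_monomial_0 parity_def)

lemma integrable_walk_walk:
  assumes "u \<in> V" "u' \<in> V"
  shows "integrable M (\<lambda>\<omega>. walk v n u T \<omega> * walk v' n' u' T' \<omega>)"
  using odd_class_walk[OF odd_class_walk[OF odd_class_1 assms(1)] assms(2), where T' = T' and v = v' and n = n', of T v n] unfolding odd_class_def
  by (auto dest!: spec[of _ "\<lambda>_. 0"] simp: edge_monomial_0)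

lemma expectation_walk_walk:
  assumes "u \<in> V" "u' \<in> V" "T \<noteq> T'"
  shows "expectation (\<lambda>\<omega>. walk v n u T \<omega> * walk v' n' u' T' \<omega>) = 0"
proof -
  have "({} - T \<union> (T - {}) - T') \<union> (T' - ({} - T \<union> (T - {}))) \<noteq> {}" using assms(3) by auto
  moreover have "odd_class (({} - T \<union> (T - {}) - T') \<union> (T' - ({} - T \<union> (T - {}))))
      (\<lambda>\<omega>. 1 * walk v n u T \<omega> * walk v' n' u' T' \<omega>)"
    by (rule odd_class_walk[OF odd_class_walk[OF odd_class_1 assms(1)] assms(2)])
  ultimately show ?thesis unfolding odd_class_def
    by (metis (no_types, lifting) edge_monomial_0 mult_1 mult.right_neutral parity_def Collect_empty_eq dvd_0_right Bochner_Integration.integral_cong)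
qed

text \<open>Together with the monomial, each walk yields a product of even moments, none smaller
  than the corresponding power of 1 / card V; hence walks may be counted with unit weights. The
  exponents \<mu> record the steps already peeled off in the induction.\<close>

lemma expectation_walk_edge_monomial_ge:
  assumes "u \<in> V" "parity \<mu> = T"
  shows "walk_sum V v (\<lambda>_. 1) n u T * sqrt (1 / real (card V)) ^ (n + (\<Sum>e\<in>edges V. \<mu> e))
    \<le> expectation (\<lambda>\<omega>. walk v n u T \<omega> * edge_monomial \<mu> \<omega>)"
  using assms
proof (induction n arbitrary: u T \<mu>)
  case 0
  then show ?case using expectation_edge_monomial_even_ge[of \<mu>] by auto
next
  case (Suc n)
  let ?s = "sqrt (1 / real (card V))"
  let ?\<mu> = "\<lambda>w. \<mu>({w, u} := Suc (\<mu> {w, u}))"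
  have cls: "odd_class T (walk v n u T)" if "u \<in> V" for u T
    using odd_class_walk[OF odd_class_1 that, of T v n] by simp
  have int: "integrable M (\<lambda>\<omega>. walk v n w (flip {w, u} T) \<omega> * edge_monomial (?\<mu> w) \<omega>)" if "w \<in> V" for w
    using cls[OF that] unfolding odd_class_def by blast
  have "walk_sum V v (\<lambda>_. 1) (Suc n) u T * ?s ^ (Suc n + (\<Sum>e\<in>edges V. \<mu> e))
      = (\<Sum>w\<in>V. walk_sum V v (\<lambda>_. 1) n w (flip {w, u} T) * ?s ^ (n + (\<Sum>e\<in>edges V. ?\<mu> w e)))"
  proof -
    have "(\<Sum>e\<in>edges V. ?\<mu> w e) = Suc (\<Sum>e\<in>edges V. \<mu> e)" if "w \<in> V" for w
    proof -
      have e: "{w, u} \<in> edges V" using that Suc.prems by auto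
      have "(\<Sum>e\<in>edges V. ?\<mu> w e) = Suc (\<mu> {w, u}) + (\<Sum>e\<in>edges V - {{w, u}}. \<mu> e)"
        using fin_V e by (subst sum.remove[of _ "{w, u}"]) auto
      also have "\<dots> = Suc (\<Sum>e\<in>edges V. \<mu> e)"
        using fin_V e by (subst (2) sum.remove[of _ "{w, u}"]) auto
      finally show ?thesis .
    qed
    then show ?thesis by (simp add: sum_distrib_right)
  qed
  also have "\<dots> \<le> (\<Sum>w\<in>V. expectation (\<lambda>\<omega>. walk v n w (flip {w, u} T) \<omega> * edge_monomial (?\<mu> w) \<omega>))"
  proof (rule sum_mono)
    fix w assume w: "w \<in> V"
    have "parity (?\<mu> w) = flip {w, u} T"
      using parity_Suc[OF edgesI[OF w Suc.prems(1)]] Suc.prems(2) by simp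
    then show "walk_sum V v (\<lambda>_. 1) n w (flip {w, u} T) * ?s ^ (n + (\<Sum>e\<in>edges V. ?\<mu> w e))
        \<le> expectation (\<lambda>\<omega>. walk v n w (flip {w, u} T) \<omega> * edge_monomial (?\<mu> w) \<omega>)"
      by (rule Suc.IH[OF w])
  qed
  also have "\<dots> = expectation (\<lambda>\<omega>. \<Sum>w\<in>V. walk v n w (flip {w, u} T) \<omega> * edge_monomial (?\<mu> w) \<omega>)"
    using int by (intro Bochner_Integration.integral_sum[symmetric]) auto
  also have "\<dots> = expectation (\<lambda>\<omega>. walk v (Suc n) u T \<omega> * edge_monomial \<mu> \<omega>)"
    using edge_monomial_Suc[OF edgesI[OF _ Suc.prems(1)]]
    by (intro Bochner_Integration.integral_cong) (auto simp: sum_distrib_right sum_distrib_left mult_ac intro!: sum.cong)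
  finally show ?case .
qed

text \<open>By \<open>walk_sum_total\<close> this is the entry at (v, u) of the n-th power of the
  matrix with entries Y {w, u}.\<close>

definition entry :: "nat \<Rightarrow> 'v \<Rightarrow> 'v \<Rightarrow> 'a \<Rightarrow> real" where
  "entry n v u \<omega> = (\<Sum>T\<in>Pow (edges V). walk v n u T \<omega>)"

lemma integrable_entry: "u \<in> V \<Longrightarrow> integrable M (entry n v u)"
  unfolding entry_def using integrable_walk by (intro Bochner_Integration.integrable_sum) auto

lemma expectation_entry:
  assumes "u \<in> V"
  shows "expectation (entry n v u) = expectation (walk v n u {})"
proof -
  have "expectation (entry n v u) = (\<Sum>T\<in>Pow (edges V). expectation (walk v n u T))"
    unfolding entry_def using integrable_walk[OF assms] by (intro Bochner_Integration.integral_sum) auto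
  also have "\<dots> = (\<Sum>T\<in>{{}}. expectation (walk v n u T))"
    using fin_V expectation_walk[OF assms] by (intro sum.mono_neutral_right) auto
  finally show ?thesis by simp
qed

lemma integrable_entry_square: "u \<in> V \<Longrightarrow> integrable M (\<lambda>\<omega>. (entry n v u \<omega>)\<^sup>2)"
  unfolding entry_def power2_eq_square sum_product
  using integrable_walk_walk by (intro Bochner_Integration.integrable_sum) auto

text \<open>Parseval's identity for the orthogonal parts. The sum stays under the expectation so
  that the deterministic norm bounds can be applied to it in each realization.\<close>

lemma expectation_entry_square:
  assumes "u \<in> V"
  shows "expectation (\<lambda>\<omega>. (entry n v u \<omega>)\<^sup>2) = expectation (\<lambda>\<omega>. \<Sum>T\<in>Pow (edges V). (walk v n u T \<omega>)\<^sup>2)"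
proof -
  have fin: "finite (Pow (edges V))" using fin_V by simp
  have "expectation (\<lambda>\<omega>. (entry n v u \<omega>)\<^sup>2) =
      (\<Sum>T\<in>Pow (edges V). \<Sum>T'\<in>Pow (edges V). expectation (\<lambda>\<omega>. walk v n u T \<omega> * walk v n u T' \<omega>))"
    unfolding entry_def power2_eq_square sum_product
    using integrable_walk_walk[OF assms assms] by (simp add: Bochner_Integration.integral_sum)
  also have "\<dots> = (\<Sum>T\<in>Pow (edges V). expectation (\<lambda>\<omega>. walk v n u T \<omega> * walk v n u T \<omega>))"
  proof (rule sum.cong[OF refl])
    fix T assume T: "T \<in> Pow (edges V)"
    have "(\<Sum>T'\<in>Pow (edges V) - {T}. expectation (\<lambda>\<omega>. walk v n u T \<omega> * walk v n u T' \<omega>)) = 0"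
      by (intro sum.neutral ballI expectation_walk_walk[OF assms assms]) auto
    then show "(\<Sum>T'\<in>Pow (edges V). expectation (\<lambda>\<omega>. walk v n u T \<omega> * walk v n u T' \<omega>)) =
        expectation (\<lambda>\<omega>. walk v n u T \<omega> * walk v n u T \<omega>)"
      by (simp only: sum.remove[OF fin T])
  qed
  also have "\<dots> = expectation (\<lambda>\<omega>. \<Sum>T\<in>Pow (edges V). (walk v n u T \<omega>)\<^sup>2)"
    using integrable_walk_walk[OF assms assms] by (simp add: Bochner_Integration.integral_sum power2_eq_square)
  finally show ?thesis .
qed

lemma expectation_return_ge:
  assumes "v \<in> V" "2 * m + 1 \<le> card V"
  shows "real (ballot (2 * m) 0) * (1 - (2 * real m + 1) / real (card V)) ^ m
    \<le> expectation (entry (2 * m) v v)"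
proof -
  let ?N = "real (card V)"
  \<comment> \<open>Here K = 2 m + 1, the largest number of vertices that a walk of 2 m steps can
    visit.\<close>
  have "real (ballot (2 * m) 0) * sqrt (?N - real (2 * m + 1)) ^ (2 * m) \<le> walk_sum V v (\<lambda>_. 1) (2 * m) v {}"
    using simple_path_walk_sum_ge[OF fin_V, of v "[]" v "2 * m" "2 * m + 1"] assms by simp
  also have "sqrt (?N - real (2 * m + 1)) ^ (2 * m) = (?N - real (2 * m + 1)) ^ m"
    using assms(2) by (simp add: power_mult)
  finally have "real (ballot (2 * m) 0) * (?N - real (2 * m + 1)) ^ m * (1 / ?N) ^ m \<le> walk_sum V v (\<lambda>_. 1) (2 * m) v {} * (1 / ?N) ^ m"
    using card_V by (intro mult_right_mono) auto
  also have "\<dots> = walk_sum V v (\<lambda>_. 1) (2 * m) v {} * sqrt (1 / ?N) ^ (2 * m)"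
    by (simp add: power_mult)
  also have "\<dots> \<le> expectation (walk v (2 * m) v {})"
    using expectation_walk_edge_monomial_ge[OF assms(1), of "\<lambda>_. 0" "{}" v "2 * m"] by (simp add: parity_def edge_monomial_0)
  also have "real (ballot (2 * m) 0) * (?N - real (2 * m + 1)) ^ m * (1 / ?N) ^ m =
      real (ballot (2 * m) 0) * ((?N - real (2 * m + 1)) * (1 / ?N)) ^ m"
    by (simp only: power_mult_distrib mult.assoc)
  also have "(?N - real (2 * m + 1)) * (1 / ?N) = 1 - (2 * real m + 1) / ?N"
    using card_V by (simp add: field_simps)
  finally show ?thesis unfolding expectation_entry[OF assms(1)] .
qed

end

section \<open>Moments of the random operator bound and their consequences\<close>

context random_weights
begin

definition row_max :: "'a \<Rightarrow> real" where
  "row_max \<omega> = Max ((\<lambda>w. \<Sum>u\<in>V. (Y {w, u} \<omega>)\<^sup>2) ` V)"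

definition entry_max :: "'a \<Rightarrow> real" where
  "entry_max \<omega> = Max ((\<lambda>e. (Y e \<omega>)\<^sup>2) ` edges V)"

text \<open>\<kappa> bounds the length of the walks. Both the trace of the power 2k and the fixed
  power 2m are treated with \<kappa> = 2k: one moment bound then serves both, and the excess over 2m
  makes \<open>entry_max\<close> small compared with \<open>rho\<close>.\<close>

definition rho :: "real \<Rightarrow> 'a \<Rightarrow> real" where
  "rho \<kappa> \<omega> = row_max \<omega> + 2 * \<kappa> * entry_max \<omega>"

lemma edges_nonempty: "edges V \<noteq> {}"
  using V_nonempty by (auto simp: edges_def)

lemma entry_max_ge: "e \<in> edges V \<Longrightarrow> (Y e \<omega>)\<^sup>2 \<le> entry_max \<omega>"
  unfolding entry_max_def using fin_V by (intro Max_ge) auto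

lemma row_max_ge: "w \<in> V \<Longrightarrow> (\<Sum>u\<in>V. (Y {w, u} \<omega>)\<^sup>2) \<le> row_max \<omega>"
  unfolding row_max_def using fin_V by (intro Max_ge) auto

lemma entry_max_nonneg: "0 \<le> entry_max \<omega>"
  using edges_nonempty entry_max_ge by (meson ex_in_conv order.trans zero_le_power2)

lemma row_max_nonneg: "0 \<le> row_max \<omega>"
proof -
  obtain w where "w \<in> V" using V_nonempty by blast
  from row_max_ge[OF this] show ?thesis by (rule order.trans[rotated]) (intro sum_nonneg, simp)
qed

lemma weight_bounds: "weight_bounds V (\<lambda>e. Y e \<omega>) (row_max \<omega>) (entry_max \<omega>)"
  using fin_V row_max_ge entry_max_ge entry_max_nonneg row_max_nonneg
  by unfold_locales (auto simp: edgesI)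

lemma rho_nonneg: "0 \<le> \<kappa> \<Longrightarrow> 0 \<le> rho \<kappa> \<omega>"
  unfolding rho_def using entry_max_nonneg row_max_nonneg by simp

lemma card_edges_le: "real (card (edges V)) \<le> (real (card V))\<^sup>2"
proof -
  have "card (edges V) \<le> card (V \<times> V)"
    unfolding edges_def using fin_V by (intro card_image_le) auto
  then have "real (card (edges V)) \<le> real (card (V \<times> V))" by linarith
  then show ?thesis by (simp add: card_cartesian_product power2_eq_square)
qed

text \<open>The edges {w, u} of a row are distinct, so the exponential moment factors. With x = k
  \<alpha> \<le> k \<eta> \<le> 1 one has exp x \<le> 1 + (1 + k \<eta>) x, and the mean of \<alpha>
  is at most 1 / card V.\<close>

lemma truncated_row_exp_moment:
  assumes w: "w \<in> V" and \<eta>: "0 < \<eta>" "real k * \<eta> \<le> 1"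
  defines "\<alpha> \<equiv> \<lambda>e \<omega>. if (Y e \<omega>)\<^sup>2 \<le> \<eta> then (Y e \<omega>)\<^sup>2 else 0"
  shows "integrable M (\<lambda>\<omega>. exp (real k * (\<Sum>u\<in>V. \<alpha> {w, u} \<omega>)))"
    and "expectation (\<lambda>\<omega>. exp (real k * (\<Sum>u\<in>V. \<alpha> {w, u} \<omega>))) \<le> exp (real k * (1 + real k * \<eta>))"
proof -
  define J where "J = (\<lambda>u. {w, u}) ` V"
  have J: "J \<subseteq> edges V" "finite J" using w fin_V unfolding J_def by auto
  have inj: "inj_on (\<lambda>u. {w, u}) V" by (auto simp: inj_on_def doubleton_eq_iff)
  have prod_eq: "exp (real k * (\<Sum>u\<in>V. \<alpha> {w, u} \<omega>)) = (\<Prod>e\<in>J. exp (real k * \<alpha> e \<omega>))" for \<omega>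
    unfolding J_def using fin_V by (simp add: prod.reindex[OF inj] sum_distrib_left exp_sum)
  have meas: "\<alpha> e \<in> borel_measurable M" if "e \<in> edges V" for e
    unfolding \<alpha>_def using measurable_Y[OF that] by measurable
  have bnd: "0 \<le> \<alpha> e \<omega>" "\<alpha> e \<omega> \<le> \<eta>" "\<alpha> e \<omega> \<le> (Y e \<omega>)\<^sup>2" for e \<omega>
    using \<eta> by (auto simp: \<alpha>_def)
  have int: "integrable M (\<lambda>\<omega>. exp (real k * \<alpha> e \<omega>))" if "e \<in> edges V" for e
  proof (rule integrable_const_bound[where B = "exp 1"])
    have "real k * \<alpha> e \<omega> \<le> 1" for \<omega>
      using mult_left_mono[OF bnd(2)[of e \<omega>], of "real k"] \<eta> by simp
    then show "AE \<omega> in M. norm (exp (real k * \<alpha> e \<omega>)) \<le> exp 1" by simp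
    show "(\<lambda>\<omega>. exp (real k * \<alpha> e \<omega>)) \<in> borel_measurable M" using meas[OF that] by measurable
  qed
  have ind: "indep_vars (\<lambda>_. borel) (\<lambda>e \<omega>. exp (real k * \<alpha> e \<omega>)) J"
    unfolding \<alpha>_def by (rule indep_vars_compose2[OF indep_vars_subset[OF indep J(1)]]) measurable
  show "integrable M (\<lambda>\<omega>. exp (real k * (\<Sum>u\<in>V. \<alpha> {w, u} \<omega>)))"
    unfolding prod_eq using J int by (intro indep_vars_integrable[OF J(2) ind]) auto
  have factor: "expectation (\<lambda>\<omega>. exp (real k * \<alpha> e \<omega>)) \<le> exp (real k * (1 + real k * \<eta>) / real (card V))"
    if e: "e \<in> edges V" for e
  proof -
    have "expectation (\<lambda>\<omega>. exp (real k * \<alpha> e \<omega>)) \<le> expectation (\<lambda>\<omega>. 1 + real k * (1 + real k * \<eta>) * (Y e \<omega>)\<^sup>2)"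
    proof (rule integral_mono[OF int[OF e]])
      show "integrable M (\<lambda>\<omega>. 1 + real k * (1 + real k * \<eta>) * (Y e \<omega>)\<^sup>2)"
        using integrable_pow[OF e] by auto
      fix \<omega>
      define x where "x = real k * \<alpha> e \<omega>"
      have x: "0 \<le> x" "x \<le> real k * \<eta>"
        using bnd[of e \<omega>] by (auto simp: x_def intro!: mult_left_mono)
      then have "exp x \<le> 1 + x + x\<^sup>2" using \<eta>(2) by (intro exp_bound) auto
      also have "\<dots> \<le> 1 + x + real k * \<eta> * x"
        using x by (simp add: power2_eq_square mult_right_mono)
      also have "\<dots> = 1 + (1 + real k * \<eta>) * x" by (simp add: algebra_simps)
      also have "\<dots> \<le> 1 + (1 + real k * \<eta>) * (real k * (Y e \<omega>)\<^sup>2)"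
        unfolding x_def using bnd[of e \<omega>] \<eta> by (intro add_left_mono mult_left_mono) auto
      finally show "exp (real k * \<alpha> e \<omega>) \<le> 1 + real k * (1 + real k * \<eta>) * (Y e \<omega>)\<^sup>2"
        by (simp add: x_def mult_ac)
    qed
    also have "\<dots> = 1 + real k * (1 + real k * \<eta>) / real (card V)"
      using integrable_pow[OF e] second_moment[OF e] by (simp add: prob_space)
    also have "\<dots> \<le> exp (real k * (1 + real k * \<eta>) / real (card V))" by (rule exp_ge_add_one_self)
    finally show ?thesis .
  qed
  have "expectation (\<lambda>\<omega>. exp (real k * (\<Sum>u\<in>V. \<alpha> {w, u} \<omega>))) = (\<Prod>e\<in>J. expectation (\<lambda>\<omega>. exp (real k * \<alpha> e \<omega>)))"
    unfolding prod_eq using J int by (intro indep_vars_lebesgue_integral[OF J(2) ind]) auto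
  also have "\<dots> \<le> (\<Prod>e\<in>J. exp (real k * (1 + real k * \<eta>) / real (card V)))"
    using J factor by (intro prod_mono) (auto intro!: Bochner_Integration.integral_nonneg)
  also have "\<dots> = exp (real k * (1 + real k * \<eta>) / real (card V)) ^ card V"
    by (simp add: J_def card_image[OF inj])
  also have "\<dots> = exp (real k * (1 + real k * \<eta>))"
    using card_V by (simp add: exp_of_nat_mult[symmetric])
  finally show "expectation (\<lambda>\<omega>. exp (real k * (\<Sum>u\<in>V. \<alpha> {w, u} \<omega>))) \<le> exp (real k * (1 + real k * \<eta>))" .
qed

text \<open>Exact at x = 1, the mean of a full squared row sum; the factor exp (-k) cancels the
  leading exp k of the exponential moment.\<close>

lemma pow_le_exp:
  fixes x :: real
  assumes "0 \<le> x"
  shows "x ^ k \<le> exp (real k * (x - 1))"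
proof -
  have "x \<le> exp (x - 1)" using exp_ge_add_one_self[of "x - 1"] by simp
  then have "x ^ k \<le> exp (x - 1) ^ k" using assms by (intro power_mono)
  then show ?thesis by (simp add: exp_of_nat_mult)
qed

text \<open>The squared entries are split at \<eta>. For the bounded part the maximum over rows is
  replaced by a sum of exponential moments. The large part is summed over all edges, and the k-th
  power of that sum costs the factor (card V)^(2k), which a small B has to compensate.\<close>

lemma rho_majorant:
  assumes k: "k > 0" and \<eta>: "0 < \<eta>" "real k * \<eta> \<le> 1" and "0 < \<epsilon>" "0 \<le> \<kappa>"
    and tail: "\<And>e. e \<in> edges V \<Longrightarrow> expectation (\<lambda>\<omega>. if (Y e \<omega>)\<^sup>2 \<le> \<eta> then 0 else Y e \<omega> ^ (2 * k)) \<le> B"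
  obtains H where "integrable M H" "\<And>\<omega>. rho \<kappa> \<omega> ^ k \<le> H \<omega>"
    "expectation H \<le> (1 + \<epsilon>) ^ k * (real (card V) * exp (real k * (real k + 2 * \<kappa>) * \<eta>)) +
      ((1 + 1 / \<epsilon>) * (1 + 2 * \<kappa>) * (real (card V))\<^sup>2) ^ k * ((real (card V))\<^sup>2 * B)"
proof -
  let ?N = "real (card V)"
  define \<alpha> where "\<alpha> = (\<lambda>e \<omega>. if (Y e \<omega>)\<^sup>2 \<le> \<eta> then (Y e \<omega>)\<^sup>2 else 0)"
  define \<gamma> where "\<gamma> = (\<lambda>e \<omega>. if (Y e \<omega>)\<^sup>2 \<le> \<eta> then 0 else (Y e \<omega>)\<^sup>2)"
  define A where "A w \<omega> = exp (real k * (\<Sum>u\<in>V. \<alpha> {w, u} \<omega>)) * exp (real k * (2 * \<kappa> * \<eta> - 1))" for w \<omega>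
  define C where "C = (1 + 1 / \<epsilon>) ^ k * ((1 + 2 * \<kappa>) ^ k * (?N\<^sup>2) ^ k)"
  define H where "H \<omega> = (1 + \<epsilon>) ^ k * (\<Sum>w\<in>V. A w \<omega>) + C * (\<Sum>e\<in>edges V. \<gamma> e \<omega> ^ k)" for \<omega>
  have C0: "0 \<le> C" unfolding C_def using assms by simp
  have nn: "0 \<le> \<alpha> e \<omega>" "0 \<le> \<gamma> e \<omega>" for e \<omega> by (auto simp: \<alpha>_def \<gamma>_def)
  have split: "(Y e \<omega>)\<^sup>2 = \<alpha> e \<omega> + \<gamma> e \<omega>" for e \<omega> by (auto simp: \<alpha>_def \<gamma>_def)
  have \<gamma>k: "\<gamma> e \<omega> ^ k = (if (Y e \<omega>)\<^sup>2 \<le> \<eta> then 0 else Y e \<omega> ^ (2 * k))" for e \<omega>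
    using k by (auto simp: \<gamma>_def power_mult)
  have int_A: "integrable M (A w)" if "w \<in> V" for w
    unfolding A_def \<alpha>_def using truncated_row_exp_moment(1)[OF that \<eta>] by simp
  have int_\<gamma>: "integrable M (\<lambda>\<omega>. \<gamma> e \<omega> ^ k)" if "e \<in> edges V" for e
  proof (rule Bochner_Integration.integrable_bound[OF integrable_pow[OF that, of "2 * k"]])
    show "(\<lambda>\<omega>. \<gamma> e \<omega> ^ k) \<in> borel_measurable M"
      unfolding \<gamma>_def using measurable_Y[OF that] by measurable
    show "AE \<omega> in M. norm (\<gamma> e \<omega> ^ k) \<le> norm (Y e \<omega> ^ (2 * k))"
      by (auto simp: \<gamma>k)
  qed
  show ?thesis
  proof (rule that)
    show "integrable M H"
      unfolding H_def using int_A int_\<gamma> by (intro Bochner_Integration.integrable_add integrable_mult_right Bochner_Integration.integrable_sum) auto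
    show "rho \<kappa> \<omega> ^ k \<le> H \<omega>" for \<omega>
    proof -
      define G where "G = (\<Sum>e\<in>edges V. \<gamma> e \<omega>)"
      have G0: "0 \<le> G" unfolding G_def using nn by (intro sum_nonneg)
      have "row_max \<omega> \<in> (\<lambda>w. \<Sum>u\<in>V. (Y {w, u} \<omega>)\<^sup>2) ` V"
        unfolding row_max_def using fin_V V_nonempty by (intro Max_in) auto
      then obtain w where w: "w \<in> V" "row_max \<omega> = (\<Sum>u\<in>V. (Y {w, u} \<omega>)\<^sup>2)" by blast
      have inj: "inj_on (\<lambda>u. {w, u}) V" by (auto simp: inj_on_def doubleton_eq_iff)
      have "(\<Sum>u\<in>V. \<gamma> {w, u} \<omega>) = (\<Sum>e\<in>(\<lambda>u. {w, u}) ` V. \<gamma> e \<omega>)"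
        by (simp add: sum.reindex[OF inj])
      also have "\<dots> \<le> G" unfolding G_def using fin_V w nn by (intro sum_mono2) auto
      finally have row: "row_max \<omega> \<le> (\<Sum>u\<in>V. \<alpha> {w, u} \<omega>) + G"
        unfolding w(2) split by (simp add: sum.distrib)
      have "entry_max \<omega> \<in> (\<lambda>e. (Y e \<omega>)\<^sup>2) ` edges V"
        unfolding entry_max_def using fin_V edges_nonempty by (intro Max_in) auto
      then obtain e where e: "e \<in> edges V" "entry_max \<omega> = (Y e \<omega>)\<^sup>2" by blast
      have "\<gamma> e \<omega> \<le> G" unfolding G_def using e fin_V nn by (intro member_le_sum) auto
      then have "entry_max \<omega> \<le> \<eta> + G" using e(2) \<eta>(1) G0 by (auto simp: \<gamma>_def split: if_splits)
      then have "2 * \<kappa> * entry_max \<omega> \<le> 2 * \<kappa> * (\<eta> + G)" using assms by (intro mult_left_mono) auto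
      then have le: "rho \<kappa> \<omega> \<le> ((\<Sum>u\<in>V. \<alpha> {w, u} \<omega>) + 2 * \<kappa> * \<eta>) + (1 + 2 * \<kappa>) * G"
        using row unfolding rho_def by (simp add: algebra_simps)
      have s0: "0 \<le> (\<Sum>u\<in>V. \<alpha> {w, u} \<omega>)" using nn by (intro sum_nonneg)
      have "rho \<kappa> \<omega> ^ k \<le> (((\<Sum>u\<in>V. \<alpha> {w, u} \<omega>) + 2 * \<kappa> * \<eta>) + (1 + 2 * \<kappa>) * G) ^ k"
        using le rho_nonneg assms by (intro power_mono) auto
      also have "\<dots> \<le> (1 + \<epsilon>) ^ k * ((\<Sum>u\<in>V. \<alpha> {w, u} \<omega>) + 2 * \<kappa> * \<eta>) ^ k + (1 + 1 / \<epsilon>) ^ k * ((1 + 2 * \<kappa>) * G) ^ k"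
        using s0 G0 assms by (intro add_pow_le) auto
      also have "\<dots> \<le> H \<omega>"
        unfolding H_def
      proof (rule add_mono)
        have "((\<Sum>u\<in>V. \<alpha> {w, u} \<omega>) + 2 * \<kappa> * \<eta>) ^ k \<le> exp (real k * ((\<Sum>u\<in>V. \<alpha> {w, u} \<omega>) + 2 * \<kappa> * \<eta> - 1))"
          using s0 assms by (intro pow_le_exp) auto
        also have "\<dots> = A w \<omega>" unfolding A_def exp_add[symmetric] by (simp add: algebra_simps)
        also have "\<dots> \<le> (\<Sum>w\<in>V. A w \<omega>)"
          using w fin_V by (intro member_le_sum) (auto simp: A_def)
        finally show "(1 + \<epsilon>) ^ k * ((\<Sum>u\<in>V. \<alpha> {w, u} \<omega>) + 2 * \<kappa> * \<eta>) ^ k \<le> (1 + \<epsilon>) ^ k * (\<Sum>w\<in>V. A w \<omega>)"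
          using assms by (intro mult_left_mono) auto
        have "G ^ k \<le> real (card (edges V)) ^ k * (\<Sum>e\<in>edges V. \<gamma> e \<omega> ^ k)"
          unfolding G_def using fin_V nn k by (intro sum_pow_le) auto
        also have "\<dots> \<le> (?N\<^sup>2) ^ k * (\<Sum>e\<in>edges V. \<gamma> e \<omega> ^ k)"
          using card_edges_le nn by (intro mult_right_mono power_mono sum_nonneg) auto
        finally have "(1 + 1 / \<epsilon>) ^ k * ((1 + 2 * \<kappa>) ^ k * G ^ k) \<le> (1 + 1 / \<epsilon>) ^ k * ((1 + 2 * \<kappa>) ^ k * ((?N\<^sup>2) ^ k * (\<Sum>e\<in>edges V. \<gamma> e \<omega> ^ k)))"
          using assms by (intro mult_left_mono) auto
        then show "(1 + 1 / \<epsilon>) ^ k * ((1 + 2 * \<kappa>) * G) ^ k \<le> C * (\<Sum>e\<in>edges V. \<gamma> e \<omega> ^ k)"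
          by (simp only: C_def power_mult_distrib mult.assoc)
      qed
      finally show ?thesis .
    qed
    have "expectation H = (1 + \<epsilon>) ^ k * (\<Sum>w\<in>V. expectation (A w)) + C * (\<Sum>e\<in>edges V. expectation (\<lambda>\<omega>. \<gamma> e \<omega> ^ k))"
      unfolding H_def using int_A int_\<gamma> by (simp add: Bochner_Integration.integral_sum Bochner_Integration.integrable_sum)
    also have "\<dots> \<le> (1 + \<epsilon>) ^ k * (\<Sum>w\<in>V. exp (real k * (real k + 2 * \<kappa>) * \<eta>)) + C * (\<Sum>e\<in>edges V. max 0 B)"
    proof (intro add_mono mult_left_mono sum_mono C0)
      fix w assume w: "w \<in> V"
      have "expectation (A w) = expectation (\<lambda>\<omega>. exp (real k * (\<Sum>u\<in>V. \<alpha> {w, u} \<omega>))) * exp (real k * (2 * \<kappa> * \<eta> - 1))"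
        unfolding A_def by simp
      also have "\<dots> \<le> exp (real k * (1 + real k * \<eta>)) * exp (real k * (2 * \<kappa> * \<eta> - 1))"
        unfolding \<alpha>_def using truncated_row_exp_moment(2)[OF w \<eta>] by (intro mult_right_mono) auto
      also have "\<dots> = exp (real k * (real k + 2 * \<kappa>) * \<eta>)"
        unfolding exp_add[symmetric] by (simp add: algebra_simps)
      finally show "expectation (A w) \<le> exp (real k * (real k + 2 * \<kappa>) * \<eta>)" .
    next
      fix e assume "e \<in> edges V"
      from tail[OF this] show "expectation (\<lambda>\<omega>. \<gamma> e \<omega> ^ k) \<le> max 0 B" unfolding \<gamma>k by simp
    qed (use assms in auto)
    also have "\<dots> \<le> (1 + \<epsilon>) ^ k * (?N * exp (real k * (real k + 2 * \<kappa>) * \<eta>)) + C * (?N\<^sup>2 * B)"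
    proof -
      obtain e where e: "e \<in> edges V" using edges_nonempty by blast
      have "0 \<le> expectation (\<lambda>\<omega>. if (Y e \<omega>)\<^sup>2 \<le> \<eta> then 0 else Y e \<omega> ^ (2 * k))"
        by (intro Bochner_Integration.integral_nonneg) auto
      with tail[OF e] have "0 \<le> B" by linarith
      then show ?thesis using card_edges_le C0 by (auto intro!: mult_left_mono mult_right_mono)
    qed
    finally show "expectation H \<le> (1 + \<epsilon>) ^ k * (?N * exp (real k * (real k + 2 * \<kappa>) * \<eta>)) +
        ((1 + 1 / \<epsilon>) * (1 + 2 * \<kappa>) * ?N\<^sup>2) ^ k * (?N\<^sup>2 * B)"
      by (simp only: C_def power_mult_distrib mult.assoc)
  qed
qed

lemma expectation_trace_le:
  assumes H: "integrable M H" "\<And>\<omega>. rho (2 * real k) \<omega> ^ k \<le> H \<omega>"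
  shows "expectation (\<lambda>\<omega>. \<Sum>v\<in>V. entry (2 * k) v v \<omega>) \<le> real (card V) * 4 ^ k * expectation H"
proof -
  have walk_le: "walk v (2 * k) v {} \<omega> \<le> 4 ^ k * H \<omega>" if v: "v \<in> V" for v \<omega>
  proof -
    interpret w: weight_bounds V "\<lambda>e. Y e \<omega>" "row_max \<omega>" "entry_max \<omega>" by (rule weight_bounds)
    have r: "0 \<le> rho (2 * real k) \<omega>" by (intro rho_nonneg) simp
    have "walk v (2 * k) v {} \<omega> \<le> real (ballot (2 * k) 0) * sqrt (rho (2 * real k) \<omega>) ^ (2 * k)"
      using w.walk_sum_return_le[of "2 * k" "rho (2 * real k) \<omega>", OF _ v] by (simp add: rho_def)
    also have "\<dots> = real (ballot (2 * k) 0) * rho (2 * real k) \<omega> ^ k"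
      using r by (simp add: power_mult)
    also have "\<dots> \<le> 2 ^ (2 * k) * H \<omega>"
    proof (rule mult_mono)
      have "real (ballot (2 * k) 0) \<le> real (2 ^ (2 * k))" using ballot_le of_nat_le_iff by blast
      then show "real (ballot (2 * k) 0) \<le> 2 ^ (2 * k)" by simp
    qed (use H(2) r in auto)
    finally show ?thesis by (simp add: power_mult)
  qed
  have "expectation (\<lambda>\<omega>. \<Sum>v\<in>V. entry (2 * k) v v \<omega>) = (\<Sum>v\<in>V. expectation (walk v (2 * k) v {}))"
    using integrable_entry expectation_entry by (simp add: Bochner_Integration.integral_sum)
  also have "\<dots> \<le> (\<Sum>v\<in>V. expectation (\<lambda>\<omega>. 4 ^ k * H \<omega>))"
    using H integrable_walk walk_le by (intro sum_mono integral_mono) auto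
  finally show ?thesis by simp
qed

lemma expectation_return_square_le:
  assumes v: "v \<in> V" and \<kappa>: "0 < \<kappa>" "2 * real m \<le> \<kappa>"
    and H: "integrable M H" "\<And>\<omega>. rho \<kappa> \<omega> ^ (2 * m) \<le> H \<omega>"
  shows "expectation (\<lambda>\<omega>. (entry (2 * m) v v \<omega>)\<^sup>2) \<le>
    ((real (ballot (2 * m) 0))\<^sup>2 + (2 * real m * (4 * real m + 1) * 2 ^ (2 * m))\<^sup>2 / (2 * \<kappa>)) * expectation H"
proof -
  let ?b = "real (ballot (2 * m) 0)" and ?C = "2 * real m * (4 * real m + 1) * 2 ^ (2 * m)"
  have ptw: "(\<Sum>T\<in>Pow (edges V). (walk v (2 * m) v T \<omega>)\<^sup>2) \<le> (?b\<^sup>2 + ?C\<^sup>2 / (2 * \<kappa>)) * H \<omega>" for \<omega>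
  proof -
    interpret w: weight_bounds V "\<lambda>e. Y e \<omega>" "row_max \<omega>" "entry_max \<omega>" by (rule weight_bounds)
    let ?r = "rho \<kappa> \<omega>"
    have r: "0 \<le> ?r" using \<kappa> by (intro rho_nonneg) simp
    have le: "row_max \<omega> + 2 * real (2 * m) * entry_max \<omega> \<le> ?r"
      unfolding rho_def using \<kappa> entry_max_nonneg by (intro add_left_mono mult_right_mono) auto
    have sq: "(sqrt ?r ^ (2 * m))\<^sup>2 = ?r ^ (2 * m)"
    proof -
      have "(sqrt ?r ^ (2 * m))\<^sup>2 = ((sqrt ?r)\<^sup>2) ^ (2 * m)"
        by (simp only: power_mult[symmetric] mult.commute)
      then show ?thesis using r by simp
    qed
    \<comment> \<open>2 \<kappa> \<open>entry_max\<close> is a summand of \<open>rho\<close>. In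
      this way the non-simple states contribute to the second moment only with a factor 1 / (2
      \<kappa>).\<close>
    have c: "entry_max \<omega> \<le> (1 / sqrt (2 * \<kappa>))\<^sup>2 * ?r"
      using \<kappa> row_max_nonneg[of \<omega>] by (simp add: power_divide rho_def field_simps)
    have "(\<Sum>T\<in>Pow (edges V). (walk v (2 * m) v T \<omega>)\<^sup>2) =
        (walk v (2 * m) v {} \<omega>)\<^sup>2 + (\<Sum>T\<in>Pow (edges V) - {{}}. (walk v (2 * m) v T \<omega>)\<^sup>2)"
      using fin_V by (intro sum.remove) auto
    also have "\<dots> \<le> (?b * sqrt ?r ^ (2 * m))\<^sup>2 +
        (real (2 * m) * (2 * real (2 * m) + 1) * 2 ^ (2 * m) * (1 / sqrt (2 * \<kappa>)) * sqrt ?r ^ (2 * m))\<^sup>2"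
    proof (rule add_mono)
      show "(walk v (2 * m) v {} \<omega>)\<^sup>2 \<le> (?b * sqrt ?r ^ (2 * m))\<^sup>2"
        using w.walk_sum_return_le[OF le v] by (subst abs_le_square_iff[symmetric]) auto
      show "(\<Sum>T\<in>Pow (edges V) - {{}}. (walk v (2 * m) v T \<omega>)\<^sup>2) \<le>
          (real (2 * m) * (2 * real (2 * m) + 1) * 2 ^ (2 * m) * (1 / sqrt (2 * \<kappa>)) * sqrt ?r ^ (2 * m))\<^sup>2"
        using \<kappa> by (intro w.walk_sum_closed_nonempty_le[OF le v _ c]) auto
    qed
    also have "\<dots> = (?b\<^sup>2 + ?C\<^sup>2 / (2 * \<kappa>)) * ?r ^ (2 * m)"
      unfolding power_mult_distrib sq using \<kappa>
      by (simp add: power_divide power_mult_distrib distrib_right)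
    also have "\<dots> \<le> (?b\<^sup>2 + ?C\<^sup>2 / (2 * \<kappa>)) * H \<omega>"
      using H(2) \<kappa> by (intro mult_left_mono) auto
    finally show ?thesis .
  qed
  have "expectation (\<lambda>\<omega>. (entry (2 * m) v v \<omega>)\<^sup>2) = expectation (\<lambda>\<omega>. \<Sum>T\<in>Pow (edges V). (walk v (2 * m) v T \<omega>)\<^sup>2)"
    by (rule expectation_entry_square[OF v])
  also have "\<dots> \<le> expectation (\<lambda>\<omega>. (?b\<^sup>2 + ?C\<^sup>2 / (2 * \<kappa>)) * H \<omega>)"
    using integrable_walk_walk[OF v v] H(1) ptw
    by (intro integral_mono) (auto simp: power2_eq_square)
  finally show ?thesis by simp
qed

text \<open>Above \<open>\<theta>\<close>, the power \<open>x\<^sup>n\<close> is at most \<open>\<theta>\<^sup>n (x / \<theta>)\<^sup>k\<close>, so a high moment controls the low ones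
  with almost no loss.\<close>

lemma low_moment_majorant:
  assumes H: "integrable M H" "\<And>\<omega>. rho \<kappa> \<omega> ^ k \<le> H \<omega>" "0 \<le> \<kappa>" "n \<le> k" "0 < \<theta>"
  shows "rho \<kappa> \<omega> ^ n \<le> \<theta> ^ n + \<theta> ^ n * (H \<omega> / \<theta> ^ k)"
proof (cases "rho \<kappa> \<omega> \<le> \<theta>")
  case True
  have "0 \<le> H \<omega>" using H(2)[of \<omega>] rho_nonneg[OF H(3), of \<omega>] by (meson order.trans zero_le_power)
  moreover have "rho \<kappa> \<omega> ^ n \<le> \<theta> ^ n" using True rho_nonneg[OF H(3)] by (intro power_mono)
  ultimately show ?thesis using assms by (simp add: add_increasing2)
next
  case False
  have "rho \<kappa> \<omega> ^ n / \<theta> ^ n = (rho \<kappa> \<omega> / \<theta>) ^ n" by (simp add: power_divide)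
  also have "\<dots> \<le> (rho \<kappa> \<omega> / \<theta>) ^ k" using False assms by (intro power_increasing) auto
  also have "\<dots> \<le> H \<omega> / \<theta> ^ k" using H(2)[of \<omega>] assms by (simp add: power_divide divide_right_mono)
  finally have "rho \<kappa> \<omega> ^ n \<le> \<theta> ^ n * (H \<omega> / \<theta> ^ k)" using assms by (simp add: field_simps)
  then show ?thesis using assms by (simp add: add_increasing)
qed

lemma prob_le_return:
  assumes v: "v \<in> V" and t: "t < expectation (entry n v v)"
  shows "prob {\<omega>\<in>space M. entry n v v \<omega> \<le> t} \<le>
    (expectation (\<lambda>\<omega>. (entry n v v \<omega>)\<^sup>2) - (expectation (entry n v v))\<^sup>2) / (expectation (entry n v v) - t)\<^sup>2"
proof -
  let ?Z = "entry n v v"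
  have [measurable]: "?Z \<in> borel_measurable M" using integrable_entry[OF v] by auto
  have "prob {\<omega>\<in>space M. ?Z \<omega> \<le> t} \<le> prob {\<omega>\<in>space M. expectation ?Z - t \<le> \<bar>?Z \<omega> - expectation ?Z\<bar>}"
    by (intro finite_measure_mono) auto
  also have "\<dots> \<le> variance ?Z / (expectation ?Z - t)\<^sup>2"
    using t integrable_entry_square[OF v] by (intro Chebyshev_inequality) auto
  also have "variance ?Z = expectation (\<lambda>\<omega>. (?Z \<omega>)\<^sup>2) - (expectation ?Z)\<^sup>2"
    using integrable_entry[OF v] integrable_entry_square[OF v] by (intro variance_eq) auto
  finally show ?thesis .
qed

end

subsection \<open>The dilute matrix\<close>

lemma (in pair_prob_space) integral_fst_times_snd:
  fixes f :: "'a \<Rightarrow> real" and h :: "'b \<Rightarrow> real"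
  assumes f: "integrable M1 f" and h: "integrable M2 h"
  shows "integrable (M1 \<Otimes>\<^sub>M M2) (\<lambda>\<omega>. f (fst \<omega>) * h (snd \<omega>))"
    and "(\<integral>\<omega>. f (fst \<omega>) * h (snd \<omega>) \<partial>(M1 \<Otimes>\<^sub>M M2)) = (\<integral>x. f x \<partial>M1) * (\<integral>y. h y \<partial>M2)"
proof -
  have [measurable]: "f \<in> borel_measurable M1" "h \<in> borel_measurable M2" using f h by auto
  show int: "integrable (M1 \<Otimes>\<^sub>M M2) (\<lambda>\<omega>. f (fst \<omega>) * h (snd \<omega>))"
  proof (rule Fubini_integrable)
    show "integrable M1 (\<lambda>x. \<integral>y. norm (f (fst (x, y)) * h (snd (x, y))) \<partial>M2)"
      using f h by (simp add: abs_mult)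
    show "AE x in M1. integrable M2 (\<lambda>y. f (fst (x, y)) * h (snd (x, y)))"
      using h by simp
  qed measurable
  show "(\<integral>\<omega>. f (fst \<omega>) * h (snd \<omega>) \<partial>(M1 \<Otimes>\<^sub>M M2)) = (\<integral>x. f x \<partial>M1) * (\<integral>y. h y \<partial>M2)"
    using integral_fst'[OF int] by simp
qed

lemma (in prob_space) zero_one_valued_moment:
  fixes X :: "'a \<Rightarrow> real"
  assumes [measurable]: "random_variable borel X"
    and one: "prob {\<omega>\<in>space M. X \<omega> = 1} = q" and zero: "prob {\<omega>\<in>space M. X \<omega> = 0} = 1 - q" and n: "n > 0"
  shows "integrable M (\<lambda>\<omega>. X \<omega> ^ n)" "expectation (\<lambda>\<omega>. X \<omega> ^ n) = q"
proof -
  let ?A = "{\<omega>\<in>space M. X \<omega> = 1}" and ?B = "{\<omega>\<in>space M. X \<omega> = 0}"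
  have "prob (?A \<union> ?B) = prob ?A + prob ?B" by (intro finite_measure_Union) auto
  then have "prob (?A \<union> ?B) = 1" using one zero by simp
  then have "AE \<omega> in M. \<omega> \<in> ?A \<union> ?B" by (intro AE_prob_1) auto
  then have ae: "AE \<omega> in M. X \<omega> ^ n = indicator ?A \<omega>"
    by (rule eventually_mono) (use n in auto)
  have "integrable M (indicator ?A :: 'a \<Rightarrow> real)" by (intro integrable_real_indicator) (auto simp: emeasure_eq_measure)
  then show "integrable M (\<lambda>\<omega>. X \<omega> ^ n)"
    using ae by (subst integrable_cong_AE[OF _ _ ae]) auto
  have "expectation (\<lambda>\<omega>. X \<omega> ^ n) = expectation (indicator ?A)"
    by (intro integral_cong_AE ae) auto
  also have "\<dots> = q" using one by simp
  finally show "expectation (\<lambda>\<omega>. X \<omega> ^ n) = q" .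
qed

text \<open>Independence is assumed only for index pairs 1 \<le> x \<le> y, hence the sorting of the
  endpoints and the shift away from vertices that start at 0.\<close>

definition edge_index :: "nat set \<Rightarrow> nat \<times> nat" where
  "edge_index e = (Suc (Min e), Suc (Max e))"

lemma edge_index_doubleton: "edge_index {i, j} = (Suc (min i j), Suc (max i j))"
  by (simp add: edge_index_def)

lemma inj_on_edge_index: "inj_on edge_index (edges V)"
  by (rule inj_onI) (auto simp: edges_def edge_index_doubleton min_def max_def split: if_splits)

lemma edge_index_range: "edge_index ` edges {..<N} \<subseteq> {(x, y). 1 \<le> x \<and> x \<le> y \<and> y \<le> N}"
  by (auto simp: edges_def edge_index_doubleton)

locale dilute_model =
  fixes Ma :: "'a measure" and Md :: "'b measure"
    and a :: "nat \<Rightarrow> nat \<Rightarrow> 'a \<Rightarrow> real" and d :: "nat \<Rightarrow> nat \<Rightarrow> 'b \<Rightarrow> real"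
    and N :: nat and p :: real
  assumes prob_a: "prob_space Ma" and prob_d: "prob_space Md"
    and indep_a: "prob_space.indep_vars Ma (\<lambda>_. borel) (\<lambda>(x, y). a x y) {(x, y). 1 \<le> x \<and> x \<le> y}"
    and sym_a: "\<And>x y w. 1 \<le> x \<Longrightarrow> 1 \<le> y \<Longrightarrow> w \<in> space Ma \<Longrightarrow> a y x w = a x y w"
    and odd_a: "\<And>x y k::nat. 1 \<le> x \<Longrightarrow> 1 \<le> y \<Longrightarrow> (\<integral>w. a x y w ^ (2 * k + 1) \<partial>Ma) = 0"
    and var_a: "\<And>x y. 1 \<le> x \<Longrightarrow> 1 \<le> y \<Longrightarrow> (\<integral>w. (a x y w)\<^sup>2 \<partial>Ma) = 1"
    and moments_finite: "\<And>k::nat. moment_sup Ma a (2 * k) < \<infinity>"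
    and N: "1 \<le> N" and p: "0 < p" "p \<le> real N"
    and indep_d: "prob_space.indep_vars Md (\<lambda>_. borel) (\<lambda>(x, y). d x y) {(x, y). 1 \<le> x \<and> x \<le> y \<and> y \<le> N}"
    and sym_d: "\<And>x y w. 1 \<le> x \<Longrightarrow> x \<le> N \<Longrightarrow> 1 \<le> y \<Longrightarrow> y \<le> N \<Longrightarrow> w \<in> space Md \<Longrightarrow> d y x w = d x y w"
    and d_one: "\<And>x y. 1 \<le> x \<Longrightarrow> x \<le> y \<Longrightarrow> y \<le> N \<Longrightarrow> \<P>(w in Md. d x y w = 1) = p / real N"
    and d_zero: "\<And>x y. 1 \<le> x \<Longrightarrow> x \<le> y \<Longrightarrow> y \<le> N \<Longrightarrow> \<P>(w in Md. d x y w = 0) = 1 - p / real N"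

sublocale dilute_model \<subseteq> A: prob_space Ma by (rule prob_a)
sublocale dilute_model \<subseteq> D: prob_space Md by (rule prob_d)
sublocale dilute_model \<subseteq> P: pair_prob_space Ma Md ..

context dilute_model
begin

definition weight :: "nat set \<Rightarrow> 'a \<times> 'b \<Rightarrow> real" where
  "weight e \<omega> = 1 / sqrt p * ((\<lambda>(x, y). a x y) (edge_index e) (fst \<omega>) * (\<lambda>(x, y). d x y) (edge_index e) (snd \<omega>))"

lemma edge_cases:
  assumes "e \<in> edges {..<N}"
  obtains x y where "edge_index e = (x, y)" "1 \<le> x" "x \<le> y" "y \<le> N"
  using edge_index_range[of N] assms by (cases "edge_index e") auto

lemma measurable_a: "1 \<le> x \<Longrightarrow> x \<le> y \<Longrightarrow> a x y \<in> borel_measurable Ma"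
  using indep_a unfolding A.indep_vars_def2 by auto

lemma measurable_d: "1 \<le> x \<Longrightarrow> x \<le> y \<Longrightarrow> y \<le> N \<Longrightarrow> d x y \<in> borel_measurable Md"
  using indep_d unfolding D.indep_vars_def2 by auto

lemma nn_moment_le: "1 \<le> x \<Longrightarrow> 1 \<le> y \<Longrightarrow> (\<integral>\<^sup>+ w. ennreal (a x y w ^ n) \<partial>Ma) \<le> moment_sup Ma a n"
  unfolding moment_sup_def by (rule SUP_upper2[of "(x, y)"]) auto

lemma integrable_a_even:
  assumes "1 \<le> x" "x \<le> y"
  shows "integrable Ma (\<lambda>w. a x y w ^ (2 * k))"
proof (rule integrableI_nonneg)
  show "(\<lambda>w. a x y w ^ (2 * k)) \<in> borel_measurable Ma" using measurable_a[OF assms] by measurable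
  show "(\<integral>\<^sup>+ w. ennreal (a x y w ^ (2 * k)) \<partial>Ma) < \<infinity>"
    using nn_moment_le[of x y "2 * k"] moments_finite[of k] assms by (simp add: order.strict_trans1)
qed simp

text \<open>Finiteness is known for even moments; |t| \<le> 1 + t^2 carries it over to all
  powers.\<close>

lemma integrable_a:
  assumes "1 \<le> x" "x \<le> y"
  shows "integrable Ma (\<lambda>w. a x y w ^ n)"
proof (rule Bochner_Integration.integrable_bound[of _ "\<lambda>w. 1 + a x y w ^ (2 * n)"])
  show "integrable Ma (\<lambda>w. 1 + a x y w ^ (2 * n))" using integrable_a_even[OF assms] by simp
  show "(\<lambda>w. a x y w ^ n) \<in> borel_measurable Ma" using measurable_a[OF assms] by measurable
  have "\<bar>t\<bar> \<le> 1 + t\<^sup>2" for t :: real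
    using zero_le_power2[of "\<bar>t\<bar> - 1"] by (simp add: power2_diff)
  then have "\<bar>a x y w ^ n\<bar> \<le> 1 + a x y w ^ (2 * n)" for w
    by (metis power_mult mult.commute)
  then show "AE w in Ma. norm (a x y w ^ n) \<le> norm (1 + a x y w ^ (2 * n))"
    by (intro AE_I2) (simp add: order.trans[OF _ abs_ge_self])
qed

lemma expectation_a_even_le:
  assumes "1 \<le> x" "x \<le> y" "moment_sup Ma a (2 * k) \<le> ennreal B" "0 \<le> B"
  shows "(\<integral>w. a x y w ^ (2 * k) \<partial>Ma) \<le> B"
proof -
  have "ennreal (\<integral>w. a x y w ^ (2 * k) \<partial>Ma) = (\<integral>\<^sup>+ w. ennreal (a x y w ^ (2 * k)) \<partial>Ma)"
    using integrable_a_even[OF assms(1,2)] by (intro nn_integral_eq_integral[symmetric]) auto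
  also have "\<dots> \<le> ennreal B" using nn_moment_le[of x y "2 * k"] assms by (auto intro: order.trans)
  finally show ?thesis using assms(4) by (simp add: ennreal_le_iff)
qed

lemma d_moment:
  assumes "1 \<le> x" "x \<le> y" "y \<le> N" "n > 0"
  shows "integrable Md (\<lambda>w. d x y w ^ n)" "(\<integral>w. d x y w ^ n \<partial>Md) = p / real N"
  using D.zero_one_valued_moment[OF measurable_d d_one d_zero] assms by auto

lemma weight_moment:
  assumes "edge_index e = (x, y)" "1 \<le> x" "x \<le> y" "y \<le> N" "n > 0"
  shows "integrable (Ma \<Otimes>\<^sub>M Md) (\<lambda>\<omega>. weight e \<omega> ^ n)"
    and "P.expectation (\<lambda>\<omega>. weight e \<omega> ^ n) = (1 / sqrt p) ^ n * (\<integral>w. a x y w ^ n \<partial>Ma) * (p / real N)"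
  using P.integral_fst_times_snd[OF integrable_a[OF assms(2,3), of n] d_moment(1)[OF assms(2-5)]]
  by (simp_all add: weight_def assms(1) power_mult_distrib power_divide d_moment(2)[OF assms(2-5)] mult.assoc)

sublocale W: random_weights "Ma \<Otimes>\<^sub>M Md" "{..<N}" weight
proof
  show "P.indep_vars (\<lambda>_. borel) weight (edges {..<N})"
    unfolding weight_def[abs_def]
    using A.indep_vars_subset[OF indep_a, of "{(x, y). 1 \<le> x \<and> x \<le> y \<and> y \<le> N}"]
    by (intro indep_vars_pair_times[OF prob_a prob_d _ indep_d inj_on_edge_index edge_index_range]) auto
next
  fix e n assume "e \<in> edges {..<N}"
  then obtain x y where xy: "edge_index e = (x, y)" "1 \<le> x" "x \<le> y" "y \<le> N" by (rule edge_cases)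
  show "integrable (Ma \<Otimes>\<^sub>M Md) (\<lambda>\<omega>. weight e \<omega> ^ n)"
    using weight_moment(1)[OF xy] by (cases "n = 0") auto
  show "P.expectation (\<lambda>\<omega>. weight e \<omega> ^ n) = 0" if "odd n"
  proof -
    have n: "n = 2 * (n div 2) + 1" using that by simp
    have "(\<integral>w. a x y w ^ n \<partial>Ma) = 0" using odd_a[of x y "n div 2"] xy unfolding n[symmetric] by simp
    then show ?thesis using weight_moment(2)[OF xy, of n] n by simp
  qed
  \<comment> \<open>The dilution cancels: 1 / p from the scaling, 1 from the variance of a, and p /
    N from d give 1 / N.\<close>
  show "P.expectation (\<lambda>\<omega>. (weight e \<omega>)\<^sup>2) = 1 / real (card {..<N})"
    using weight_moment(2)[OF xy, of 2] var_a[of x y] xy p by (simp add: power_divide)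
qed (use N in \<open>auto simp: lessThan_empty_iff\<close>)

text \<open>Beyond the truncation level, the j-th power of the squared weight over \<eta> is at
  least 1 and may be inserted: j further moments, with their factor p^-j, are bought at the price
  \<eta>^-j. The probability p / N is estimated by 1.\<close>

lemma weight_tail_le:
  assumes e: "e \<in> edges {..<N}" and \<eta>: "0 < \<eta>" and k: "0 < k"
    and B: "moment_sup Ma a (2 * (k + j)) \<le> ennreal B" "0 \<le> B"
  shows "P.expectation (\<lambda>\<omega>. if (weight e \<omega>)\<^sup>2 \<le> \<eta> then 0 else weight e \<omega> ^ (2 * k)) \<le> B / (p ^ (k + j) * \<eta> ^ j)"
proof -
  obtain x y where xy: "edge_index e = (x, y)" "1 \<le> x" "x \<le> y" "y \<le> N" using e by (rule edge_cases)
  have "P.expectation (\<lambda>\<omega>. if (weight e \<omega>)\<^sup>2 \<le> \<eta> then 0 else weight e \<omega> ^ (2 * k))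
      \<le> P.expectation (\<lambda>\<omega>. weight e \<omega> ^ (2 * (k + j)) / \<eta> ^ j)"
  proof (rule integral_mono)
    have [measurable]: "weight e \<in> borel_measurable (Ma \<Otimes>\<^sub>M Md)" by (rule W.measurable_Y[OF e])
    show "integrable (Ma \<Otimes>\<^sub>M Md) (\<lambda>\<omega>. if (weight e \<omega>)\<^sup>2 \<le> \<eta> then 0 else weight e \<omega> ^ (2 * k))"
      by (rule Bochner_Integration.integrable_bound[OF W.integrable_pow[OF e, of "2 * k"]]) auto
    show "integrable (Ma \<Otimes>\<^sub>M Md) (\<lambda>\<omega>. weight e \<omega> ^ (2 * (k + j)) / \<eta> ^ j)"
      using W.integrable_pow[OF e, of "2 * (k + j)"] by auto
    fix \<omega>
    show "(if (weight e \<omega>)\<^sup>2 \<le> \<eta> then 0 else weight e \<omega> ^ (2 * k)) \<le> weight e \<omega> ^ (2 * (k + j)) / \<eta> ^ j"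
    proof (cases "(weight e \<omega>)\<^sup>2 \<le> \<eta>")
      case False
      then have "\<eta> ^ j \<le> ((weight e \<omega>)\<^sup>2) ^ j" using \<eta> by (intro power_mono) auto
      then have "((weight e \<omega>)\<^sup>2) ^ k * \<eta> ^ j \<le> ((weight e \<omega>)\<^sup>2) ^ k * ((weight e \<omega>)\<^sup>2) ^ j"
        by (intro mult_left_mono) auto
      then show ?thesis using False \<eta> unfolding power_mult power_add by (simp add: pos_le_divide_eq)
    qed (use \<eta> in \<open>auto intro!: divide_nonneg_pos zero_le_even_power\<close>)
  qed
  also have "\<dots> = (1 / sqrt p) ^ (2 * (k + j)) * (\<integral>w. a x y w ^ (2 * (k + j)) \<partial>Ma) * (p / real N) / \<eta> ^ j"
    using weight_moment(2)[OF xy, of "2 * (k + j)"] k by simp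
  also have "(1 / sqrt p) ^ (2 * (k + j)) = 1 / p ^ (k + j)"
    using p unfolding power_mult by (simp add: power_divide)
  also have "1 / p ^ (k + j) * (\<integral>w. a x y w ^ (2 * (k + j)) \<partial>Ma) * (p / real N) / \<eta> ^ j
      \<le> 1 / p ^ (k + j) * B * 1 / \<eta> ^ j"
    using expectation_a_even_le[OF xy(2,3) B] B p N \<eta>
    by (intro divide_right_mono mult_mono mult_left_mono) (auto intro!: Bochner_Integration.integral_nonneg)
  finally show ?thesis by simp
qed

section \<open>The matrix, its powers and its spectral norm\<close>

abbreviation matrix :: "'a \<times> 'b \<Rightarrow> real mat" where
  "matrix \<omega> \<equiv> dilute_matrix N p (\<lambda>x y. a x y (fst \<omega>)) (\<lambda>x y. d x y (snd \<omega>))"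

lemma matrix_carrier: "matrix \<omega> \<in> carrier_mat N N"
  by (simp add: dilute_matrix_def)

lemma matrix_entry:
  assumes "\<omega> \<in> space (Ma \<Otimes>\<^sub>M Md)" "i < N" "j < N"
  shows "matrix \<omega> $$ (i, j) = weight {i, j} \<omega>"
proof -
  have "fst \<omega> \<in> space Ma" "snd \<omega> \<in> space Md" using assms(1) by (auto simp: space_pair_measure)
  then show ?thesis
    using assms sym_a[of "Suc i" "Suc j" "fst \<omega>"] sym_d[of "Suc i" "Suc j" "snd \<omega>"]
    by (cases "i \<le> j") (auto simp: dilute_matrix_def weight_def edge_index_doubleton min_def max_def)
qed

lemma matrix_symmetric:
  assumes "\<omega> \<in> space (Ma \<Otimes>\<^sub>M Md)" "i < N" "j < N"
  shows "matrix \<omega> $$ (i, j) = matrix \<omega> $$ (j, i)"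
  using matrix_entry[OF assms] matrix_entry[OF assms(1,3,2)] by (simp add: insert_commute)

lemma matrix_pow_entry:
  assumes \<omega>: "\<omega> \<in> space (Ma \<Otimes>\<^sub>M Md)" and "v < N" "u < N"
  shows "(matrix \<omega> ^\<^sub>m n) $$ (v, u) = W.entry n v u \<omega>"
  using assms(3)
proof (induction n arbitrary: u)
  case 0
  have "W.entry 0 v u \<omega> = (\<Sum>T\<in>Pow (edges {..<N}). if T = {} then (if u = v then 1 else 0) else 0)"
    unfolding W.entry_def by (intro sum.cong) auto
  also have "\<dots> = (if u = v then 1 else 0)" by (subst sum.delta) auto
  finally show ?case using assms(2) 0 matrix_carrier[of \<omega>] by (simp add: dilute_matrix_def)
next
  case (Suc n)
  have "(matrix \<omega> ^\<^sub>m Suc n) $$ (v, u) = (\<Sum>w<N. (matrix \<omega> ^\<^sub>m n) $$ (v, w) * matrix \<omega> $$ (w, u))"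
    using matrix_carrier[of \<omega>] assms(2) Suc.prems by (simp add: scalar_prod_def atLeast0LessThan)
  also have "\<dots> = (\<Sum>w<N. weight {w, u} \<omega> * W.entry n v w \<omega>)"
    using Suc matrix_entry[OF \<omega> _ Suc.prems] by (intro sum.cong) (auto simp: mult.commute)
  also have "\<dots> = W.entry (Suc n) v u \<omega>"
    unfolding W.entry_def using Suc.prems by (subst walk_sum_total) auto
  finally show ?case .
qed

text \<open>Markov's inequality for the trace. The set S is defined through the trace, a polynomial
  in the weights and thus measurable; probabilities of events about the norm are later bounded
  through this superset.\<close>

lemma prob_spectral_norm_ge:
  assumes s: "0 < s" and H: "integrable (Ma \<Otimes>\<^sub>M Md) H" "\<And>\<omega>. W.rho (2 * real k) \<omega> ^ k \<le> H \<omega>"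
  obtains S where "S \<in> sets (Ma \<Otimes>\<^sub>M Md)" "{\<omega>\<in>space (Ma \<Otimes>\<^sub>M Md). s \<le> spectral_norm (matrix \<omega>)} \<subseteq> S"
    "P.prob S \<le> real N * 4 ^ k * P.expectation H / s ^ (2 * k)"
proof
  let ?T = "\<lambda>\<omega>. \<Sum>v<N. W.entry (2 * k) v v \<omega>"
  let ?S = "{\<omega>\<in>space (Ma \<Otimes>\<^sub>M Md). s ^ (2 * k) \<le> ?T \<omega>}"
  have int: "integrable (Ma \<Otimes>\<^sub>M Md) ?T" using W.integrable_entry by auto
  have T: "?T \<omega> = (\<Sum>v<N. (matrix \<omega> ^\<^sub>m (2 * k)) $$ (v, v))" if "\<omega> \<in> space (Ma \<Otimes>\<^sub>M Md)" for \<omega>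
    using matrix_pow_entry[OF that] by simp
  show "?S \<in> sets (Ma \<Otimes>\<^sub>M Md)" using int by measurable
  have nn: "0 \<le> ?T \<omega>" if "\<omega> \<in> space (Ma \<Otimes>\<^sub>M Md)" for \<omega>
    unfolding T[OF that] using pow_mat_square_diag[OF matrix_carrier matrix_symmetric[OF that]]
    by (auto intro!: sum_nonneg)
  show "{\<omega>\<in>space (Ma \<Otimes>\<^sub>M Md). s \<le> spectral_norm (matrix \<omega>)} \<subseteq> ?S"
  proof safe
    fix x y assume \<omega>: "(x, y) \<in> space (Ma \<Otimes>\<^sub>M Md)" and le: "s \<le> spectral_norm (matrix (x, y))"
    have "s ^ (2 * k) \<le> spectral_norm (matrix (x, y)) ^ (2 * k)"
      using le s by (intro power_mono) auto
    also have "\<dots> \<le> ?T (x, y)"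
      unfolding T[OF \<omega>] using N by (intro spectral_norm_pow_le_trace[OF matrix_carrier _ matrix_symmetric[OF \<omega>]]) auto
    finally show "s ^ (2 * k) \<le> ?T (x, y)" .
  qed
  have "P.prob ?S \<le> P.expectation ?T / s ^ (2 * k)"
    using s nn by (intro integral_Markov_inequality_measure[where A = "{}"] int AE_I2) auto
  also have "\<dots> \<le> real N * 4 ^ k * P.expectation H / s ^ (2 * k)"
    using W.expectation_trace_le[OF H] s by (intro divide_right_mono) auto
  finally show "P.prob ?S \<le> real N * 4 ^ k * P.expectation H / s ^ (2 * k)" .
qed

lemma spectral_norm_ge_return:
  assumes "\<omega> \<in> space (Ma \<Otimes>\<^sub>M Md)" "v < N"
  shows "W.entry (2 * m) v v \<omega> \<le> spectral_norm (matrix \<omega>) ^ (2 * m)"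
  using diag_pow_le_spectral_norm[OF matrix_carrier assms(2) matrix_symmetric[OF assms(1)]]
    matrix_pow_entry[OF assms(1,2,2)] by simp

lemma spectral_norm_nonneg: "0 \<le> spectral_norm (matrix \<omega>)"
  using spectral_radius_mem_max(1)[of "map_mat complex_of_real (matrix \<omega>)" N] matrix_carrier[of \<omega>] N
  unfolding spectral_norm_def by force

end

subsection \<open>Asymptotics\<close>

text \<open>Here L stands for ln N. In units of n ln L, where n = k + j is of order L^2, the
  exponent receives 2 \<delta> from the moments, because ln n is about 2 ln L, then -(1 + \<delta>')
  from the powers of p, and at most 1 from the truncation level of order 1 / k. The total
  -(\<delta>' - 2 \<delta>) is negative, and all remaining terms are O(L^2), so they lose against
  L^2 ln L.\<close>

lemma tail_term_small:
  fixes \<delta> \<delta>' \<epsilon> C :: real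
  assumes \<delta>: "0 < \<delta>" "2 * \<delta> < \<delta>'" and \<epsilon>: "0 < \<epsilon>" and C: "1 \<le> C"
  obtains L0 where "\<And>(L::real) (k::nat) (j::nat) (p::real). L0 \<le> L \<Longrightarrow> 1 \<le> k \<Longrightarrow> real k \<le> C * L \<Longrightarrow> L\<^sup>2 \<le> real j \<Longrightarrow>
    real j \<le> 2 * L\<^sup>2 \<Longrightarrow> L powr (1 + \<delta>') \<le> p \<Longrightarrow>
    ((1 + 1 / \<epsilon>) * (1 + 2 * (2 * real k)) * (exp L)\<^sup>2) ^ k *
      ((exp L)\<^sup>2 * (real (k + j) powr (\<delta> * real (k + j)) / (p ^ (k + j) * (\<epsilon> / (5 * real k)) ^ j))) \<le> 1 / 2"
proof -
  define c where "c = ln (1 + 1 / \<epsilon>)"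
  define c1 where "c1 = ln (C + 2)"
  define c2 where "c2 = \<bar>ln (5 * C / \<epsilon>)\<bar>"
  \<comment> \<open>The coefficient of L^2 collected from the estimates \<open>b1\<close> to
    \<open>b6\<close>; the terms with ln L are kept apart.\<close>
  define K where "K = c * C + 4 * C\<^sup>2 + (2 * C + 2) + \<delta> * c1 * (C + 2) + c2 * 2"
  have c0: "0 \<le> c" "0 \<le> c1" "0 \<le> c2" using \<epsilon> C by (auto simp: c_def c1_def c2_def)
  \<comment> \<open>From here on (\<delta>' - 2 \<delta>) ln L is at least |K| + 1, which pushes the
    whole exponent below -1.\<close>
  define L0 where "L0 = max 1 (exp ((\<bar>K\<bar> + 1) / (\<delta>' - 2 * \<delta>)))"
  show thesis
  proof (rule that[of L0])
    fix L p :: real and k j :: nat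
    assume L: "L0 \<le> L" and k: "1 \<le> k" "real k \<le> C * L" and j: "L\<^sup>2 \<le> real j" "real j \<le> 2 * L\<^sup>2"
      and p: "L powr (1 + \<delta>') \<le> p"
    have L1: "1 \<le> L" using L by (simp add: L0_def)
    have lnL: "(\<bar>K\<bar> + 1) / (\<delta>' - 2 * \<delta>) \<le> ln L"
      using L by (intro ln_ge_iff[THEN iffD2]) (auto simp: L0_def)
    then have lnL': "\<bar>K\<bar> + 1 \<le> (\<delta>' - 2 * \<delta>) * ln L" using \<delta> by (simp add: divide_le_eq mult.commute)
    have lnL0: "0 \<le> ln L" using L1 by simp
    have LL: "L \<le> L\<^sup>2" "1 \<le> L\<^sup>2" using L1 by (auto simp: power2_eq_square mult_le_cancel_left1 intro: order.trans[OF _ mult_mono[of 1 L 1 L]])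
    have p0: "0 < p" using p L1 by (smt (verit) powr_gt_zero)
    have kj: "0 < real (k + j)" using k by simp
    let ?n = "real (k + j)"
    have e1: "((1 + 1 / \<epsilon>) * (1 + 2 * (2 * real k)) * (exp L)\<^sup>2) ^ k = exp (real k * (c + ln (1 + 4 * real k) + 2 * L))"
    proof -
      have "exp (c + ln (1 + 4 * real k) + 2 * L) = (1 + 1 / \<epsilon>) * (1 + 2 * (2 * real k)) * (exp L)\<^sup>2"
        using \<epsilon> by (simp add: exp_add c_def exp_double[symmetric] add_pos_pos)
      then show ?thesis by (simp add: exp_of_nat_mult)
    qed
    have e2: "?n powr (\<delta> * ?n) = exp (\<delta> * ?n * ln ?n)" using kj by (simp add: powr_def)
    have e3: "p ^ (k + j) = exp (?n * ln p)" using p0 exp_of_nat_mult[of "k + j" "ln p"] by simp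
    have e4: "(\<epsilon> / (5 * real k)) ^ j = exp (real j * (- ln (5 * real k / \<epsilon>)))"
    proof -
      have "exp (- ln (5 * real k / \<epsilon>)) = \<epsilon> / (5 * real k)" using \<epsilon> k by (simp add: exp_minus)
      then show ?thesis by (simp only: exp_of_nat_mult)
    qed
    let ?E = "real k * (c + ln (1 + 4 * real k) + 2 * L) + (2 * L + (\<delta> * ?n * ln ?n - (?n * ln p + real j * (- ln (5 * real k / \<epsilon>)))))"
    have eq: "((1 + 1 / \<epsilon>) * (1 + 2 * (2 * real k)) * (exp L)\<^sup>2) ^ k *
      ((exp L)\<^sup>2 * (?n powr (\<delta> * ?n) / (p ^ (k + j) * (\<epsilon> / (5 * real k)) ^ j))) = exp ?E"
      unfolding e1 e2 e3 e4 by (simp only: exp_double[symmetric] exp_add[symmetric] exp_diff[symmetric])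
    have b1: "real k * c \<le> c * C * L\<^sup>2"
    proof -
      have "real k * c \<le> (C * L\<^sup>2) * c" using k LL C c0 by (intro mult_right_mono) (auto intro: order.trans mult_left_mono)
      then show ?thesis by (simp add: mult_ac)
    qed
    have b2: "real k * ln (1 + 4 * real k) \<le> 4 * C\<^sup>2 * L\<^sup>2"
    proof -
      have "real k * ln (1 + 4 * real k) \<le> real k * (4 * real k)"
        using ln_add_one_self_le_self[of "4 * real k"] by (intro mult_left_mono) auto
      also have "\<dots> \<le> (C * L) * (4 * (C * L))" using k C L1 by (intro mult_mono) auto
      finally show ?thesis by (simp add: power2_eq_square mult_ac)
    qed
    have b3: "real k * (2 * L) + 2 * L \<le> (2 * C + 2) * L\<^sup>2"
    proof -
      have "real k * (2 * L) \<le> (C * L) * (2 * L)" using k L1 by (intro mult_right_mono) auto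
      then show ?thesis using LL by (simp add: power2_eq_square algebra_simps)
    qed
    have n_le: "?n \<le> (C + 2) * L\<^sup>2"
    proof -
      have "C * L \<le> C * L\<^sup>2" using LL C by (intro mult_left_mono) auto
      then show ?thesis using k j by (simp add: algebra_simps)
    qed
    have ln_n: "ln ?n \<le> c1 + 2 * ln L"
    proof -
      have "ln ?n \<le> ln ((C + 2) * L\<^sup>2)" using n_le kj by (subst ln_le_cancel_iff) auto
      also have "\<dots> = c1 + 2 * ln L" using C L1 by (simp add: ln_mult c1_def ln_realpow)
      finally show ?thesis .
    qed
    have b4: "\<delta> * ?n * ln ?n \<le> \<delta> * c1 * (C + 2) * L\<^sup>2 + 2 * \<delta> * ?n * ln L"
    proof -
      have "\<delta> * ?n * ln ?n \<le> \<delta> * ?n * (c1 + 2 * ln L)" using ln_n \<delta> kj by (intro mult_left_mono) auto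
      also have "\<dots> = (\<delta> * c1) * ?n + 2 * \<delta> * ?n * ln L" by (simp add: algebra_simps)
      also have "\<dots> \<le> (\<delta> * c1) * ((C + 2) * L\<^sup>2) + 2 * \<delta> * ?n * ln L"
        using n_le \<delta> c0 by (intro add_right_mono mult_left_mono) auto
      finally show ?thesis by (simp add: mult_ac)
    qed
    have b5: "?n * ((1 + \<delta>') * ln L) \<le> ?n * ln p"
    proof (rule mult_left_mono)
      have "ln (L powr (1 + \<delta>')) \<le> ln p" using p p0 L1 by (subst ln_le_cancel_iff) auto
      then show "(1 + \<delta>') * ln L \<le> ln p" using L1 by (simp add: ln_powr)
    qed simp
    have b6: "real j * ln (5 * real k / \<epsilon>) \<le> c2 * 2 * L\<^sup>2 + ?n * ln L"
    proof -
      have "ln (5 * real k / \<epsilon>) \<le> ln ((5 * C / \<epsilon>) * L)"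
        using k \<epsilon> C L1 by (subst ln_le_cancel_iff) (auto simp: divide_right_mono)
      also have "\<dots> = ln (5 * C / \<epsilon>) + ln L" using \<epsilon> C L1 by (intro ln_mult_pos) auto
      also have "\<dots> \<le> c2 + ln L" by (simp add: c2_def)
      finally have "real j * ln (5 * real k / \<epsilon>) \<le> real j * (c2 + ln L)" by (intro mult_left_mono) auto
      also have "\<dots> \<le> (2 * L\<^sup>2) * c2 + ?n * ln L"
        unfolding distrib_left using j c0 lnL0 by (intro add_mono mult_right_mono) auto
      finally show ?thesis by (simp add: mult_ac)
    qed
    have "?E \<le> K * L\<^sup>2 + (2 * \<delta> * ?n * ln L - ?n * ((1 + \<delta>') * ln L) + ?n * ln L)"
      using b1 b2 b3 b4 b5 b6 unfolding K_def distrib_left distrib_right by linarith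
    also have "\<dots> = K * L\<^sup>2 - ?n * ((\<delta>' - 2 * \<delta>) * ln L)" by (simp add: algebra_simps)
    also have "\<dots> \<le> \<bar>K\<bar> * L\<^sup>2 - L\<^sup>2 * (\<bar>K\<bar> + 1)"
    proof (rule diff_mono)
      show "K * L\<^sup>2 \<le> \<bar>K\<bar> * L\<^sup>2" by (intro mult_right_mono) auto
      show "L\<^sup>2 * (\<bar>K\<bar> + 1) \<le> ?n * ((\<delta>' - 2 * \<delta>) * ln L)"
        using lnL' j by (intro mult_mono) auto
    qed
    also have "\<dots> \<le> - 1" using LL by (simp add: algebra_simps)
    finally have "exp ?E \<le> exp (- 1)" by simp
    also have "\<dots> \<le> 1 / (2::real)" using exp_ge_add_one_self[of "1::real"] by (simp add: exp_minus field_simps)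
    finally show "((1 + 1 / \<epsilon>) * (1 + 2 * (2 * real k)) * (exp L)\<^sup>2) ^ k *
      ((exp L)\<^sup>2 * (?n powr (\<delta> * ?n) / (p ^ (k + j) * (\<epsilon> / (5 * real k)) ^ j))) \<le> 1 / 2"
      unfolding eq .
  qed
qed

text \<open>The Catalan numbers lose only a polynomial factor against 4^m, while (2 -
  \<epsilon>)^(2m) loses a geometric one. The quarter leaves a gap to the expected return entry,
  which is later at least half the ballot number.\<close>

lemma exists_return_dominating:
  fixes \<epsilon> :: real
  assumes "0 < \<epsilon>" "\<epsilon> \<le> 1"
  obtains m where "(2 - \<epsilon>) ^ (2 * m) \<le> real (ballot (2 * m) 0) / 4" "0 < ballot (2 * m) 0"
proof -
  define r where "r = ((2 - \<epsilon>) / 2)\<^sup>2"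
  have "0 < r" using assms by (simp add: r_def)
  moreover have "r < 1" using power_strict_mono[of "(2 - \<epsilon>) / 2" 1 2] assms by (simp add: r_def)
  ultimately have "(\<lambda>m. (real m + 1)\<^sup>2 * r ^ m) \<longlonglongrightarrow> 0" by real_asymp
  then have "eventually (\<lambda>m. (real m + 1)\<^sup>2 * r ^ m < 1 / 8) sequentially"
    by (rule order_tendstoD) simp
  then obtain m where m: "(real m + 1)\<^sup>2 * r ^ m < 1 / 8"
    using eventually_happens trivial_limit_sequentially by blast
  have r: "r ^ m * 4 ^ m = (2 - \<epsilon>) ^ (2 * m)"
  proof -
    have "r * 4 = (2 - \<epsilon>)\<^sup>2" by (simp add: r_def power_divide)
    then show ?thesis by (simp only: power_mult_distrib[symmetric] power_mult)
  qed
  have "(2 - \<epsilon>) ^ (2 * m) \<le> r ^ m * (real (ballot (2 * m) 0) * (2 * (real m + 1)\<^sup>2))"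
    unfolding r[symmetric] using ballot_closed_ge[of m] assms by (intro mult_left_mono) (auto simp: r_def)
  also have "\<dots> = real (ballot (2 * m) 0) * 2 * ((real m + 1)\<^sup>2 * r ^ m)" by simp
  also have "\<dots> \<le> real (ballot (2 * m) 0) * 2 * (1 / 8)" using m by (intro mult_left_mono) auto
  finally have le: "(2 - \<epsilon>) ^ (2 * m) \<le> real (ballot (2 * m) 0) / 4" by simp
  moreover have "0 < (2 - \<epsilon>) ^ (2 * m)" using assms by simp
  ultimately have "0 < ballot (2 * m) 0" by (cases "ballot (2 * m) 0") auto
  with le show ?thesis by (rule that)
qed

section \<open>The truncation level and the combination of both bounds at fixed N\<close>

context dilute_model
begin

lemma moment_majorant:
  assumes k: "1 \<le> k" and \<epsilon>: "0 < \<epsilon>" "\<epsilon> \<le> 5"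
    and mom: "moment_sup Ma a (2 * (k + j)) \<le> ennreal (real (k + j) powr (\<delta> * real (k + j)))"
    and main: "real N * ((1 + \<epsilon>) * exp \<epsilon>) ^ k \<le> \<theta> ^ k / 2"
    and tail: "((1 + 1 / \<epsilon>) * (1 + 2 * (2 * real k)) * (real N)\<^sup>2) ^ k *
      ((real N)\<^sup>2 * (real (k + j) powr (\<delta> * real (k + j)) / (p ^ (k + j) * (\<epsilon> / (5 * real k)) ^ j))) \<le> \<theta> ^ k / 2"
  obtains H where "integrable (Ma \<Otimes>\<^sub>M Md) H" "\<And>\<omega>. W.rho (2 * real k) \<omega> ^ k \<le> H \<omega>" "P.expectation H \<le> \<theta> ^ k"
proof -
  \<comment> \<open>With \<kappa> = 2k the exponent k (k + 2 \<kappa>) \<eta> is 5 k^2 \<eta>, so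
    this level turns it into k \<epsilon>.\<close>
  let ?\<eta> = "\<epsilon> / (5 * real k)"
  let ?B = "real (k + j) powr (\<delta> * real (k + j)) / (p ^ (k + j) * ?\<eta> ^ j)"
  have \<eta>: "0 < ?\<eta>" "real k * ?\<eta> \<le> 1" using k \<epsilon> by auto
  have T: "P.expectation (\<lambda>\<omega>. if (weight e \<omega>)\<^sup>2 \<le> ?\<eta> then 0 else weight e \<omega> ^ (2 * k)) \<le> ?B"
    if "e \<in> edges {..<N}" for e
    using weight_tail_le[OF that \<eta>(1) _ mom] k by simp
  have k0: "0 < k" "0 \<le> 2 * real k" using k by auto
  obtain H where H: "integrable (Ma \<Otimes>\<^sub>M Md) H" "\<And>\<omega>. W.rho (2 * real k) \<omega> ^ k \<le> H \<omega>"
    and EH: "P.expectation H \<le> (1 + \<epsilon>) ^ k * (real (card {..<N}) * exp (real k * (real k + 2 * (2 * real k)) * ?\<eta>)) +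
      ((1 + 1 / \<epsilon>) * (1 + 2 * (2 * real k)) * (real (card {..<N}))\<^sup>2) ^ k * ((real (card {..<N}))\<^sup>2 * ?B)"
    using W.rho_majorant[OF k0(1) \<eta> \<epsilon>(1) k0(2) T] by blast
  have me: "(1 + \<epsilon>) ^ k * (real N * exp (real k * (real k + 2 * (2 * real k)) * ?\<eta>)) = real N * ((1 + \<epsilon>) * exp \<epsilon>) ^ k"
  proof -
    have "real k * (real k + 2 * (2 * real k)) * ?\<eta> = real k * \<epsilon>" using k by (simp add: field_simps)
    then have "exp (real k * (real k + 2 * (2 * real k)) * ?\<eta>) = exp \<epsilon> ^ k" by (simp only: exp_of_nat_mult)
    then show ?thesis by (simp add: power_mult_distrib)
  qed
  have "P.expectation H \<le> \<theta> ^ k / 2 + \<theta> ^ k / 2"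
    using EH[unfolded card_lessThan me] main tail by linarith
  then show ?thesis using that[OF H] by simp
qed

text \<open>One majorant H serves both directions. Above 2, the assumption N \<le> \<theta>^k
  absorbs the number of diagonal entries into the trace bound. Below 2, Chebyshev's inequality is
  applied to the return entry at vertex 0, whose expectation and second moment agree up to the
  factors shown.\<close>

lemma deviation_prob_le:
  assumes \<epsilon>: "0 < \<epsilon>" "\<epsilon> \<le> \<epsilon>0" and \<theta>: "1 < \<theta>" and N\<theta>: "real N \<le> \<theta> ^ k" and k: "1 \<le> k" "2 * m \<le> k"
    and H: "integrable (Ma \<Otimes>\<^sub>M Md) H" "\<And>\<omega>. W.rho (2 * real k) \<omega> ^ k \<le> H \<omega>" "P.expectation H \<le> \<theta> ^ k"
    and b: "(2 - \<epsilon>) ^ (2 * m) \<le> real (ballot (2 * m) 0) / 4" "0 < ballot (2 * m) 0" "\<epsilon> \<le> 1"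
    and Nm: "2 * m + 1 \<le> N" "1 / 2 \<le> (1 - (2 * real m + 1) / real N) ^ m"
  shows "\<P>(\<omega> in Ma \<Otimes>\<^sub>M Md. \<bar>spectral_norm (matrix \<omega>) - 2\<bar> > \<epsilon>0) \<le>
    (4 * \<theta>\<^sup>2 / (2 + \<epsilon>)\<^sup>2) ^ k +
    16 * ((1 + (2 * real m * (4 * real m + 1) * 2 ^ (2 * m))\<^sup>2 / (4 * real k * (real (ballot (2 * m) 0))\<^sup>2)) *
      (\<theta> ^ (4 * m) * (1 + (1 / \<theta>) ^ k)) - ((1 - (2 * real m + 1) / real N) ^ m)\<^sup>2)"
proof -
  let ?b = "real (ballot (2 * m) 0)" and ?C = "2 * real m * (4 * real m + 1) * 2 ^ (2 * m)"
  let ?q = "(1 - (2 * real m + 1) / real N) ^ m"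
  let ?Z = "W.entry (2 * m) 0 0"
  have v: "0 \<in> {..<N}" using N by simp
  have b0: "0 < ?b" using b(2) by simp
  obtain S where S: "S \<in> sets (Ma \<Otimes>\<^sub>M Md)" "{\<omega>\<in>space (Ma \<Otimes>\<^sub>M Md). 2 + \<epsilon> \<le> spectral_norm (matrix \<omega>)} \<subseteq> S"
      "P.prob S \<le> real N * 4 ^ k * P.expectation H / (2 + \<epsilon>) ^ (2 * k)"
    using prob_spectral_norm_ge[OF _ H(1,2), of "2 + \<epsilon>"] \<epsilon> by auto
  have "real N * 4 ^ k * P.expectation H / (2 + \<epsilon>) ^ (2 * k) \<le> \<theta> ^ k * 4 ^ k * \<theta> ^ k / (2 + \<epsilon>) ^ (2 * k)"
    using N\<theta> H(3) \<epsilon> \<theta> k by (intro divide_right_mono mult_mono mult_right_mono)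
      (auto intro!: Bochner_Integration.integral_nonneg order.trans[OF _ H(2)] zero_le_power W.rho_nonneg)
  also have "\<dots> = (4 * \<theta>\<^sup>2 / (2 + \<epsilon>)\<^sup>2) ^ k"
    by (simp add: power_divide power_mult_distrib power_mult[symmetric] mult.commute mult.left_commute)
      (simp add: power_mult power2_eq_square power_mult_distrib)
  finally have pS: "P.prob S \<le> (4 * \<theta>\<^sup>2 / (2 + \<epsilon>)\<^sup>2) ^ k" using S(3) by linarith
  let ?S' = "{\<omega>\<in>space (Ma \<Otimes>\<^sub>M Md). ?Z \<omega> \<le> (2 - \<epsilon>) ^ (2 * m)}"
  have S': "?S' \<in> sets (Ma \<Otimes>\<^sub>M Md)" using W.integrable_entry[OF v, of "2 * m" 0] by measurable
  have EZ: "?b * ?q \<le> P.expectation ?Z"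
    using W.expectation_return_ge[OF v, of m] Nm by simp
  have "?b / 2 \<le> ?b * ?q" using Nm(2) b0 by simp
  \<comment> \<open>The mean is at least half the ballot number, the threshold at most a quarter of
    it; squaring this gap in Chebyshev's inequality produces the factor 16.\<close>
  then have gap: "?b / 4 \<le> P.expectation ?Z - (2 - \<epsilon>) ^ (2 * m)" using EZ b(1) by linarith
  let ?t = "\<theta> ^ (4 * m)"
  \<comment> \<open>The cut-off is \<theta>^2 rather than \<theta>: as H has expectation at most
    \<theta>^k, the error becomes (1 / \<theta>)^k, which vanishes as k grows.\<close>
  let ?H2 = "\<lambda>\<omega>. ?t + ?t * (H \<omega> / (\<theta>\<^sup>2) ^ k)"
  have t: "(\<theta>\<^sup>2) ^ (2 * m) = ?t" by (simp add: power_mult[symmetric])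
  have H2: "integrable (Ma \<Otimes>\<^sub>M Md) ?H2" using H(1) by simp
  have maj: "W.rho (2 * real k) \<omega> ^ (2 * m) \<le> ?H2 \<omega>" for \<omega>
    using W.low_moment_majorant[OF H(1,2) _ k(2), of "\<theta>\<^sup>2" \<omega>] \<theta> unfolding t by simp
  have "P.expectation ?H2 = ?t + ?t * (P.expectation H / (\<theta>\<^sup>2) ^ k)"
    using H(1) by (simp add: P.prob_space)
  also have "\<dots> \<le> ?t + ?t * (\<theta> ^ k / (\<theta>\<^sup>2) ^ k)"
    using H(3) \<theta> by (intro add_left_mono mult_left_mono divide_right_mono) auto
  also have "\<theta> ^ k / (\<theta>\<^sup>2) ^ k = (1 / \<theta>) ^ k"
    using \<theta> by (simp add: power_divide[symmetric] power2_eq_square)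
  finally have EH2: "P.expectation ?H2 \<le> ?t * (1 + (1 / \<theta>) ^ k)" by (simp only: distrib_left mult_1_right)
  have "P.expectation (\<lambda>\<omega>. (?Z \<omega>)\<^sup>2) \<le> (?b\<^sup>2 + ?C\<^sup>2 / (2 * (2 * real k))) * P.expectation ?H2"
    using k \<theta> by (intro W.expectation_return_square_le[OF v _ _ H2 maj]) auto
  also have "\<dots> \<le> (?b\<^sup>2 + ?C\<^sup>2 / (2 * (2 * real k))) * (\<theta> ^ (4 * m) * (1 + (1 / \<theta>) ^ k))"
    using EH2 by (intro mult_left_mono) auto
  also have "?b\<^sup>2 + ?C\<^sup>2 / (2 * (2 * real k)) = ?b\<^sup>2 * (1 + ?C\<^sup>2 / (4 * real k * ?b\<^sup>2))"
    using b0 k by (simp add: field_simps)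
  finally have EZ2: "P.expectation (\<lambda>\<omega>. (?Z \<omega>)\<^sup>2) \<le> ?b\<^sup>2 * ((1 + ?C\<^sup>2 / (4 * real k * ?b\<^sup>2)) * (\<theta> ^ (4 * m) * (1 + (1 / \<theta>) ^ k)))"
    by (simp only: mult.assoc)
  have sq: "?b\<^sup>2 * ?q\<^sup>2 \<le> (P.expectation ?Z)\<^sup>2"
    using EZ Nm(2) b0 by (simp only: power_mult_distrib[symmetric]) (intro power_mono mult_nonneg_nonneg; simp)
  have num: "P.expectation (\<lambda>\<omega>. (?Z \<omega>)\<^sup>2) - (P.expectation ?Z)\<^sup>2 \<le>
      ?b\<^sup>2 * ((1 + ?C\<^sup>2 / (4 * real k * ?b\<^sup>2)) * (\<theta> ^ (4 * m) * (1 + (1 / \<theta>) ^ k)) - ?q\<^sup>2)" (is "_ \<le> ?b\<^sup>2 * ?X")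
    unfolding right_diff_distrib using EZ2 sq by linarith
  have var: "P.expectation (\<lambda>\<omega>. (?Z \<omega>)\<^sup>2) - (P.expectation ?Z)\<^sup>2 = P.variance ?Z"
    using W.integrable_entry[OF v] W.integrable_entry_square[OF v] by (intro P.variance_eq[symmetric]) auto
  have "0 \<le> P.variance ?Z" by (intro Bochner_Integration.integral_nonneg) auto
  then have nn: "0 \<le> ?b\<^sup>2 * ?X" using num unfolding var by linarith
  have "P.prob ?S' \<le> (P.expectation (\<lambda>\<omega>. (?Z \<omega>)\<^sup>2) - (P.expectation ?Z)\<^sup>2) / (P.expectation ?Z - (2 - \<epsilon>) ^ (2 * m))\<^sup>2"
    using gap b0 by (intro W.prob_le_return[OF v]) linarith
  also have "\<dots> \<le> (?b\<^sup>2 * ?X) / (?b / 4)\<^sup>2"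
    using gap b0 by (intro frac_le nn num power_mono) auto
  also have "\<dots> = 16 * ?X" using b0 by (simp add: power_divide)
  finally have pS': "P.prob ?S' \<le> 16 * ?X" .
  have "{\<omega>\<in>space (Ma \<Otimes>\<^sub>M Md). \<bar>spectral_norm (matrix \<omega>) - 2\<bar> > \<epsilon>0} \<subseteq> S \<union> ?S'"
  proof
    fix \<omega> assume "\<omega> \<in> {\<omega>\<in>space (Ma \<Otimes>\<^sub>M Md). \<bar>spectral_norm (matrix \<omega>) - 2\<bar> > \<epsilon>0}"
    then have \<omega>: "\<omega> \<in> space (Ma \<Otimes>\<^sub>M Md)" and dev: "\<bar>spectral_norm (matrix \<omega>) - 2\<bar> > \<epsilon>0" by auto
    show "\<omega> \<in> S \<union> ?S'"
    proof (cases "2 + \<epsilon> \<le> spectral_norm (matrix \<omega>)")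
      case True
      then show ?thesis using S(2) \<omega> by blast
    next
      case False
      then have "spectral_norm (matrix \<omega>) \<le> 2 - \<epsilon>" using dev \<epsilon> by linarith
      then have "spectral_norm (matrix \<omega>) ^ (2 * m) \<le> (2 - \<epsilon>) ^ (2 * m)"
        by (intro power_mono spectral_norm_nonneg)
      then have "?Z \<omega> \<le> (2 - \<epsilon>) ^ (2 * m)"
        using spectral_norm_ge_return[OF \<omega>, of 0 m] N by linarith
      then show ?thesis using \<omega> by simp
    qed
  qed
  then have "\<P>(\<omega> in Ma \<Otimes>\<^sub>M Md. \<bar>spectral_norm (matrix \<omega>) - 2\<bar> > \<epsilon>0) \<le> P.prob (S \<union> ?S')"
    using S(1) S' by (intro P.finite_measure_mono) auto
  also have "\<dots> \<le> P.prob S + P.prob ?S'" using S(1) S' by (intro measure_Un_le)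
  finally show ?thesis using pS pS' by linarith
qed

end

section \<open>Choice of the parameters in terms of N and passage to the limit\<close>

theorem theorem2p1:
  fixes Ma :: "'a measure" and Md :: "nat \<Rightarrow> 'b measure"
    and a :: "nat \<Rightarrow> nat \<Rightarrow> 'a \<Rightarrow> real"
    and d :: "nat \<Rightarrow> nat \<Rightarrow> nat \<Rightarrow> 'b \<Rightarrow> real"
    and p :: "nat \<Rightarrow> real"
    and \<delta> \<delta>' :: real
  assumes prob_a: "prob_space Ma"
    and indep_a: "prob_space.indep_vars Ma (\<lambda>_. borel) (\<lambda>(x, y). a x y) {(x, y). 1 \<le> x \<and> x \<le> y}"
    and sym_a: "\<And>x y w. 1 \<le> x \<Longrightarrow> 1 \<le> y \<Longrightarrow> w \<in> space Ma \<Longrightarrow> a y x w = a x y w"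
    and odd_a: "\<And>x y k::nat. 1 \<le> x \<Longrightarrow> 1 \<le> y \<Longrightarrow> (\<integral>w. a x y w ^ (2 * k + 1) \<partial>Ma) = 0"
    and var_a: "\<And>x y. 1 \<le> x \<Longrightarrow> 1 \<le> y \<Longrightarrow> (\<integral>w. (a x y w)\<^sup>2 \<partial>Ma) = 1"
    and moments_finite: "\<And>k::nat. moment_sup Ma a (2 * k) < \<infinity>"
    and delta_pos: "\<delta> > 0"
    and moments_bound:
      "\<And>k::nat. 1 \<le> k \<Longrightarrow> moment_sup Ma a (2 * k) \<le> ennreal (real k powr (\<delta> * real k))"
    and p_range: "\<And>N. 1 \<le> N \<Longrightarrow> 0 < p N \<and> p N \<le> real N"
    and prob_d: "\<And>N. 1 \<le> N \<Longrightarrow> prob_space (Md N)"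
    and indep_d: "\<And>N. 1 \<le> N \<Longrightarrow>
      prob_space.indep_vars (Md N) (\<lambda>_. borel) (\<lambda>(x, y). d N x y) {(x, y). 1 \<le> x \<and> x \<le> y \<and> y \<le> N}"
    and sym_d: "\<And>N x y w. 1 \<le> x \<Longrightarrow> x \<le> N \<Longrightarrow> 1 \<le> y \<Longrightarrow> y \<le> N \<Longrightarrow> w \<in> space (Md N) \<Longrightarrow>
      d N y x w = d N x y w"
    and d_one: "\<And>N x y. 1 \<le> x \<Longrightarrow> x \<le> y \<Longrightarrow> y \<le> N \<Longrightarrow>
      \<P>(w in Md N. d N x y w = 1) = p N / real N"
    and d_zero: "\<And>N x y. 1 \<le> x \<Longrightarrow> x \<le> y \<Longrightarrow> y \<le> N \<Longrightarrow>
      \<P>(w in Md N. d N x y w = 0) = 1 - p N / real N"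
    and delta': "\<delta>' > 2 * \<delta>"
    and p_infinity: "filterlim p at_top sequentially"
    and p_growth: "filterlim (\<lambda>N. p N / ln (real N) powr (1 + \<delta>')) at_top sequentially"
  shows "\<forall>\<epsilon>>0. (\<lambda>N. \<P>(w in Ma \<Otimes>\<^sub>M Md N.
            \<bar>spectral_norm (dilute_matrix N (p N)
                (\<lambda>x y. a x y (fst w)) (\<lambda>x y. d N x y (snd w))) - 2\<bar> > \<epsilon>))
          \<longlonglongrightarrow> 0"
proof (intro allI impI)
  fix \<epsilon>0 :: real
  assume \<epsilon>0: "\<epsilon>0 > 0"
  define P where "P N = \<P>(w in Ma \<Otimes>\<^sub>M Md N.
            \<bar>spectral_norm (dilute_matrix N (p N)
                (\<lambda>x y. a x y (fst w)) (\<lambda>x y. d N x y (snd w))) - 2\<bar> > \<epsilon>0)" for N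
  have model: "dilute_model Ma (Md N) a (d N) N (p N)" if "1 \<le> N" for N
    by (rule dilute_model.intro[OF prob_a prob_d[OF that] indep_a sym_a odd_a var_a moments_finite that
          _ _ indep_d[OF that] sym_d d_one d_zero]) (use p_range[OF that] in auto)
  \<comment> \<open>Capping at 1 keeps 2 - \<epsilon> positive.\<close>
  define \<epsilon> where "\<epsilon> = min \<epsilon>0 1"
  have \<epsilon>: "0 < \<epsilon>" "\<epsilon> \<le> \<epsilon>0" "\<epsilon> \<le> 1" using \<epsilon>0 by (auto simp: \<epsilon>_def)
  obtain m where m: "(2 - \<epsilon>) ^ (2 * m) \<le> real (ballot (2 * m) 0) / 4" "0 < ballot (2 * m) 0"
    using exists_return_dominating[OF \<epsilon>(1,3)] .
  have "eventually (\<lambda>N. P N < \<tau>) sequentially" if \<tau>: "\<tau> > 0" for \<tau>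
  proof -
    \<comment> \<open>m is fixed before \<theta>. Two demands bring \<theta> close to 1: the limit
      16 (\<theta>^(4m) - 1) of the lower tail bound has to stay below \<tau>, and 2 \<theta> below
      2 + \<epsilon> so that the upper tail decays.\<close>
    have "((\<lambda>\<theta>. 16 * (\<theta> ^ (4 * m) - 1)) \<longlongrightarrow> 16 * (1 ^ (4 * m) - 1)) (at_right (1::real))"
      by (intro tendsto_intros)
    then have "eventually (\<lambda>\<theta>::real. 16 * (\<theta> ^ (4 * m) - 1) < \<tau>) (at_right 1)"
      using \<tau> by (intro order_tendstoD(2)) auto
    moreover have "eventually (\<lambda>\<theta>::real. 1 < \<theta> \<and> \<theta> < 1 + \<epsilon> / 4) (at_right 1)"
      using eventually_at_right_less \<epsilon>(1) by (intro eventually_conj eventually_at_right_real[of 1 "1 + \<epsilon> / 4", THEN eventually_mono]) auto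
    ultimately have "eventually (\<lambda>\<theta>::real. 16 * (\<theta> ^ (4 * m) - 1) < \<tau> \<and> 1 < \<theta> \<and> \<theta> < 1 + \<epsilon> / 4) (at_right 1)"
      by (rule eventually_conj)
    then obtain \<theta> :: real where \<theta>: "16 * (\<theta> ^ (4 * m) - 1) < \<tau>" "1 < \<theta>" "\<theta> < 1 + \<epsilon> / 4"
      using eventually_happens trivial_limit_at_right_real by blast
    \<comment> \<open>Then (1 + \<epsilon>1) exp \<epsilon>1 \<le> exp (2 \<epsilon>1) \<le> sqrt
      \<theta>, so half of the growth of \<theta>^k is left to absorb factors of N.\<close>
    define \<epsilon>1 where "\<epsilon>1 = min 1 (ln \<theta> / 4)"
    have \<epsilon>1: "0 < \<epsilon>1" "\<epsilon>1 \<le> 5" using \<theta> by (auto simp: \<epsilon>1_def)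
    \<comment> \<open>The 4 makes sqrt \<theta> ^ k at least N^2 and so at least 2 N for N \<ge> 2:
      one factor N for the number of rows, and 2 for the halves in the moment bound.\<close>
    define k where "k N = nat \<lceil>4 * ln (real N) / ln \<theta>\<rceil>" for N :: nat
    define j where "j N = nat \<lceil>(ln (real N))\<^sup>2\<rceil>" for N :: nat
    \<comment> \<open>The added 1 covers the rounding in k once ln N \<ge> 1.\<close>
    define C where "C = 4 / ln \<theta> + 1"
    have C: "1 \<le> C" using \<theta> by (simp add: C_def)
    obtain L0 where L0: "\<And>L k j q. L0 \<le> L \<Longrightarrow> 1 \<le> k \<Longrightarrow> real k \<le> C * L \<Longrightarrow> L\<^sup>2 \<le> real j \<Longrightarrow>
      real j \<le> 2 * L\<^sup>2 \<Longrightarrow> L powr (1 + \<delta>') \<le> q \<Longrightarrow>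
      ((1 + 1 / \<epsilon>1) * (1 + 2 * (2 * real k)) * (exp L)\<^sup>2) ^ k *
        ((exp L)\<^sup>2 * (real (k + j) powr (\<delta> * real (k + j)) / (q ^ (k + j) * (\<epsilon>1 / (5 * real k)) ^ j))) \<le> 1 / 2"
      using tail_term_small[OF delta_pos delta' \<epsilon>1(1) C] by metis
    have k_lim: "filterlim k at_top sequentially"
      unfolding filterlim_sequentially_iff_filterlim_real
    proof (rule filterlim_at_top_mono)
      have "0 < ln \<theta>" using \<theta>(2) by simp
      then show "filterlim (\<lambda>N. 4 * ln (real N) / ln \<theta>) at_top sequentially" by real_asymp
      show "eventually (\<lambda>N. 4 * ln (real N) / ln \<theta> \<le> real (k N)) sequentially"
        unfolding k_def by (intro always_eventually allI real_nat_ceiling_ge)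
    qed
    define F where "F N = (4 * \<theta>\<^sup>2 / (2 + \<epsilon>)\<^sup>2) ^ k N +
      16 * ((1 + (2 * real m * (4 * real m + 1) * 2 ^ (2 * m))\<^sup>2 / (4 * real (k N) * (real (ballot (2 * m) 0))\<^sup>2)) *
      (\<theta> ^ (4 * m) * (1 + (1 / \<theta>) ^ k N)) - ((1 - (2 * real m + 1) / real N) ^ m)\<^sup>2)" for N
    have pow_k: "(\<lambda>N. r ^ k N) \<longlonglongrightarrow> 0" if "0 \<le> r" "r < 1" for r :: real
      using filterlim_compose[OF LIMSEQ_power_zero k_lim, of r] that by simp
    have k_inv: "(\<lambda>N. K / (4 * real (k N) * B)) \<longlonglongrightarrow> 0" for K B :: real
    proof -
      have "(\<lambda>N. inverse (real (k N))) \<longlonglongrightarrow> 0"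
        by (rule filterlim_compose[OF tendsto_inverse_0_at_top[OF filterlim_real_sequentially] k_lim])
      then have "(\<lambda>N. (K / (4 * B)) * inverse (real (k N))) \<longlonglongrightarrow> (K / (4 * B)) * 0"
        by (intro tendsto_intros)
      \<comment> \<open>If x or B is 0, both sides vanish by the convention for division by
        zero.\<close>
      moreover have "K / (4 * x * B) = K / (4 * B) * inverse x" for x
        by (cases "x = 0"; cases "B = 0") (simp_all add: field_simps)
      ultimately show ?thesis by simp
    qed
    have q_lim: "(\<lambda>N. 1 - (2 * real m + 1) / real N) \<longlonglongrightarrow> 1" by real_asymp
    have base: "4 * \<theta>\<^sup>2 / (2 + \<epsilon>)\<^sup>2 < 1"
    proof -
      have "(2 * \<theta>)\<^sup>2 < (2 + \<epsilon>)\<^sup>2" using \<theta> \<epsilon> by (intro power_strict_mono) auto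
      then show ?thesis using \<epsilon> by (simp add: power_mult_distrib)
    qed
    have "F \<longlonglongrightarrow> 0 + 16 * ((1 + 0) * (\<theta> ^ (4 * m) * (1 + 0)) - (1 ^ m)\<^sup>2)"
      unfolding F_def using \<theta> base
      by (intro tendsto_intros pow_k k_inv q_lim) auto
    then have F: "eventually (\<lambda>N. F N < \<tau>) sequentially"
      using \<theta>(1) by (intro order_tendstoD(2)) auto
    have ln_lim: "filterlim (\<lambda>N. ln (real N)) at_top sequentially" by real_asymp
    have ev_k: "eventually (\<lambda>N. max 1 (2 * m) \<le> k N) sequentially"
      using k_lim unfolding filterlim_at_top by blast
    have ev_L: "eventually (\<lambda>N. max L0 1 \<le> ln (real N)) sequentially"
      using ln_lim unfolding filterlim_at_top by blast
    have ev_p: "eventually (\<lambda>N. 1 \<le> p N / ln (real N) powr (1 + \<delta>')) sequentially"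
      using p_growth unfolding filterlim_at_top by blast
    have ev_q: "eventually (\<lambda>N. 1 / 2 < (1 - (2 * real m + 1) / real N) ^ m) sequentially"
      using tendsto_power[OF q_lim, of m] by (intro order_tendstoD(1)) auto
    from F ev_k ev_L ev_p ev_q eventually_ge_at_top[of "2 * m + 2"] show ?thesis
    proof eventually_elim
      fix N
      assume FN: "F N < \<tau>" and kN: "max 1 (2 * m) \<le> k N" and LN: "max L0 1 \<le> ln (real N)"
        and pN: "1 \<le> p N / ln (real N) powr (1 + \<delta>')"
        and qN: "1 / 2 < (1 - (2 * real m + 1) / real N) ^ m" and Nm: "2 * m + 2 \<le> N"
      then have N1: "1 \<le> N" "2 \<le> real N" by auto
      interpret dilute_model Ma "Md N" a "d N" N "p N" by (rule model[OF N1(1)])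
      let ?L = "ln (real N)"
      have L1: "1 \<le> ?L" "L0 \<le> ?L" using LN by auto
      have expL: "exp ?L = real N" using N1 by simp
      have k1: "1 \<le> k N" "2 * m \<le> k N" using kN by auto
      have k_ge: "4 * ?L / ln \<theta> \<le> real (k N)"
        unfolding k_def by (rule real_nat_ceiling_ge)
      have k_le: "real (k N) \<le> C * ?L"
      proof -
        have "0 \<le> 4 * ?L / ln \<theta>" using L1 \<theta> by simp
        then have "real (k N) \<le> 4 * ?L / ln \<theta> + 1" unfolding k_def by linarith
        also have "\<dots> \<le> C * ?L" using L1 by (simp add: C_def distrib_right)
        finally show ?thesis .
      qed
      have j_ge: "?L\<^sup>2 \<le> real (j N)" unfolding j_def by (rule real_nat_ceiling_ge)
      have j_le: "real (j N) \<le> 2 * ?L\<^sup>2"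
      proof -
        have "1 \<le> ?L\<^sup>2" using L1 by simp
        then show ?thesis unfolding j_def by linarith
      qed
      have p_ge: "?L powr (1 + \<delta>') \<le> p N"
        using pN L1 by (simp add: le_divide_eq split: if_splits)
      have sqrt_pow: "real N * 2 \<le> exp (real (k N) * (ln \<theta> / 2))"
      proof -
        have "2 * ?L \<le> real (k N) * (ln \<theta> / 2)" using k_ge \<theta> by (simp add: divide_le_eq)
        then have "exp (2 * ?L) \<le> exp (real (k N) * (ln \<theta> / 2))" by simp
        moreover have "exp (2 * ?L) = real N * real N" by (simp only: exp_double expL power2_eq_square)
        moreover have "real N * 2 \<le> real N * real N" using N1 by (intro mult_left_mono) auto
        ultimately show ?thesis by linarith
      qed
      have \<theta>k: "\<theta> ^ k N = exp (real (k N) * (ln \<theta> / 2)) * exp (real (k N) * (ln \<theta> / 2))"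
        using \<theta> exp_of_nat_mult[of "k N" "ln \<theta>"] by (simp add: exp_add[symmetric] mult.commute)
      have e1: "1 \<le> exp (real (k N) * (ln \<theta> / 2))" using \<theta> by simp
      have N\<theta>: "real N \<le> \<theta> ^ k N"
      proof -
        have "exp (real (k N) * (ln \<theta> / 2)) * 1 \<le> \<theta> ^ k N"
          unfolding \<theta>k using e1 by (intro mult_left_mono) auto
        then show ?thesis using sqrt_pow N1 by linarith
      qed
      have main: "real N * ((1 + \<epsilon>1) * exp \<epsilon>1) ^ k N \<le> \<theta> ^ k N / 2"
      proof -
        have "(1 + \<epsilon>1) * exp \<epsilon>1 \<le> exp \<epsilon>1 * exp \<epsilon>1"
          by (intro mult_right_mono exp_ge_add_one_self) auto
        also have "\<dots> \<le> exp (ln \<theta> / 2)" unfolding exp_add[symmetric] by (simp add: \<epsilon>1_def)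
        finally have "((1 + \<epsilon>1) * exp \<epsilon>1) ^ k N \<le> exp (ln \<theta> / 2) ^ k N"
          using \<epsilon>1 by (intro power_mono) auto
        then have "((1 + \<epsilon>1) * exp \<epsilon>1) ^ k N \<le> exp (real (k N) * (ln \<theta> / 2))"
          by (simp only: exp_of_nat_mult)
        then have "(real N * 2) * ((1 + \<epsilon>1) * exp \<epsilon>1) ^ k N \<le> \<theta> ^ k N"
          unfolding \<theta>k using sqrt_pow \<epsilon>1 by (intro mult_mono) auto
        then show ?thesis by simp
      qed
      have "((1 + 1 / \<epsilon>1) * (1 + 2 * (2 * real (k N))) * (real N)\<^sup>2) ^ k N *
        ((real N)\<^sup>2 * (real (k N + j N) powr (\<delta> * real (k N + j N)) / (p N ^ (k N + j N) * (\<epsilon>1 / (5 * real (k N))) ^ j N))) \<le> 1 / 2"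
        using L0[OF L1(2) k1(1) k_le j_ge j_le p_ge] unfolding expL .
      also have "\<dots> \<le> \<theta> ^ k N / 2" using \<theta>(2) by simp
      finally have tail: "((1 + 1 / \<epsilon>1) * (1 + 2 * (2 * real (k N))) * (real N)\<^sup>2) ^ k N *
        ((real N)\<^sup>2 * (real (k N + j N) powr (\<delta> * real (k N + j N)) / (p N ^ (k N + j N) * (\<epsilon>1 / (5 * real (k N))) ^ j N))) \<le> \<theta> ^ k N / 2" .
      have mom: "moment_sup Ma a (2 * (k N + j N)) \<le> ennreal (real (k N + j N) powr (\<delta> * real (k N + j N)))"
        using k1 by (intro moments_bound) simp
      obtain H where H: "integrable (Ma \<Otimes>\<^sub>M Md N) H" "\<And>\<omega>. W.rho (2 * real (k N)) \<omega> ^ k N \<le> H \<omega>" "P.expectation H \<le> \<theta> ^ k N"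
        using moment_majorant[OF k1(1) \<epsilon>1 mom main tail] by blast
      have "P N \<le> F N"
        unfolding P_def F_def using Nm qN
        by (intro deviation_prob_le[OF \<epsilon>(1,2) \<theta>(2) N\<theta> k1 H m \<epsilon>(3)]) auto
      then show "P N < \<tau>" using FN by linarith
    qed
  qed
  then have "P \<longlonglongrightarrow> 0"
    by (intro order_tendstoI) (auto simp: P_def intro!: always_eventually order.strict_trans2[OF _ measure_nonneg])
  then show "(\<lambda>N. \<P>(w in Ma \<Otimes>\<^sub>M Md N.
            \<bar>spectral_norm (dilute_matrix N (p N)
                (\<lambda>x y. a x y (fst w)) (\<lambda>x y. d N x y (snd w))) - 2\<bar> > \<epsilon>0)) \<longlonglongrightarrow> 0"
    unfolding P_def .
qed

end
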